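(* Let $\mathcal{F}$ and $\mathcal{D}$ be the germs at the origin of $\mathbb{C}^3$ (coordinates $(x,y,z)$) of the singular holomorphic foliations by curves associated, respectively, to the vector fields \begin{align*} X &= 2xy \frac{\partial }{\partial x} + (x^3+2y^2) \frac{\partial }{\partial y} - 2yz \frac{\partial }{\partial z}, \\ Y &= x(x - 2y^2 - y) \frac{\partial }{\partial x} + y(x - y^2 - y) \frac{\partial }{\partial y} - z(x - y^2 - y) \frac{\partial }{\partial z}. \end{align*} Then $\mathcal{F}$ and $\mathcal{D}$ are topologically equivalent. Nonetheless, $\mathcal{F}$ admits two independent holomorphic first integrals, while $\mathcal{D}$ does not admit two independent holomorphic first integrals.
   Context: A singular holomorphic foliation by curves on $(\mathbb{C}^n,0)$ is the one defined, on a neighborhood of the origin, by the local solutions (complex integral curves) of a holomorphic vector field whose singular (zero) set has codimension at least two. Two foliations $\mathcal{F}_1,\mathcal{F}_2$ on $(\mathbb{C}^3,0)$ are topologically equivalent if there is a homeomorphism $h$ between neighborhoods of the origin, with $h(0)=0$, taking the leaves of $\mathcal{F}_1$ to the leaves of $\mathcal{F}_2$. A holomorphic first integral of a foliation on $(\mathbb{C}^3,0)$ is a non-constant holomorphic function $F$ defined on a neighborhood of the origin that is constant on the leaves (equivalently, $dF(Z)=0$ for a vector field $Z$ defining the foliation). Two holomorphic first integrals $F,G$ are independent if they are functionally independent, i.e. $dF\wedge dG\not\equiv 0$. *)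

theory Defs
  imports "HOL-Analysis.Analysis"
begin

text \<open>
  A germ at the origin of a singular holomorphic foliation by curves is represented by a
  holomorphic vector field whose zero set has codimension at least two; two representatives
  give the same leaves on small neighbourhoods.  Germs of functions at the origin are
  represented by total functions, of which only the values near the origin are used.
\<close>

text \<open>Holomorphic in several variables: complex differentiable (Frechet differentiable with
  complex linear derivative) at every point of an open set.\<close>

definition holomorphic_fun :: "(complex^'n::finite \<Rightarrow> complex) \<Rightarrow> (complex^'n) set \<Rightarrow> bool"
  where "holomorphic_fun F U \<longleftrightarrow>
    open U \<and> (\<forall>p\<in>U. \<exists>a. (F has_derivative (\<lambda>v. \<Sum>i\<in>UNIV. a $ i * v $ i)) (at p))"

definition holomorphic_field :: "(complex^'n::finite \<Rightarrow> complex^'n) \<Rightarrow> (complex^'n) set \<Rightarrow> bool"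
  where "holomorphic_field Z U \<longleftrightarrow> (\<forall>i. holomorphic_fun (\<lambda>p. Z p $ i) U)"

definition sing :: "(complex^'n::finite \<Rightarrow> complex^'n) \<Rightarrow> (complex^'n) set"
  where "sing Z = {p. Z p = 0}"

definition integral_curve ::
  "(complex^'n::finite \<Rightarrow> complex^'n) \<Rightarrow> (complex^'n) set \<Rightarrow> complex set \<Rightarrow> (complex \<Rightarrow> complex^'n) \<Rightarrow> bool"
  where "integral_curve Z U D \<phi> \<longleftrightarrow>
    open D \<and> connected D \<and>
    (\<forall>t\<in>D. \<phi> t \<in> U \<and> (\<forall>i. ((\<lambda>s. \<phi> s $ i) has_field_derivative Z (\<phi> t) $ i) (at t)))"

definition same_curve ::
  "(complex^'n::finite \<Rightarrow> complex^'n) \<Rightarrow> (complex^'n) set \<Rightarrow> complex^'n \<Rightarrow> complex^'n \<Rightarrow> bool"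
  where "same_curve Z U p q \<longleftrightarrow>
    (\<exists>D \<phi> s t. integral_curve Z U D \<phi> \<and> s \<in> D \<and> t \<in> D \<and> \<phi> s = p \<and> \<phi> t = q)"

text \<open>The leaf through \<open>p\<close> is obtained by continuing local solutions inside \<open>U\<close>.  A chain of
  solutions is needed because the continuation of a solution may be a multivalued function
  of the time.\<close>

definition leaf ::
  "(complex^'n::finite \<Rightarrow> complex^'n) \<Rightarrow> (complex^'n) set \<Rightarrow> complex^'n \<Rightarrow> (complex^'n) set"
  where "leaf Z U p = {q. (same_curve Z U)\<^sup>*\<^sup>* p q}"

text \<open>The leaves are those of the regular foliation on \<open>U - sing Z\<close>; solutions through points
  of \<open>sing Z\<close> are constant.\<close>

definition leaves ::
  "(complex^'n::finite \<Rightarrow> complex^'n) \<Rightarrow> (complex^'n) set \<Rightarrow> (complex^'n) set set"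
  where "leaves Z U = leaf Z U ` (U - sing Z)"

text \<open>Equality of the two families of leaves makes the correspondence bijective, so both \<open>h\<close>
  and its inverse take leaves to leaves, and \<open>h\<close> maps singular points to singular points.\<close>

definition topologically_equivalent ::
  "(complex^'n::finite \<Rightarrow> complex^'n) \<Rightarrow> (complex^'n \<Rightarrow> complex^'n) \<Rightarrow> bool"
  where "topologically_equivalent Z W \<longleftrightarrow>
    (\<exists>U V h g. open U \<and> 0 \<in> U \<and> open V \<and> 0 \<in> V \<and> homeomorphism U V h g \<and> h 0 = 0 \<and>
      (\<lambda>L. h ` L) ` leaves Z U = leaves W V)"

text \<open>Non-constancy is that of the germ, i.e. on every neighbourhood of the origin; on a
  connected neighbourhood this is ordinary non-constancy, by the identity theorem.\<close>

definition first_integral ::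
  "(complex^'n::finite \<Rightarrow> complex^'n) \<Rightarrow> (complex^'n \<Rightarrow> complex) \<Rightarrow> bool"
  where "first_integral Z F \<longleftrightarrow>
    \<not> (\<exists>c. \<forall>\<^sub>F p in nhds 0. F p = c) \<and>
    (\<exists>U. 0 \<in> U \<and> holomorphic_fun F U \<and> (\<forall>L\<in>leaves Z U. F constant_on L))"

text \<open>The value at \<open>p\<close> of the 2-form $dF \wedge dG$ on the vectors \<open>u\<close> and \<open>v\<close>.\<close>

definition wedge_diff ::
  "(complex^'n::finite \<Rightarrow> complex) \<Rightarrow> (complex^'n \<Rightarrow> complex) \<Rightarrow> complex^'n \<Rightarrow> complex^'n \<Rightarrow> complex^'n \<Rightarrow> complex"
  where "wedge_diff F G p u v =
    frechet_derivative F (at p) u * frechet_derivative G (at p) v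
    - frechet_derivative F (at p) v * frechet_derivative G (at p) u"

text \<open>The germ of $dF \wedge dG$ at the origin is not identically zero.\<close>

definition independent_integrals ::
  "(complex^'n::finite \<Rightarrow> complex) \<Rightarrow> (complex^'n \<Rightarrow> complex) \<Rightarrow> bool"
  where "independent_integrals F G \<longleftrightarrow>
    \<not> (\<forall>\<^sub>F p in nhds 0. \<forall>u v. wedge_diff F G p u v = 0)"

definition X_field :: "complex^3 \<Rightarrow> complex^3"
  where "X_field p = (let x = p $ 1; y = p $ 2; z = p $ 3 in
    vector [2 * x * y, x ^ 3 + 2 * y ^ 2, - 2 * y * z])"

definition Y_field :: "complex^3 \<Rightarrow> complex^3"
  where "Y_field p = (let x = p $ 1; y = p $ 2; z = p $ 3 in
    vector [x * (x - 2 * y ^ 2 - y), y * (x - y ^ 2 - y), - z * (x - y ^ 2 - y)])"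

text \<open>Both vector fields do define foliations in the above sense: they are holomorphic, and
  near the origin each zero set is the \<open>z\<close>-axis, of codimension two.\<close>

lemma has_derivative_coord: "((\<lambda>p::complex^'n::finite. p $ k) has_derivative (\<lambda>v. v $ k)) (at p)"
  by (rule bounded_linear_imp_has_derivative) (rule bounded_linear_vec_nth)

lemma holomorphic_X_field: "holomorphic_field X_field UNIV"
proof -
  have "\<exists>a. ((\<lambda>p. X_field p $ i) has_derivative (\<lambda>v. \<Sum>i\<in>UNIV. a $ i * v $ i)) (at p)" for i p
  proof -
    consider "i = 1" | "i = 2" | "i = 3" using exhaust_3 by blast
    then show ?thesis
    proof cases
      case 1
      show ?thesis
        by (rule exI[of _ "vector [2 * p $ 2, 2 * p $ 1, 0]"])
          (auto simp: X_field_def Let_def 1 sum_3 algebra_simps power2_eq_square intro!: derivative_eq_intros has_derivative_coord)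
    next
      case 2
      show ?thesis
        by (rule exI[of _ "vector [3 * (p $ 1)^2, 4 * p $ 2, 0]"])
          (auto simp: X_field_def Let_def 2 sum_3 algebra_simps power2_eq_square intro!: derivative_eq_intros has_derivative_coord)
    next
      case 3
      show ?thesis
        by (rule exI[of _ "vector [0, - 2 * p $ 3, - 2 * p $ 2]"])
          (auto simp: X_field_def Let_def 3 sum_3 algebra_simps power2_eq_square intro!: derivative_eq_intros has_derivative_coord)
    qed
  qed
  then show ?thesis by (simp add: holomorphic_field_def holomorphic_fun_def)
qed

lemma holomorphic_Y_field: "holomorphic_field Y_field UNIV"
proof -
  have "\<exists>a. ((\<lambda>p. Y_field p $ i) has_derivative (\<lambda>v. \<Sum>i\<in>UNIV. a $ i * v $ i)) (at p)" for i p
  proof -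
    consider "i = 1" | "i = 2" | "i = 3" using exhaust_3 by blast
    then show ?thesis
    proof cases
      case 1
      show ?thesis
        by (rule exI[of _ "vector [2 * p $ 1 - 2 * (p $ 2)^2 - p $ 2, - p $ 1 * (4 * p $ 2 + 1), 0]"])
          (auto simp: Y_field_def Let_def 1 sum_3 algebra_simps power2_eq_square intro!: derivative_eq_intros has_derivative_coord)
    next
      case 2
      show ?thesis
        by (rule exI[of _ "vector [p $ 2, p $ 1 - 3 * (p $ 2)^2 - 2 * p $ 2, 0]"])
          (auto simp: Y_field_def Let_def 2 sum_3 algebra_simps power2_eq_square intro!: derivative_eq_intros has_derivative_coord)
    next
      case 3
      show ?thesis
        by (rule exI[of _ "vector [- p $ 3, p $ 3 * (2 * p $ 2 + 1), - (p $ 1 - (p $ 2)^2 - p $ 2)]"])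
          (auto simp: Y_field_def Let_def 3 sum_3 algebra_simps power2_eq_square intro!: derivative_eq_intros has_derivative_coord)
    qed
  qed
  then show ?thesis by (simp add: holomorphic_field_def holomorphic_fun_def)
qed

lemma sing_X_field: "sing X_field = {p. p $ 1 = 0 \<and> p $ 2 = 0}"
  by (auto simp: sing_def X_field_def Let_def vec_eq_iff forall_3)

lemma sing_Y_field: "sing Y_field \<inter> ball 0 1 = {p. p $ 1 = 0 \<and> p $ 2 = 0} \<inter> ball 0 1"
proof -
  have "p $ 1 = 0 \<and> p $ 2 = 0" if Y: "Y_field p = 0" and p: "p \<in> ball 0 1" for p
  proof -
    have y: "norm (p $ 2) < 1"
      using Finite_Cartesian_Product.norm_nth_le[of p 2] p by simp
    have "p $ 1 = 0 \<or> p $ 1 - 2 * (p $ 2)^2 - p $ 2 = 0"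
      and "p $ 2 = 0 \<or> p $ 1 - (p $ 2)^2 - p $ 2 = 0"
      using Y by (auto simp: Y_field_def Let_def vec_eq_iff forall_3)
    then have e1: "p $ 1 = 0 \<or> p $ 1 = 2 * (p $ 2)^2 + p $ 2"
      and e2: "p $ 2 = 0 \<or> p $ 1 = (p $ 2)^2 + p $ 2"
      by (simp_all only: diff_diff_eq right_minus_eq)
    have ne: "p $ 2 \<noteq> - 1" using y by auto
    show ?thesis
    proof (cases "p $ 2 = 0")
      case True
      then show ?thesis using e1 by auto
    next
      case False
      then have e: "p $ 1 = (p $ 2)^2 + p $ 2" using e2 by blast
      have "p $ 1 \<noteq> 0"
      proof
        assume "p $ 1 = 0"
        then have "p $ 2 * (p $ 2 + 1) = 0"
          using e by (simp only: power2_eq_square distrib_left mult_1_right)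
        then show False
          using False ne by (simp only: mult_eq_0_iff eq_neg_iff_add_eq_0 simp_thms)
      qed
      then have "p $ 1 = 2 * (p $ 2)^2 + p $ 2" using e1 by blast
      with e have "2 * (p $ 2)^2 + p $ 2 = (p $ 2)^2 + p $ 2" by (simp only:)
      then have "(p $ 2)^2 = 0" by (simp only: add_right_cancel) simp
      then show ?thesis using False by simp
    qed
  qed
  moreover have "Y_field p = 0" if "p $ 1 = 0 \<and> p $ 2 = 0" for p
    using that by (simp add: Y_field_def Let_def vec_eq_iff forall_3)
  ultimately show ?thesis unfolding sing_def by blast
qed

end

theory Submission
  imports Defs "HOL-Complex_Analysis.Complex_Analysis"
begin

text \<open>
  In the blow-up both foliations become explicit. For \<open>X\<close> the slope \<open>t = y/x\<close> has
  \<open>t\<^sup>2 - x\<close> and \<open>x z\<close> constant on the leaves, hence the integrals \<open>x z\<close> and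
  \<open>z\<^sup>2 (y\<^sup>2 - x\<^sup>3)\<close>. For \<open>Y\<close>, name the coordinates \<open>v, u, z\<close> and put
  \<open>m = v / (u (1 + u))\<close>, \<open>a = Ln (1 + u)\<close>: then \<open>1/m + Ln m + a\<close> and \<open>u z\<close> are constant on the
  leaves.

  A first integral of \<open>Y\<close> is a power series with coefficients \<open>c i j k\<close>. For fixed \<open>k\<close> and
  \<open>d n i = c i (n - i) k\<close>, the equation \<open>Y F = 0\<close> reads
  \<open>(n - k) (d n (i - 1) - d n i) = (i + n - 1 - k) d (n - 1) i\<close>. It gives \<open>d n = 0\<close> for \<open>n < k\<close>.
  If the largest \<open>D\<close> with \<open>d k D \<noteq> 0\<close> were positive, the largest index in the support of
  \<open>d (k + m)\<close> would be exactly \<open>D - m\<close>, and the equation for \<open>d (k + D + 1)\<close> would have no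
  solution. So only the powers of \<open>u z\<close> remain, and two such functions are dependent.

  For the equivalence let \<open>x = - 2 a\<close>. The leaves are \<open>t\<^sup>2 = x + const\<close> and
  \<open>2 (1/m + Ln m) = x + const\<close>; both are folded over the \<open>x\<close>-axis, along \<open>t = 0\<close> and \<open>m = 1\<close>.
  Near \<open>m = 1\<close> a holomorphic \<open>t = \<kappa> m\<close> with \<open>(\<kappa> m)\<^sup>2 = 2 (1/m + Ln m - 1)\<close> matches them.
  Elsewhere the leaves are transverse to the fibres \<open>x = const\<close>, so one may extend \<open>\<kappa>\<close> to any
  homeomorphism \<open>theta\<close> of the fibre \<open>x = 0\<close> and transport it along the leaves. The third
  coordinate is adjusted so that \<open>x z\<close> corresponds to \<open>u z\<close>.
\<close>

text \<open>The obstacle is that the invariant of \<open>X\<close> on a fibre is the single-valued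
  \<open>t^2\<close>, whereas \<open>1/m + Ln m\<close> is multivalued around \<open>m = 0\<close>:
  its derivative has residue 1 there, so a holomorphic \<open>\<kappa>\<close> cannot exist on the
  whole fibre. Short transport avoids global branches of \<open>Ln m\<close>: a small time
  multiplies \<open>m\<close> by \<open>exp l\<close> with \<open>l\<close> small, and all estimates
  concern this \<open>l\<close>. Exact matching of invariants is unavoidable only at the fold, where
  a leaf meets nearby fibres in two close points that must receive opposite slopes. The second
  delicate place is the plane \<open>u = 0\<close>, which is \<open>m = \<infinity>\<close> in the
  blow-up. There \<open>m * a\<close> is comparable to \<open>v\<close>, so bounds stated through
  \<open>m * a\<close> stay uniform in \<open>m\<close>, and a fibre map at bounded distance from
  \<open>m\<close> extends continuously over the plane. No inverse map is ever written down.
  Injectivity comes from Lipschitz estimates, and invariance of domain then supplies openness twice: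
  in space for the homeomorphism, and in the complex plane for the parameter of a plaque.\<close>

no_notation fps_nth (infixl \<open>$\<close> 75)

subsection \<open>Leaves\<close>

lemma same_curve_sym: "same_curve Z U p q \<Longrightarrow> same_curve Z U q p"
  unfolding same_curve_def by blast

lemma leaf_refl: "p \<in> leaf Z U p"
  by (simp add: leaf_def)

lemma leaf_trans: "q \<in> leaf Z U p \<Longrightarrow> r \<in> leaf Z U q \<Longrightarrow> r \<in> leaf Z U p"
  by (auto simp: leaf_def)

lemma leaf_sym:
  assumes "q \<in> leaf Z U p"
  shows "p \<in> leaf Z U q"
proof -
  have "symp (same_curve Z U)"
    by (auto intro: sympI same_curve_sym)
  then have "symp (same_curve Z U)\<^sup>*\<^sup>*"
    by (rule symp_rtranclp)
  then show ?thesis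
    using assms by (auto simp: leaf_def dest: sympD)
qed

lemma leaf_subset:
  assumes "p \<in> U"
  shows "leaf Z U p \<subseteq> U"
proof
  fix q assume "q \<in> leaf Z U p"
  then have "(same_curve Z U)\<^sup>*\<^sup>* p q" by (simp add: leaf_def)
  then show "q \<in> U"
    by induction (auto simp: same_curve_def integral_curve_def assms)
qed

text \<open>\<open>integral_curve\<close> prescribes the speed of a solution, while a plaque only
  has the right direction, with derivative \<open>\<mu> * Z\<close>. Composing with a local inverse
  of a primitive \<open>P\<close> of \<open>\<mu>\<close> removes the factor; the inverse exists
  because \<open>\<mu>\<close> has no zero.\<close>

lemma local_plaque_in_leaf:
  assumes "open W" "c \<in> W"
    and "\<And>\<tau>. \<tau> \<in> W \<Longrightarrow> \<psi> \<tau> \<in> U"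
    and der: "\<And>\<tau> i. \<tau> \<in> W \<Longrightarrow>
      ((\<lambda>\<sigma>. \<psi> \<sigma> $ i) has_field_derivative \<mu> \<tau> * Z (\<psi> \<tau>) $ i) (at \<tau>)"
    and hol: "\<mu> holomorphic_on W" and nz: "\<And>\<tau>. \<tau> \<in> W \<Longrightarrow> \<mu> \<tau> \<noteq> 0"
  obtains r where "r > 0" "ball c r \<subseteq> W" "\<And>\<tau>. \<tau> \<in> ball c r \<Longrightarrow> same_curve Z U (\<psi> c) (\<psi> \<tau>)"
proof -
  obtain r0 where r0: "r0 > 0" "ball c r0 \<subseteq> W"
    using assms(1,2) openE by blast
  have "\<mu> holomorphic_on ball c r0"
    using hol r0 holomorphic_on_subset by blast
  then obtain P where P: "\<And>x. x \<in> ball c r0 \<Longrightarrow> (P has_field_derivative \<mu> x) (at x within ball c r0)"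
    using holomorphic_convex_primitive'[of "ball c r0" \<mu>] by (auto simp: convex_ball)
  then have P: "(P has_field_derivative \<mu> x) (at x)" if "x \<in> ball c r0" for x
    using that at_within_open[OF that] by force
  have Phol: "P holomorphic_on ball c r0"
    using P by (meson holomorphic_on_open open_ball)
  have dP: "deriv P x = \<mu> x" if "x \<in> ball c r0" for x
    using P[OF that] by (rule DERIV_imp_deriv)
  have "deriv P c \<noteq> 0"
    using r0 dP[of c] nz[OF assms(2)] by simp
  then obtain r where r: "r > 0" "ball c r \<subseteq> ball c r0" "inj_on P (ball c r)"
    using has_complex_derivative_locally_injective[OF Phol, of c] r0 by (metis centre_in_ball open_ball)
  have Pholr: "P holomorphic_on ball c r"
    using Phol r(2) holomorphic_on_subset by blast
  obtain g where g: "g holomorphic_on (P ` ball c r)"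
      "\<And>z. z \<in> ball c r \<Longrightarrow> deriv P z * deriv g (P z) = 1"
      "\<And>z. z \<in> ball c r \<Longrightarrow> g (P z) = z"
    using holomorphic_has_inverse[OF Pholr open_ball r(3)] by metis
  define D where "D = P ` ball c r"
  have oD: "open D"
    unfolding D_def using open_mapping_thm3[OF Pholr open_ball r(3)] .
  have cD: "connected D"
    unfolding D_def using Pholr
    by (intro connected_continuous_image) (auto simp: holomorphic_on_imp_continuous_on)
  have "integral_curve Z U D (\<psi> \<circ> g)"
    unfolding integral_curve_def
  proof (intro conjI ballI allI oD cD)
    fix t assume "t \<in> D"
    then obtain \<tau> where \<tau>: "\<tau> \<in> ball c r" "t = P \<tau>" by (auto simp: D_def)
    have \<tau>W: "\<tau> \<in> W" using \<tau> r r0 by blast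
    show "(\<psi> \<circ> g) t \<in> U"
      using \<tau> \<tau>W g(3) assms(3) by simp
    fix i
    have "deriv g t = 1 / \<mu> \<tau>"
      using g(2)[OF \<tau>(1)] dP[of \<tau>] \<tau> r(2) nz[OF \<tau>W] by (simp add: subset_iff field_simps)
    moreover have "(g has_field_derivative deriv g t) (at t)"
      using holomorphic_derivI[OF g(1)] \<open>t \<in> D\<close> oD unfolding D_def by blast
    ultimately have gd: "(g has_field_derivative 1 / \<mu> \<tau>) (at t)" by simp
    have "((\<lambda>\<sigma>. \<psi> \<sigma> $ i) has_field_derivative \<mu> \<tau> * Z (\<psi> \<tau>) $ i) (at (g t))"
      using der[OF \<tau>W, of i] g(3)[OF \<tau>(1)] \<tau>(2) by simp
    from DERIV_chain2[OF this gd]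
    have "((\<lambda>s. \<psi> (g s) $ i) has_field_derivative (\<mu> \<tau> * Z (\<psi> \<tau>) $ i) * (1 / \<mu> \<tau>)) (at t)" .
    then show "((\<lambda>s. (\<psi> \<circ> g) s $ i) has_field_derivative Z ((\<psi> \<circ> g) t) $ i) (at t)"
      using nz[OF \<tau>W] g(3)[OF \<tau>(1)] \<tau>(2) by (simp add: field_simps)
  qed
  then have "same_curve Z U (\<psi> c) (\<psi> \<tau>)" if "\<tau> \<in> ball c r" for \<tau>
    unfolding same_curve_def using that r(1) g(3)
    by (intro exI[of _ D] exI[of _ "\<psi> \<circ> g"] exI[of _ "P c"] exI[of _ "P \<tau>"]) (auto simp: D_def)
  moreover have "ball c r \<subseteq> W" using r r0 by blast
  ultimately show ?thesis using r(1) that by blast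
qed

text \<open>The condition is local in the time of each solution, so it can be checked inside one
  plaque. The pair \<open>Z U\<close> is the source, \<open>W V\<close> the target.\<close>

definition follows_leaves ::
  "(complex^'n::finite \<Rightarrow> complex^'n) \<Rightarrow> (complex^'n) set \<Rightarrow> (complex^'n \<Rightarrow> complex^'n) \<Rightarrow>
   (complex^'n) set \<Rightarrow> (complex^'n \<Rightarrow> complex^'n) \<Rightarrow> bool"
  where "follows_leaves Z U W V f \<longleftrightarrow> (\<forall>D \<phi> c. integral_curve Z U D \<phi> \<longrightarrow> c \<in> D \<longrightarrow>
    (\<exists>r>0. ball c r \<subseteq> D \<and> (\<forall>t\<in>ball c r. f (\<phi> t) \<in> leaf W V (f (\<phi> c)))))"

text \<open>Lying in the same leaf is an equivalence relation. Along one solution it holds locally,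
  so connectedness of the time domain makes it hold throughout; a leaf is a chain of such
  solutions.\<close>

lemma locally_followed_leaf:
  assumes "q \<in> leaf Z U p"
    and "follows_leaves Z U W V f"
  shows "f q \<in> leaf W V (f p)"
proof -
  have stp: "f q \<in> leaf W V (f p)" if same: "same_curve Z U p q" for p q
  proof -
    obtain D \<phi> s t where *: "integral_curve Z U D \<phi>" "s \<in> D" "t \<in> D" "\<phi> s = p" "\<phi> t = q"
      using same by (auto simp: same_curve_def)
    have D: "open D" "connected D" using *(1) by (auto simp: integral_curve_def)
    have "f (\<phi> t) \<in> leaf W V (f (\<phi> s))"
    proof (rule connected_equivalence_relation[of D s t "\<lambda>b c. f (\<phi> c) \<in> leaf W V (f (\<phi> b))"])
      fix a assume a: "a \<in> D"
      obtain r where "r > 0" "ball a r \<subseteq> D" "\<And>\<tau>. \<tau> \<in> ball a r \<Longrightarrow> f (\<phi> \<tau>) \<in> leaf W V (f (\<phi> a))"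
        using assms(2) *(1) a unfolding follows_leaves_def by meson
      then show "\<exists>T. openin (top_of_set D) T \<and> a \<in> T \<and> (\<forall>x\<in>T. f (\<phi> x) \<in> leaf W V (f (\<phi> a)))"
        by (intro exI[of _ "ball a r"]) (auto simp: openin_open_eq D)
    qed (simp_all add: * D leaf_sym, rule leaf_trans)
    with * show ?thesis by simp
  qed
  have "(same_curve Z U)\<^sup>*\<^sup>* p q" using assms(1) by (simp add: leaf_def)
  then show ?thesis
  proof induction
    case base
    show ?case by (rule leaf_refl)
  next
    case (step y z)
    show ?case using leaf_trans[OF step.IH stp[OF step.hyps(2)]] .
  qed
qed

text \<open>Each of the two local conditions yields one inclusion between the image of a leaf and
  the leaf of the image point. The condition on zeros matches the sets of points whose leaves are
  counted.\<close>

lemma topologically_equivalentI: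
  assumes "open U" "0 \<in> U" "open V" "0 \<in> V" "homeomorphism U V h g" "h 0 = 0"
    and sing: "\<And>p. p \<in> U \<Longrightarrow> h p \<in> sing W \<longleftrightarrow> p \<in> sing Z"
    and h: "follows_leaves Z U W V h" and g: "follows_leaves W V Z U g"
  shows "topologically_equivalent Z W"
proof -
  have hg: "\<And>x. x \<in> U \<Longrightarrow> g (h x) = x" "\<And>y. y \<in> V \<Longrightarrow> h (g y) = y" "h ` U = V" "g ` V = U"
    using assms(5) by (auto simp: homeomorphism_def)
  have eq: "h ` leaf Z U p = leaf W V (h p)" if p: "p \<in> U" for p
  proof (intro equalityI subsetI)
    fix q assume "q \<in> h ` leaf Z U p"
    then show "q \<in> leaf W V (h p)" using locally_followed_leaf[OF _ h] by blast
  next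
    fix q assume q: "q \<in> leaf W V (h p)"
    have qV: "q \<in> V" using q leaf_subset[of "h p" V W] hg p by blast
    have "g q \<in> leaf Z U p" using locally_followed_leaf[OF q g] hg(1)[OF p] by simp
    then show "q \<in> h ` leaf Z U p" using hg(2)[OF qV] by (metis image_eqI)
  qed
  have V: "V - sing W = h ` (U - sing Z)" using hg(3) sing by auto
  have "(\<lambda>L. h ` L) ` leaves Z U = leaves W V"
    unfolding leaves_def V image_image using eq by (auto intro!: image_cong)
  then show ?thesis using assms(1-6) unfolding topologically_equivalent_def by blast
qed

subsection \<open>Plaques and first integrals\<close>

text \<open>The parameter of \<open>plaqueX\<close> is the slope \<open>y/x\<close>, that of \<open>plaqueY\<close> is the time of the field
  \<open>Y/u\<^sup>2\<close>, in which the slope \<open>v/u\<close> decays exponentially. The leaves in the invariant planes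
  \<open>x = 0\<close> of \<open>X\<close> and \<open>u = 0\<close> of \<open>Y\<close> are parametrised separately.\<close>

definition plaqueX :: "complex \<Rightarrow> complex \<Rightarrow> complex \<Rightarrow> complex^3"
  where "plaqueX C w t = vector [t\<^sup>2 - C, t * (t\<^sup>2 - C), w / (t\<^sup>2 - C)]"

definition plaqueX0 :: "complex \<Rightarrow> complex \<Rightarrow> complex^3"
  where "plaqueX0 k y = vector [0, y, k / y]"

definition slopeY :: "complex \<Rightarrow> complex \<Rightarrow> complex"
  where "slopeY s0 \<tau> = s0 * exp (- \<tau>)"

definition coordY :: "complex \<Rightarrow> complex \<Rightarrow> complex \<Rightarrow> complex"
  where "coordY s0 u0 \<tau> = exp (- \<tau>) * (1 + u0 + s0 * \<tau>) - 1"

definition plaqueY :: "complex \<Rightarrow> complex \<Rightarrow> complex \<Rightarrow> complex \<Rightarrow> complex^3"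
  where "plaqueY s0 u0 k \<tau> =
    vector [slopeY s0 \<tau> * coordY s0 u0 \<tau>, coordY s0 u0 \<tau>, k / coordY s0 u0 \<tau>]"

definition plaqueY0 :: "complex \<Rightarrow> complex \<Rightarrow> complex^3"
  where "plaqueY0 k v = vector [v, 0, k / v]"

lemma has_field_derivative_vec3:
  fixes f :: "complex \<Rightarrow> complex^3"
  assumes "\<And>\<sigma>. f \<sigma> = vector [f1 \<sigma>, f2 \<sigma>, f3 \<sigma>]"
    and "(f1 has_field_derivative d1) F" "(f2 has_field_derivative d2) F" "(f3 has_field_derivative d3) F"
    and "d1 = \<mu> * d $ 1" "d2 = \<mu> * d $ 2" "d3 = \<mu> * d $ 3"
  shows "((\<lambda>\<sigma>. f \<sigma> $ i) has_field_derivative \<mu> * d $ i) F"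
  using assms exhaust_3[of i] by auto

text \<open>Along \<open>X\<close> the slope \<open>t = y/x\<close> has derivative
  \<open>x^2\<close>, whence the factor \<open>1/x^2\<close>.\<close>

lemma deriv_plaqueX:
  assumes "t\<^sup>2 \<noteq> C"
  shows "((\<lambda>\<sigma>. plaqueX C w \<sigma> $ i) has_field_derivative
    (1 / (t\<^sup>2 - C)\<^sup>2) * X_field (plaqueX C w t) $ i) (at t)"
proof (rule has_field_derivative_vec3[OF plaqueX_def])
  define x where "x = t\<^sup>2 - C"
  have x: "x \<noteq> 0" using assms by (simp add: x_def)
  show "((\<lambda>\<sigma>. \<sigma>\<^sup>2 - C) has_field_derivative 2 * t) (at t)"
    by (auto intro!: derivative_eq_intros)
  show "((\<lambda>\<sigma>. \<sigma> * (\<sigma>\<^sup>2 - C)) has_field_derivative x + 2 * t\<^sup>2) (at t)"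
    by (auto intro!: derivative_eq_intros simp: x_def power2_eq_square)
  have "((\<lambda>\<sigma>. w / (\<sigma>\<^sup>2 - C)) has_field_derivative (0 * (t\<^sup>2 - C) - w * (2 * t)) / ((t\<^sup>2 - C) * (t\<^sup>2 - C))) (at t)"
    by (rule DERIV_divide) (use assms in \<open>auto intro!: derivative_eq_intros\<close>)
  then show "((\<lambda>\<sigma>. w / (\<sigma>\<^sup>2 - C)) has_field_derivative - (2 * t * w / x\<^sup>2)) (at t)"
    by (simp add: x_def power2_eq_square mult_ac)
  show "2 * t = 1 / (t\<^sup>2 - C)\<^sup>2 * X_field (plaqueX C w t) $ 1"
      "x + 2 * t\<^sup>2 = 1 / (t\<^sup>2 - C)\<^sup>2 * X_field (plaqueX C w t) $ 2"
      "- (2 * t * w / x\<^sup>2) = 1 / (t\<^sup>2 - C)\<^sup>2 * X_field (plaqueX C w t) $ 3"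
    using x unfolding plaqueX_def X_field_def Let_def vector_3 x_def[symmetric]
    by (simp_all add: field_simps power2_eq_square power3_eq_cube)
qed

lemma deriv_plaqueX0:
  assumes "y \<noteq> 0"
  shows "((\<lambda>\<sigma>. plaqueX0 k \<sigma> $ i) has_field_derivative
    (1 / (2 * y\<^sup>2)) * X_field (plaqueX0 k y) $ i) (at y)"
proof (rule has_field_derivative_vec3[OF plaqueX0_def])
  show "((\<lambda>\<sigma>. 0) has_field_derivative 0) (at y)" "((\<lambda>\<sigma>. \<sigma>) has_field_derivative 1) (at y)"
    by simp_all
  have "((\<lambda>\<sigma>. k / \<sigma>) has_field_derivative (0 * y - k * 1) / (y * y)) (at y)"
    by (rule DERIV_divide) (use assms in auto)
  then show "((\<lambda>\<sigma>. k / \<sigma>) has_field_derivative - (k / y\<^sup>2)) (at y)"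
    by (simp add: power2_eq_square)
qed (use assms in \<open>simp_all add: plaqueX0_def X_field_def Let_def field_simps power2_eq_square\<close>)

lemma deriv_slopeY: "(slopeY s0 has_field_derivative - slopeY s0 \<tau>) (at \<tau>)"
  unfolding slopeY_def[abs_def] by (auto intro!: derivative_eq_intros)

lemma deriv_coordY:
  "(coordY s0 u0 has_field_derivative slopeY s0 \<tau> - 1 - coordY s0 u0 \<tau>) (at \<tau>)"
proof -
  have "(coordY s0 u0 has_field_derivative
      (exp (- \<tau>) * (- 1)) * (1 + u0 + s0 * \<tau>) + s0 * exp (- \<tau>)) (at \<tau>)"
    unfolding coordY_def[abs_def] by (auto intro!: derivative_eq_intros)
  then show ?thesis by (simp add: slopeY_def coordY_def algebra_simps)
qed

lemma deriv_plaqueY: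
  assumes "coordY s0 u0 \<tau> \<noteq> 0"
  shows "((\<lambda>\<sigma>. plaqueY s0 u0 k \<sigma> $ i) has_field_derivative
    (1 / (coordY s0 u0 \<tau>)\<^sup>2) * Y_field (plaqueY s0 u0 k \<tau>) $ i) (at \<tau>)"
proof (rule has_field_derivative_vec3[OF plaqueY_def])
  define s where "s = slopeY s0 \<tau>"
  define u where "u = coordY s0 u0 \<tau>"
  have u: "u \<noteq> 0" using assms by (simp add: u_def)
  have ds: "(slopeY s0 has_field_derivative - s) (at \<tau>)"
    unfolding s_def by (rule deriv_slopeY)
  have du: "(coordY s0 u0 has_field_derivative s - 1 - u) (at \<tau>)"
    unfolding s_def u_def by (rule deriv_coordY)
  show "(coordY s0 u0 has_field_derivative s - 1 - u) (at \<tau>)" by (rule du)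
  show "((\<lambda>\<sigma>. slopeY s0 \<sigma> * coordY s0 u0 \<sigma>) has_field_derivative
      - s * coordY s0 u0 \<tau> + (s - 1 - u) * slopeY s0 \<tau>) (at \<tau>)"
    by (rule DERIV_mult[OF ds du])
  show "((\<lambda>\<sigma>. k / coordY s0 u0 \<sigma>) has_field_derivative
      (0 * coordY s0 u0 \<tau> - k * (s - 1 - u)) / (coordY s0 u0 \<tau> * coordY s0 u0 \<tau>)) (at \<tau>)"
    by (rule DERIV_divide[OF DERIV_const du assms])
  show "- s * coordY s0 u0 \<tau> + (s - 1 - u) * slopeY s0 \<tau> =
      1 / (coordY s0 u0 \<tau>)\<^sup>2 * Y_field (plaqueY s0 u0 k \<tau>) $ 1"
      "s - 1 - u = 1 / (coordY s0 u0 \<tau>)\<^sup>2 * Y_field (plaqueY s0 u0 k \<tau>) $ 2"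
      "(0 * coordY s0 u0 \<tau> - k * (s - 1 - u)) / (coordY s0 u0 \<tau> * coordY s0 u0 \<tau>) =
      1 / (coordY s0 u0 \<tau>)\<^sup>2 * Y_field (plaqueY s0 u0 k \<tau>) $ 3"
    using u unfolding plaqueY_def Y_field_def Let_def vector_3 s_def[symmetric] u_def[symmetric]
    by (simp_all add: field_simps power2_eq_square)
qed

lemma deriv_plaqueY0:
  assumes "v \<noteq> 0"
  shows "((\<lambda>\<sigma>. plaqueY0 k \<sigma> $ i) has_field_derivative
    (1 / v\<^sup>2) * Y_field (plaqueY0 k v) $ i) (at v)"
proof (rule has_field_derivative_vec3[OF plaqueY0_def])
  show "((\<lambda>\<sigma>. 0) has_field_derivative 0) (at v)" "((\<lambda>\<sigma>. \<sigma>) has_field_derivative 1) (at v)"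
    by simp_all
  have "((\<lambda>\<sigma>. k / \<sigma>) has_field_derivative (0 * v - k * 1) / (v * v)) (at v)"
    by (rule DERIV_divide) (use assms in auto)
  then show "((\<lambda>\<sigma>. k / \<sigma>) has_field_derivative - (k / v\<^sup>2)) (at v)"
    by (simp add: power2_eq_square)
qed (use assms in \<open>simp_all add: plaqueY0_def Y_field_def Let_def field_simps power2_eq_square\<close>)

lemma has_field_derivative_along_curve:
  fixes F :: "complex^'n::finite \<Rightarrow> complex"
  assumes F: "(F has_derivative (\<lambda>v. \<Sum>i\<in>UNIV. a $ i * v $ i)) (at (\<psi> \<tau>))"
    and \<psi>: "\<And>i. ((\<lambda>\<sigma>. \<psi> \<sigma> $ i) has_field_derivative d $ i) (at \<tau>)"
  shows "((\<lambda>\<sigma>. F (\<psi> \<sigma>)) has_field_derivative (\<Sum>i\<in>UNIV. a $ i * d $ i)) (at \<tau>)"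
proof -
  have "(\<psi> has_derivative (\<lambda>h. h *s d)) (at \<tau>)"
  proof (subst has_derivative_componentwise_within, intro ballI)
    fix b :: "complex^'n" assume "b \<in> Basis"
    then obtain i c where b: "b = axis i c" by (auto simp: Basis_vec_def)
    have "((\<lambda>\<sigma>. \<psi> \<sigma> $ i) has_derivative (\<lambda>h. d $ i * h)) (at \<tau>)"
      using \<psi>[of i] by (simp add: has_field_derivative_def)
    then have "((\<lambda>\<sigma>. (\<psi> \<sigma> $ i) \<bullet> c) has_derivative (\<lambda>h. (d $ i * h) \<bullet> c)) (at \<tau>)"
      by (rule has_derivative_inner_left)
    then show "((\<lambda>x. \<psi> x \<bullet> b) has_derivative (\<lambda>x. (x *s d) \<bullet> b)) (at \<tau>)"
      by (simp add: b inner_axis mult.commute)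
  qed
  from diff_chain_at[OF this F]
  have "((\<lambda>\<sigma>. F (\<psi> \<sigma>)) has_derivative (\<lambda>h. \<Sum>i\<in>UNIV. a $ i * (h * d $ i))) (at \<tau>)"
    by (simp add: o_def)
  moreover have "(\<lambda>h. \<Sum>i\<in>UNIV. a $ i * (h * d $ i)) = (*) (\<Sum>i\<in>UNIV. a $ i * d $ i)"
    by (auto simp: sum_distrib_left sum_distrib_right mult_ac)
  ultimately show ?thesis by (simp add: has_field_derivative_def)
qed

lemma constant_on_leafI:
  assumes "\<And>p. p \<in> U \<Longrightarrow> (F has_derivative (\<lambda>v. \<Sum>i\<in>UNIV. A p $ i * v $ i)) (at p)"
    and "\<And>p. p \<in> U \<Longrightarrow> (\<Sum>i\<in>UNIV. A p $ i * Z p $ i) = 0"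
  shows "F constant_on leaf Z U p"
proof -
  have step: "F q = F p" if same: "same_curve Z U p q" for p q
  proof -
    obtain D \<phi> s t where *: "integral_curve Z U D \<phi>" "s \<in> D" "t \<in> D" "\<phi> s = p" "\<phi> t = q"
      using same by (auto simp: same_curve_def)
    have D: "open D" "connected D" using *(1) by (auto simp: integral_curve_def)
    have "((\<lambda>\<sigma>. F (\<phi> \<sigma>)) has_field_derivative 0) (at \<tau>)" if "\<tau> \<in> D" for \<tau>
    proof -
      have d: "((\<lambda>\<sigma>. \<phi> \<sigma> $ i) has_field_derivative Z (\<phi> \<tau>) $ i) (at \<tau>)" for i
        using *(1) that by (auto simp: integral_curve_def)
      have p: "\<phi> \<tau> \<in> U" using *(1) that by (auto simp: integral_curve_def)
      show ?thesis
        using has_field_derivative_along_curve[OF assms(1)[OF p] d] assms(2)[OF p] by simp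
    qed
    then have "(\<lambda>\<sigma>. F (\<phi> \<sigma>)) constant_on D"
      using has_field_derivative_0_imp_constant_on D by blast
    then show ?thesis using * by (metis constant_on_def)
  qed
  have "F q = F p" if "q \<in> leaf Z U p" for q
  proof -
    have "(same_curve Z U)\<^sup>*\<^sup>* p q" using that by (simp add: leaf_def)
    then show ?thesis
      by induction (simp_all add: step)
  qed
  then show ?thesis by (auto simp: constant_on_def)
qed

section \<open>Two independent first integrals of \<open>X\<close>\<close>

lemma holomorphic_fun_coeffs:
  assumes "open U" "\<And>p. p \<in> U \<Longrightarrow> (F has_derivative (\<lambda>v. \<Sum>i\<in>UNIV. A p $ i * v $ i)) (at p)"
  shows "holomorphic_fun F U"
  using assms unfolding holomorphic_fun_def by blast

text \<open>Germs are tested at points of the diagonal: no coordinate vanishes there, and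
  \<open>a \<noteq> 1\<close> keeps \<open>a^2 - a^3\<close> nonzero.\<close>

lemma eventually_nhds_0_diagonal:
  assumes "\<forall>\<^sub>F p in nhds (0::complex^3). P p"
  obtains a where "a \<noteq> 0" "a \<noteq> 1" "P (vector [a, a, a])" "P 0"
proof -
  define s :: "nat \<Rightarrow> complex" where "s = (\<lambda>n. of_real (inverse (real (Suc n))))"
  have s: "s \<longlonglongrightarrow> 0"
    unfolding s_def using tendsto_of_real[OF LIMSEQ_inverse_real_of_nat, where ?'a = complex] by (simp only: of_real_0)
  have "((\<lambda>n. vector [s n, s n, s n] :: complex^3) \<longlongrightarrow> 0) sequentially"
  proof (rule vec_tendstoI)
    fix i :: 3
    show "((\<lambda>n. (vector [s n, s n, s n] :: complex^3) $ i) \<longlongrightarrow> 0 $ i) sequentially"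
      using exhaust_3[of i] s by auto
  qed
  then have "\<forall>\<^sub>F n in sequentially. P (vector [s n, s n, s n])"
    by (rule eventually_compose_filterlim[OF assms])
  then obtain N where N: "\<And>n. n \<ge> N \<Longrightarrow> P (vector [s n, s n, s n])"
    by (auto simp: eventually_sequentially)
  have "s (Suc N) \<noteq> 0" "s (Suc N) \<noteq> 1"
    unfolding s_def of_real_eq_0_iff of_real_eq_1_iff by (auto simp: field_simps)
  then show ?thesis
    using that[of "s (Suc N)"] eventually_nhds_x_imp_x[OF assms] N[of "Suc N"] by simp
qed

lemma X_first_integrals:
  "\<exists>F G. first_integral X_field F \<and> first_integral X_field G \<and> independent_integrals F G"
proof -
  define F :: "complex^3 \<Rightarrow> complex" where "F = (\<lambda>p. p $ 1 * p $ 3)"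
  define G :: "complex^3 \<Rightarrow> complex" where "G = (\<lambda>p. (p $ 3)\<^sup>2 * ((p $ 2)\<^sup>2 - (p $ 1) ^ 3))"
  define A :: "complex^3 \<Rightarrow> complex^3" where "A = (\<lambda>p. vector [p $ 3, 0, p $ 1])"
  define B :: "complex^3 \<Rightarrow> complex^3" where "B = (\<lambda>p. vector [- 3 * (p $ 1)\<^sup>2 * (p $ 3)\<^sup>2,
    2 * p $ 2 * (p $ 3)\<^sup>2, 2 * p $ 3 * ((p $ 2)\<^sup>2 - (p $ 1) ^ 3)])"
  have F: "(F has_derivative (\<lambda>v. \<Sum>i\<in>UNIV. A p $ i * v $ i)) (at p)" for p
    unfolding F_def A_def by (auto simp: sum_3 intro!: derivative_eq_intros has_derivative_coord)
  have AX: "(\<Sum>i\<in>UNIV. A p $ i * X_field p $ i) = 0" for p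
    by (simp add: sum_3 A_def X_field_def Let_def)
  have BX: "(\<Sum>i\<in>UNIV. B p $ i * X_field p $ i) = 0" for p
    by (simp add: sum_3 B_def X_field_def Let_def power2_eq_square power3_eq_cube algebra_simps)
  have G: "(G has_derivative (\<lambda>v. \<Sum>i\<in>UNIV. B p $ i * v $ i)) (at p)" for p
    unfolding G_def B_def
    by (auto simp: sum_3 algebra_simps intro!: derivative_eq_intros has_derivative_coord)
  have "\<not> (\<exists>c. \<forall>\<^sub>F p in nhds 0. F p = c)"
  proof
    assume "\<exists>c. \<forall>\<^sub>F p in nhds 0. F p = c"
    then obtain c where c: "\<forall>\<^sub>F p in nhds 0. F p = c" by blast
    obtain a where "a \<noteq> 0" "F (vector [a, a, a]) = c" "F 0 = c"
      using eventually_nhds_0_diagonal[OF c] by blast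
    then show False by (simp add: F_def)
  qed
  then have Fint: "first_integral X_field F"
    unfolding first_integral_def leaves_def
    using holomorphic_fun_coeffs[of UNIV F A, OF _ F] constant_on_leafI[of UNIV F A, OF F AX]
    by auto
  have "\<not> (\<exists>c. \<forall>\<^sub>F p in nhds 0. G p = c)"
  proof
    assume "\<exists>c. \<forall>\<^sub>F p in nhds 0. G p = c"
    then obtain c where c: "\<forall>\<^sub>F p in nhds 0. G p = c" by blast
    obtain a where a: "a \<noteq> 0" "a \<noteq> 1" "G (vector [a, a, a]) = c" "G 0 = c"
      using eventually_nhds_0_diagonal[OF c] by blast
    then have "a\<^sup>2 * (a\<^sup>2 - a ^ 3) = 0" by (simp add: G_def)
    then have "a\<^sup>2 * (a\<^sup>2 * (1 - a)) = 0" by (simp add: algebra_simps power2_eq_square power3_eq_cube)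
    then show False using a(1,2) by simp
  qed
  then have Gint: "first_integral X_field G"
    unfolding first_integral_def leaves_def
    using holomorphic_fun_coeffs[of UNIV G B, OF _ G] constant_on_leafI[of UNIV G B, OF G BX]
    by auto
  have "independent_integrals F G"
    unfolding independent_integrals_def
  proof
    assume "\<forall>\<^sub>F p in nhds 0. \<forall>u v. wedge_diff F G p u v = 0"
    then obtain a where a: "a \<noteq> 0" "\<forall>u v. wedge_diff F G (vector [a, a, a]) u v = 0"
      by (rule eventually_nhds_0_diagonal)
    \<comment> \<open>On the first two basis vectors the form takes the value \<open>2 * a^4\<close>
      at this point.\<close>
    then have "wedge_diff F G (vector [a, a, a]) (vector [1, 0, 0]) (vector [0, 1, 0]) = 0" by blast
    then show False
      using a(1) unfolding wedge_diff_def frechet_derivative_at[OF F, symmetric]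
        frechet_derivative_at[OF G, symmetric]
      by (simp add: sum_3 A_def B_def)
  qed
  with Fint Gint show ?thesis by blast
qed

subsection \<open>First integrals of \<open>Y\<close>\<close>

text \<open>Here \<open>n\<close> is the total degree and \<open>i\<close> the exponent of the first
  variable. The factor \<open>n - k\<close> vanishes only for \<open>n = k\<close>, so only that
  degree leaves coefficients free. The pure powers of the second variable give the boundary equation
  \<open>rec0\<close>, which eventually rules out everything but the excepted coefficient, that of
  \<open>u^k\<close>.\<close>

lemma no_resonant_solution:
  fixes d :: "nat \<Rightarrow> nat \<Rightarrow> complex" and k :: nat
  defines "e n i \<equiv> if n = 0 then 0 else d (n - 1) i"
  assumes fin: "\<And>n i. i > n \<Longrightarrow> d n i = 0"
    and rec0: "\<And>n. (of_nat n - of_nat k) * d n 0 + (of_nat n - 1 - of_nat k) * e n 0 = 0"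
    and rec: "\<And>n i. (of_nat n - of_nat k) * (d n i - d n (Suc i)) =
      (of_nat i + of_nat n - of_nat k) * e n (Suc i)"
    and nz: "\<not> (n = k \<and> i = 0)"
  shows "d n i = 0"
proof -
  \<comment> \<open>A homogeneous part has finitely many coefficients, so a coefficient sequence
    that is constant from \<open>i\<close> on vanishes from \<open>i\<close> on.\<close>
  have down: "d n i = 0" if "\<And>j. i \<le> j \<Longrightarrow> d n j = d n (Suc j)" for n i
  proof -
    have "d n (i + l) = d n i" for l
    proof (induction l)
      case (Suc l)
      then show ?case using that[of "i + l"] by simp
    qed simp
    from this[of "Suc n"] fin[of n "i + Suc n"] show ?thesis by simp
  qed
  have low: "d n i = 0" if "n < k" for n i
    using that
  proof (induction n arbitrary: i)
    case 0
    have "d 0 j = d 0 (Suc j)" for j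
      using rec[of 0 j] 0 by (simp add: e_def)
    then show ?case by (rule down)
  next
    case (Suc n)
    have "(of_nat (Suc n) - of_nat k :: complex) \<noteq> 0"
      using Suc.prems by (metis less_irrefl of_nat_eq_iff right_minus_eq)
    then have "d (Suc n) j = d (Suc n) (Suc j)" for j
      using rec[of "Suc n" j] Suc by (simp add: e_def)
    then show ?case by (rule down)
  qed
  \<comment> \<open>Beyond the resonant degree the factor on the left is \<open>Suc m\<close>, which
    can be cancelled.\<close>
  have shift: "of_nat (Suc m) * (d (Suc (k + m)) i - d (Suc (k + m)) (Suc i)) =
      of_nat (Suc (i + m)) * d (k + m) (Suc i)" for m i
    using rec[of "Suc (k + m)" i] by (simp add: e_def algebra_simps)
  have mid: "d k i = 0" if "i > 0" for i
  proof (rule ccontr)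
    assume "d k i \<noteq> 0"
    define D where "D = (GREATEST i. d k i \<noteq> 0)"
    have bd: "\<And>j. d k j \<noteq> 0 \<Longrightarrow> j \<le> k" using fin not_le by blast
    have D: "d k D \<noteq> 0" unfolding D_def
      using \<open>d k i \<noteq> 0\<close> bd by (rule GreatestI_nat)
    have D': "d k j = 0" if "j > D" for j
      using Greatest_le_nat[of "\<lambda>i. d k i \<noteq> 0" j k] bd that unfolding D_def by fastforce
    have "D > 0" using D' \<open>d k i \<noteq> 0\<close> \<open>i > 0\<close> by (metis gr0I)
    \<comment> \<open>The differences of the part of degree \<open>k + m + 1\<close> are positive
      multiples of the part of degree \<open>k + m\<close> shifted by one place, so the top nonzero
      index drops by exactly one.\<close>
    have P: "(\<forall>i>D - m. d (k + m) i = 0) \<and> d (k + m) (D - m) \<noteq> 0" if "m \<le> D" for m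
      using that
    proof (induction m)
      case 0
      then show ?case using D D' by simp
    next
      case (Suc m)
      then have IH: "\<And>i. i > D - m \<Longrightarrow> d (k + m) i = 0" "d (k + m) (D - m) \<noteq> 0" by auto
      have "d (Suc (k + m)) j = d (Suc (k + m)) (Suc j)" if "j \<ge> D - m" for j
        using shift[of m j] IH(1)[of "Suc j"] that by (simp del: of_nat_Suc)
      then have z: "d (Suc (k + m)) j = 0" if "j \<ge> D - m" for j
        by (rule down) (use that in auto)
      have "of_nat (Suc m) * d (Suc (k + m)) (D - Suc m) =
          of_nat (Suc (D - Suc m + m)) * d (k + m) (D - m)"
        using shift[of m "D - Suc m"] z[of "D - m"] Suc.prems by (simp del: of_nat_Suc add: Suc_diff_Suc)
      then have "d (Suc (k + m)) (D - Suc m) \<noteq> 0"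
        using IH(2) by (metis mult_eq_0_iff nat.distinct(1) of_nat_eq_0_iff)
      then show ?case using z by auto
    qed
    from P[of D] have PD: "\<And>i. i > 0 \<Longrightarrow> d (k + D) i = 0" "d (k + D) 0 \<noteq> 0" by auto
    have "d (Suc (k + D)) j = d (Suc (k + D)) (Suc j)" for j
      using shift[of D j] PD(1)[of "Suc j"] by (simp del: of_nat_Suc)
    then have "d (Suc (k + D)) 0 = 0" by (rule down)
    \<comment> \<open>Now \<open>rec0\<close> in degree \<open>k + D + 1\<close> has lost its first
      term; the remaining factor is \<open>D\<close>, which is where \<open>D > 0\<close>
      matters.\<close>
    then have "of_nat D * d (k + D) 0 = 0"
      using rec0[of "Suc (k + D)"] by (simp add: e_def)
    then show False using PD(2) \<open>D > 0\<close> by simp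
  qed
  have high: "d (Suc (k + m)) i = 0" for m i
  proof (induction m arbitrary: i)
    case 0
    have "d (Suc k) j = d (Suc k) (Suc j)" for j
      using shift[of 0 j] mid[of "Suc j"] by simp
    then have "d (Suc k) i = 0" by (rule down)
    then show ?case by simp
  next
    case (Suc m)
    have "d (Suc (k + Suc m)) j = d (Suc (k + Suc m)) (Suc j)" for j
      using shift[of "Suc m" j] Suc by (simp del: of_nat_Suc)
    then show ?case by (rule down)
  qed
  show ?thesis
    using low mid high nz by (metis add_Suc_right less_imp_Suc_add linorder_neqE_nat neq0_conv)
qed

section \<open>Taylor coefficients depending holomorphically on a parameter\<close>

abbreviation taylor_coeff :: "(complex \<Rightarrow> complex) \<Rightarrow> nat \<Rightarrow> complex"
  where "taylor_coeff g \<equiv> fps_nth (fps_expansion g 0)"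

lemma continuous_on_circlepath: "continuous_on T (circlepath z r)"
  unfolding circlepath by (intro continuous_intros)

lemma continuous_on_vector_derivative_circlepath:
  "continuous_on T (\<lambda>t. vector_derivative (circlepath z r) (at t))"
  unfolding vector_derivative_circlepath by (intro continuous_intros)

lemma higher_deriv_circlepath:
  assumes "f holomorphic_on ball 0 r" "\<rho> < r" "w \<in> ball 0 \<rho>"
  shows "contour_integral (circlepath 0 \<rho>) (\<lambda>u. f u / (u - w) ^ Suc n) =
      (2 * pi * \<i>) / fact n * (deriv ^^ n) f w"
proof (intro contour_integral_unique Cauchy_has_contour_integral_higher_derivative_circlepath assms(3))
  have "cball 0 \<rho> \<subseteq> ball (0::complex) r" using assms(2) by auto
  then have "f holomorphic_on cball 0 \<rho>"
    using assms(1) holomorphic_on_subset by blast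
  then show "continuous_on (cball 0 \<rho>) f" "f holomorphic_on ball 0 \<rho>"
    using holomorphic_on_imp_continuous_on holomorphic_on_subset ball_subset_cball by blast+
qed

lemma continuous_on_swap_args:
  assumes "continuous_on (A \<times> B) (\<lambda>(x, z). f x z)"
  shows "continuous_on (B \<times> A) (\<lambda>(z, x). f x z)"
proof -
  have "continuous_on (B \<times> A) ((\<lambda>(x, z). f x z) \<circ> prod.swap)"
    using assms by (intro continuous_on_compose continuous_on_swap) (simp add: product_swap)
  then show ?thesis by (simp add: case_prod_unfold o_def)
qed

text \<open>The Cauchy integral expresses a derivative through values of \<open>f\<close>, so joint
  continuity is inherited. As \<open>f\<close> is given only on an open disc, circles of radius
  \<open>\<rho> < r\<close> are used; the discs they bound exhaust the large one.\<close>

lemma continuous_on_higher_deriv_param: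
  fixes f :: "'a::topological_space \<Rightarrow> complex \<Rightarrow> complex"
  assumes cont: "continuous_on (S \<times> ball 0 r) (\<lambda>(p, z). f p z)"
    and hol: "\<And>p. p \<in> S \<Longrightarrow> f p holomorphic_on ball 0 r"
  shows "continuous_on (S \<times> ball 0 r) (\<lambda>(p, w). (deriv ^^ n) (f p) w)"
proof -
  have *: "continuous_on (S \<times> ball 0 \<rho>) (\<lambda>(p, w). (deriv ^^ n) (f p) w)" if \<rho>: "0 < \<rho>" "\<rho> < r" for \<rho>
  proof -
    have eq: "(deriv ^^ n) (f p) w = fact n / (2 * pi * \<i>) *
        integral {0..1} (\<lambda>t. f p (circlepath 0 \<rho> t) / (circlepath 0 \<rho> t - w) ^ Suc n *
          vector_derivative (circlepath 0 \<rho>) (at t))" if "p \<in> S" "w \<in> ball 0 \<rho>" for p w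
    proof -
      note higher_deriv_circlepath[OF hol[OF that(1)] \<rho>(2) that(2), of n]
      then show ?thesis unfolding contour_integral_integral by (simp add: field_simps)
    qed
    have c1: "continuous_on ((S \<times> ball 0 \<rho>) \<times> cbox 0 1) (\<lambda>((p, w), t). f p (circlepath 0 \<rho> t))"
    proof -
      have "continuous_on ((S \<times> ball 0 \<rho>) \<times> cbox 0 1) (\<lambda>q. (\<lambda>(p, z). f p z) (fst (fst q), circlepath 0 \<rho> (snd q)))"
        using \<rho> by (intro continuous_on_compose2[OF cont])
          (auto intro!: continuous_intros simp: circlepath norm_mult)
      then show ?thesis by (simp add: case_prod_unfold)
    qed
    have ne: "circlepath 0 \<rho> t - w \<noteq> 0" if "w \<in> ball 0 \<rho>" for w t
      using that \<rho> by (auto simp: circlepath norm_mult)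
    have "continuous_on ((S \<times> ball 0 \<rho>) \<times> cbox 0 1)
      (\<lambda>((p, w), t). f p (circlepath 0 \<rho> t) / (circlepath 0 \<rho> t - w) ^ Suc n *
          vector_derivative (circlepath 0 \<rho>) (at t))"
      using c1 unfolding case_prod_unfold
      by (intro continuous_on_mult continuous_on_divide continuous_on_power continuous_on_diff
          continuous_on_compose2[OF continuous_on_circlepath[of UNIV]]
          continuous_on_compose2[OF continuous_on_vector_derivative_circlepath[of UNIV]]
          continuous_on_fst continuous_on_snd continuous_on_id) (auto dest: ne)
    then have "continuous_on (S \<times> ball 0 \<rho>) (\<lambda>q. integral (cbox 0 1)
      (\<lambda>t. case q of (p, w) \<Rightarrow> f p (circlepath 0 \<rho> t) / (circlepath 0 \<rho> t - w) ^ Suc n *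
          vector_derivative (circlepath 0 \<rho>) (at t)))" (is "continuous_on _ ?I")
      by (intro integral_continuous_on_param) (simp add: case_prod_unfold)
    then have "continuous_on (S \<times> ball 0 \<rho>) (\<lambda>q. fact n / (2 * pi * \<i>) * ?I q)"
      by (intro continuous_intros)
    then show ?thesis
      by (rule continuous_on_eq) (auto simp: eq)
  qed
  show ?thesis
    unfolding continuous_on_def
  proof
    fix q assume "q \<in> S \<times> ball (0::complex) r"
    then obtain p w where q: "q = (p, w)" "p \<in> S" "norm w < r" by auto
    define \<rho> where "\<rho> = (norm w + r) / 2"
    have \<rho>: "0 < \<rho>" "\<rho> < r" "norm w < \<rho>"
    proof -
      have "0 < norm w + r"
        using order.strict_trans1[OF norm_ge_zero q(3)] by (intro add_nonneg_pos norm_ge_zero)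
      then show "0 < \<rho>" by (simp add: \<rho>_def)
    qed (use q(3) in \<open>simp_all add: \<rho>_def\<close>)
    have "((\<lambda>(p, w). (deriv ^^ n) (f p) w) \<longlongrightarrow> (\<lambda>(p, w). (deriv ^^ n) (f p) w) q)
        (at q within S \<times> ball 0 \<rho>)"
      using *[OF \<rho>(1,2)] q \<rho>(3) unfolding continuous_on_def by auto
    moreover have "at q within S \<times> ball 0 \<rho> = at q within S \<times> ball 0 r"
      by (rule at_within_nhd[of _ "UNIV \<times> ball 0 \<rho>"]) (use q \<rho> in \<open>auto simp: open_Times\<close>)
    ultimately show "((\<lambda>(p, w). (deriv ^^ n) (f p) w) \<longlongrightarrow> (\<lambda>(p, w). (deriv ^^ n) (f p) w) q)
        (at q within S \<times> ball 0 r)" by simp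
  qed
qed

text \<open>Differentiation under the Cauchy integral. The required joint continuity of the
  \<open>x\<close>-derivative is \<open>continuous_on_higher_deriv_param\<close> with the two
  variables exchanged.\<close>

lemma has_field_derivative_higher_deriv_integral:
  fixes f :: "complex \<Rightarrow> complex \<Rightarrow> complex"
  assumes cont: "continuous_on (ball 0 a \<times> ball 0 r) (\<lambda>(x, z). f x z)"
    and hol2: "\<And>x. x \<in> ball 0 a \<Longrightarrow> f x holomorphic_on ball 0 r"
    and hol1: "\<And>z. z \<in> ball 0 r \<Longrightarrow> (\<lambda>x. f x z) holomorphic_on ball 0 a"
    and x: "x \<in> ball 0 a" and \<rho>: "\<rho> < r" and w: "w \<in> ball 0 \<rho>"
  shows "((\<lambda>x. (deriv ^^ n) (f x) w) has_field_derivative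
      fact n / (2 * pi * \<i>) * contour_integral (circlepath 0 \<rho>)
        (\<lambda>u. deriv (\<lambda>x. f x u) x / (u - w) ^ Suc n)) (at x)"
proof -
  have \<rho>0: "0 < \<rho>" using w norm_ge_zero[of w] by (simp del: norm_ge_zero)
  have \<gamma>: "circlepath 0 \<rho> t \<in> ball 0 r" "circlepath 0 \<rho> t - w \<noteq> 0" for t
    using \<rho> \<rho>0 w by (auto simp: circlepath norm_mult)
  note cont' = continuous_on_swap_args[OF cont]
  have dcont: "continuous_on (ball 0 r \<times> ball 0 a) (\<lambda>(z, x). deriv (\<lambda>x. f x z) x)"
    using continuous_on_higher_deriv_param[OF cont' hol1, of 1] by simp
  define K where "K = (\<lambda>t. vector_derivative (circlepath 0 \<rho>) (at t) / (circlepath 0 \<rho> t - w) ^ Suc n)"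
  have K: "continuous_on T K" for T
    using \<gamma>(2) unfolding K_def
    by (intro continuous_intros continuous_on_circlepath continuous_on_vector_derivative_circlepath) auto
  have eq: "(deriv ^^ n) (f x) w = fact n / (2 * pi * \<i>) *
      integral (cbox 0 1) (\<lambda>t. f x (circlepath 0 \<rho> t) * K t)" if "x \<in> ball 0 a" for x
  proof -
    note higher_deriv_circlepath[OF hol2[OF that] \<rho> w, of n]
    then show ?thesis unfolding contour_integral_integral K_def by (simp add: field_simps)
  qed
  have "((\<lambda>x. integral (cbox 0 1) (\<lambda>t. f x (circlepath 0 \<rho> t) * K t)) has_field_derivative
      integral (cbox 0 1) (\<lambda>t. deriv (\<lambda>x. f x (circlepath 0 \<rho> t)) x * K t)) (at x within ball 0 a)"
  proof (rule leibniz_rule_field_derivative)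
    fix x t assume x: "x \<in> ball (0::complex) a" and t: "t \<in> cbox (0::real) 1"
    have "((\<lambda>x. f x (circlepath 0 \<rho> t)) has_field_derivative deriv (\<lambda>x. f x (circlepath 0 \<rho> t)) x) (at x)"
      using holomorphic_derivI[OF hol1[OF \<gamma>(1)] open_ball x] .
    then show "((\<lambda>x. f x (circlepath 0 \<rho> t) * K t) has_field_derivative
        deriv (\<lambda>x. f x (circlepath 0 \<rho> t)) x * K t) (at x within ball 0 a)"
      by (intro DERIV_cmult_right) (rule has_field_derivative_at_within)
  next
    fix x assume x: "x \<in> ball (0::complex) a"
    have "continuous_on (cbox 0 1) (\<lambda>t. f x (circlepath 0 \<rho> t))"
      using \<gamma>(1) by (intro continuous_on_compose2[OF holomorphic_on_imp_continuous_on[OF hol2[OF x]]])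
        (auto intro!: continuous_intros simp: circlepath)
    then show "(\<lambda>t. f x (circlepath 0 \<rho> t) * K t) integrable_on cbox 0 1"
      by (intro integrable_continuous continuous_intros K)
  next
    have "continuous_on (ball 0 a \<times> cbox 0 1) (\<lambda>q. (\<lambda>(z, x). deriv (\<lambda>x. f x z) x) (circlepath 0 \<rho> (snd q), fst q))"
      using \<gamma>(1) by (intro continuous_on_compose2[OF dcont])
        (auto intro!: continuous_intros simp: circlepath)
    moreover have "continuous_on (ball 0 a \<times> cbox 0 1) (\<lambda>q. K (snd q))"
      using continuous_on_compose2[OF K[of UNIV] continuous_on_snd[OF continuous_on_id]] by auto
    ultimately show "continuous_on (ball 0 a \<times> cbox 0 1)
        (\<lambda>(x, t). deriv (\<lambda>x. f x (circlepath 0 \<rho> t)) x * K t)"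
      unfolding case_prod_unfold by (intro continuous_intros) auto
  qed (use x in auto)
  then have "((\<lambda>x. fact n / (2 * pi * \<i>) * integral (cbox 0 1) (\<lambda>t. f x (circlepath 0 \<rho> t) * K t))
      has_field_derivative fact n / (2 * pi * \<i>) *
      integral (cbox 0 1) (\<lambda>t. deriv (\<lambda>x. f x (circlepath 0 \<rho> t)) x * K t)) (at x)"
    using at_within_open[OF x open_ball] by (intro DERIV_cmult) simp
  then have "((\<lambda>x. (deriv ^^ n) (f x) w) has_field_derivative fact n / (2 * pi * \<i>) *
      integral (cbox 0 1) (\<lambda>t. deriv (\<lambda>x. f x (circlepath 0 \<rho> t)) x * K t)) (at x)"
    using x by (rule has_field_derivative_transform_within_open[OF _ open_ball]) (simp add: eq)
  then show ?thesis unfolding contour_integral_integral K_def by (simp add: mult.commute)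
qed

text \<open>Mixed derivatives commute because differentiating the Cauchy integral in
  \<open>x\<close> gives the Cauchy integral of the \<open>x\<close>-derivative. That this
  derivative is holomorphic in \<open>z\<close> is the same integral formula with exchanged
  variables and order 1.\<close>

lemma
  fixes f :: "complex \<Rightarrow> complex \<Rightarrow> complex"
  assumes cont: "continuous_on (ball 0 a \<times> ball 0 r) (\<lambda>(x, z). f x z)"
    and hol2: "\<And>x. x \<in> ball 0 a \<Longrightarrow> f x holomorphic_on ball 0 r"
    and hol1: "\<And>z. z \<in> ball 0 r \<Longrightarrow> (\<lambda>x. f x z) holomorphic_on ball 0 a"
    and x: "x \<in> ball 0 a"
  shows holomorphic_on_deriv_param: "(\<lambda>z. deriv (\<lambda>x. f x z) x) holomorphic_on ball 0 r"
    and has_field_derivative_higher_deriv_param: "w \<in> ball 0 r \<Longrightarrow>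
      ((\<lambda>x. (deriv ^^ n) (f x) w) has_field_derivative
        (deriv ^^ n) (\<lambda>z. deriv (\<lambda>x. f x z) x) w) (at x)"
proof -
  note cont' = continuous_on_swap_args[OF cont]
  have between: "\<exists>\<rho><s. y \<in> ball 0 \<rho>" if "y \<in> ball 0 s" for y :: complex and s
    using that dense[of "norm y" s] by auto
  show hol: "(\<lambda>z. deriv (\<lambda>x. f x z) x) holomorphic_on ball 0 r"
  proof (subst holomorphic_on_open[OF open_ball], intro ballI)
    fix z assume z: "z \<in> ball (0::complex) r"
    obtain \<rho> where "\<rho> < a" "x \<in> ball 0 \<rho>" using between[OF x] by blast
    from has_field_derivative_higher_deriv_integral[OF cont' hol1 hol2 z this, of 1]
    show "\<exists>f'. ((\<lambda>z. deriv (\<lambda>x. f x z) x) has_field_derivative f') (at z)" by auto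
  qed
  assume w: "w \<in> ball 0 r"
  obtain \<rho> where \<rho>: "\<rho> < r" "w \<in> ball 0 \<rho>" using between[OF w] by blast
  note higher_deriv_circlepath[OF hol \<rho>, of n]
  then show "((\<lambda>x. (deriv ^^ n) (f x) w) has_field_derivative
        (deriv ^^ n) (\<lambda>z. deriv (\<lambda>x. f x z) x) w) (at x)"
    using has_field_derivative_higher_deriv_integral[OF cont hol2 hol1 x \<rho>, of n] by simp
qed

section \<open>Expansions of holomorphic functions and the coefficient equations\<close>

lemma taylor_coeff_eq: "taylor_coeff g n = (deriv ^^ n) g 0 / fact n"
  by (simp add: fps_expansion_def)

lemma has_taylor_expansion:
  assumes "g holomorphic_on ball 0 r" "r > 0"
  shows "g has_fps_expansion fps_expansion g 0"
  using assms by (intro has_fps_expansion_fps_expansion[of "ball 0 r"]) auto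

lemma fps_expansion_zero:
  assumes "g has_fps_expansion G" "r > 0" "\<And>z. z \<in> ball 0 r \<Longrightarrow> g z = (0::complex)"
  shows "G = 0"
proof -
  have "eventually (\<lambda>z. g z = 0) (nhds 0)"
    using assms(2,3) eventually_nhds_in_open[of "ball 0 r" 0] by (auto elim: eventually_mono)
  then have "g has_fps_expansion 0" by (simp add: has_fps_expansion_0_iff)
  with assms(1) show ?thesis by (rule fps_expansion_unique_complex)
qed

lemma taylor_sums:
  assumes "g holomorphic_on ball 0 r" "z \<in> ball 0 r"
  shows "(\<lambda>n. taylor_coeff g n * z ^ n) sums g z"
  using holomorphic_power_series[OF assms] by (simp add: taylor_coeff_eq)

lemma taylor_monomial:
  assumes "g holomorphic_on ball 0 r" "z \<in> ball 0 r" "\<And>n. n \<noteq> k \<Longrightarrow> taylor_coeff g n = 0"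
  shows "g z = taylor_coeff g k * z ^ k"
proof -
  have "(\<lambda>n. if n = k then taylor_coeff g n * z ^ n else 0) sums (taylor_coeff g k * z ^ k)"
    by (rule sums_single)
  also have "(\<lambda>n. if n = k then taylor_coeff g n * z ^ n else 0) = (\<lambda>n. taylor_coeff g n * z ^ n)"
    using assms(3) by auto
  finally show ?thesis using taylor_sums[OF assms(1,2)] sums_unique2 by blast
qed

lemma has_field_derivative_taylor_coeff:
  fixes f :: "complex \<Rightarrow> complex \<Rightarrow> complex"
  assumes "continuous_on (ball 0 a \<times> ball 0 r) (\<lambda>(x, z). f x z)"
    and "\<And>x. x \<in> ball 0 a \<Longrightarrow> f x holomorphic_on ball 0 r"
    and "\<And>z. z \<in> ball 0 r \<Longrightarrow> (\<lambda>x. f x z) holomorphic_on ball 0 a"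
    and "x \<in> ball 0 a" "r > 0"
  shows "((\<lambda>x. taylor_coeff (f x) n) has_field_derivative
      taylor_coeff (\<lambda>z. deriv (\<lambda>x. f x z) x) n) (at x)"
  unfolding taylor_coeff_eq
  using has_field_derivative_higher_deriv_param[OF assms(1-4), of 0 n] assms(5)
  by (intro DERIV_cdivide) simp

text \<open>\<open>g\<close> is the coefficient of \<open>z^k\<close> in a first integral, and
  \<open>x\<close>, \<open>y\<close> stand for \<open>v\<close>, \<open>u\<close>. Expanding in one
  variable at a time replaces power series in several variables: \<open>h j\<close> is the
  coefficient of \<open>y^j\<close>, a holomorphic function of \<open>x\<close>, which is then
  expanded in turn.\<close>

lemma planar_coefficient_form:
  fixes g :: "complex \<Rightarrow> complex \<Rightarrow> complex" and k :: nat
  assumes r: "r > 0"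
    and cont: "continuous_on (ball 0 r \<times> ball 0 r) (\<lambda>(x, y). g x y)"
    and hol2: "\<And>x. x \<in> ball 0 r \<Longrightarrow> g x holomorphic_on ball 0 r"
    and hol1: "\<And>y. y \<in> ball 0 r \<Longrightarrow> (\<lambda>x. g x y) holomorphic_on ball 0 r"
    and pde: "\<And>x y. x \<in> ball 0 r \<Longrightarrow> y \<in> ball 0 r \<Longrightarrow>
      x * (x - 2 * y\<^sup>2 - y) * deriv (\<lambda>x. g x y) x
      + (x - y\<^sup>2 - y) * (y * deriv (g x) y - of_nat k * g x y) = 0"
    and xy: "x \<in> ball 0 r" "y \<in> ball 0 r"
  shows "g x y = taylor_coeff (g 0) k * y ^ k"
proof -
  define h where "h = (\<lambda>j x. taylor_coeff (g x) j)"
  define c where "c = (\<lambda>i j. taylor_coeff (h j) i)"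
  have nthX: "fps_nth (fps_X * F) j = (if j = 0 then 0 else fps_nth F (j - 1))" for F :: "complex fps" and j
    by simp
  have nthX2: "fps_nth (fps_X\<^sup>2 * F) j = (if j < 2 then 0 else fps_nth F (j - 2))" for F :: "complex fps" and j
    by (simp add: fps_X_power_mult_nth)
  have euler: "fps_nth (fps_X * fps_deriv F) j = of_nat j * fps_nth F j" for F :: "complex fps" and j
    by (simp add: fps_deriv_nth)
  have dh: "(h j has_field_derivative taylor_coeff (\<lambda>y. deriv (\<lambda>x. g x y) x) j) (at x)"
    if "x \<in> ball 0 r" for j x
    unfolding h_def by (rule has_field_derivative_taylor_coeff[OF cont hol2 hol1 that r])
  then have holh: "h j holomorphic_on ball 0 r" for j
    by (meson holomorphic_on_open open_ball)
  \<comment> \<open>This is the coefficient of \<open>y^j\<close> in the equation. The case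
    distinctions give coefficients of negative index the value zero, which truncated subtraction
    would not do.\<close>
  have planar: "x\<^sup>2 * deriv (h j) x - 2 * x * (if j < 2 then 0 else deriv (h (j - 2)) x)
      - x * (if j = 0 then 0 else deriv (h (j - 1)) x)
      + (of_nat j - of_nat k) * (x * h j x)
      - (of_nat j - 2 - of_nat k) * (if j < 2 then 0 else h (j - 2) x)
      - (of_nat j - 1 - of_nat k) * (if j = 0 then 0 else h (j - 1) x) = 0"
    if x: "x \<in> ball 0 r" for x j
  proof -
    define G where "G = fps_expansion (g x) 0"
    define D where "D = fps_expansion (\<lambda>y. deriv (\<lambda>x. g x y) x) 0"
    have G: "g x has_fps_expansion G"
      unfolding G_def by (rule has_taylor_expansion[OF hol2[OF x] r])
    have D: "(\<lambda>y. deriv (\<lambda>x. g x y) x) has_fps_expansion D"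
      unfolding D_def by (rule has_taylor_expansion[OF holomorphic_on_deriv_param[OF cont hol2 hol1 x] r])
    have "(\<lambda>y. x * (x - 2 * y\<^sup>2 - y) * deriv (\<lambda>x. g x y) x
        + (x - y\<^sup>2 - y) * (y * deriv (g x) y - of_nat k * g x y)) has_fps_expansion
      fps_const x * (fps_const x - fps_const 2 * fps_X\<^sup>2 - fps_X) * D
        + (fps_const x - fps_X\<^sup>2 - fps_X) * (fps_X * fps_deriv G - fps_const (of_nat k) * G)" (is "_ has_fps_expansion ?F")
      by (intro fps_expansion_intros G D)
    from fps_expansion_zero[OF this r] have "?F = 0"
      using pde[OF x] by blast
    then have "fps_const x * (fps_const x * D) - fps_const x * (fps_const 2 * (fps_X\<^sup>2 * D))
        - fps_const x * (fps_X * D)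
        + fps_const x * (fps_X * fps_deriv G) - fps_X\<^sup>2 * (fps_X * fps_deriv G)
        - fps_X * (fps_X * fps_deriv G)
        - fps_const x * (fps_const (of_nat k) * G) + fps_const (of_nat k) * (fps_X\<^sup>2 * G)
        + fps_const (of_nat k) * (fps_X * G) = 0"
      by (simp add: algebra_simps)
    from arg_cong[OF this, of "\<lambda>F. fps_nth F j"]
    have *: "x * (x * fps_nth D j) - x * (2 * fps_nth (fps_X\<^sup>2 * D) j) - x * fps_nth (fps_X * D) j
        + x * fps_nth (fps_X * fps_deriv G) j - fps_nth (fps_X\<^sup>2 * (fps_X * fps_deriv G)) j
        - fps_nth (fps_X * (fps_X * fps_deriv G)) j
        - x * (of_nat k * fps_nth G j) + of_nat k * fps_nth (fps_X\<^sup>2 * G) j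
        + of_nat k * fps_nth (fps_X * G) j = 0"
      by simp
    have Dj: "fps_nth D j = deriv (h j) x" for j
      unfolding D_def by (rule sym, rule DERIV_imp_deriv[OF dh[OF x]])
    have Gj: "fps_nth G j = h j x" for j by (simp add: G_def h_def)
    show ?thesis
      using * unfolding nthX2 euler Dj Gj nthX[of "D"] nthX[of "G"] nthX[of "fps_X * fps_deriv G"]
      by (auto simp: algebra_simps power2_eq_square of_nat_diff split: if_splits)
  qed
  \<comment> \<open>This is the coefficient of \<open>x^i * y^j\<close>. Only total degrees
    \<open>i + j - 1\<close> and \<open>i + j - 2\<close> occur, so sorting by degree yields a
    recursion between consecutive degrees.\<close>
  have rec: "(of_nat i - 1 + of_nat j - of_nat k) * (if i = 0 then 0 else c (i - 1) j)
      - (2 * of_nat i + of_nat j - 2 - of_nat k) * (if j < 2 then 0 else c i (j - 2))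
      - (of_nat i + of_nat j - 1 - of_nat k) * (if j = 0 then 0 else c i (j - 1)) = 0" for i j
  proof -
    have H: "h j has_fps_expansion fps_expansion (h j) 0" for j
      by (rule has_taylor_expansion[OF holh r])
    define H2 where "H2 = (if j < 2 then 0 else fps_expansion (h (j - 2)) 0)"
    define H1 where "H1 = (if j = 0 then 0 else fps_expansion (h (j - 1)) 0)"
    define h2 where "h2 = (if j < 2 then (\<lambda>x. 0) else h (j - 2))"
    define h1 where "h1 = (if j = 0 then (\<lambda>x. 0) else h (j - 1))"
    have h2: "h2 has_fps_expansion H2" unfolding h2_def H2_def using H by auto
    have h1: "h1 has_fps_expansion H1" unfolding h1_def H1_def using H by auto
    have "(\<lambda>x. x * (x * deriv (h j) x) - 2 * (x * deriv h2 x) - x * deriv h1 x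
      + (of_nat j - of_nat k) * (x * h j x) - (of_nat j - 2 - of_nat k) * h2 x
      - (of_nat j - 1 - of_nat k) * h1 x) has_fps_expansion
      fps_X * (fps_X * fps_deriv (fps_expansion (h j) 0)) - fps_const 2 * (fps_X * fps_deriv H2)
      - fps_X * fps_deriv H1 + fps_const (of_nat j - of_nat k) * (fps_X * fps_expansion (h j) 0)
      - fps_const (of_nat j - 2 - of_nat k) * H2 - fps_const (of_nat j - 1 - of_nat k) * H1" (is "?f has_fps_expansion ?F")
      by (intro fps_expansion_intros H h1 h2)
    moreover have "?f x = 0" if x: "x \<in> ball 0 r" for x
    proof -
      have "h2 x = (if j < 2 then 0 else h (j - 2) x)" "h1 x = (if j = 0 then 0 else h (j - 1) x)"
          "deriv h2 x = (if j < 2 then 0 else deriv (h (j - 2)) x)"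
          "deriv h1 x = (if j = 0 then 0 else deriv (h (j - 1)) x)"
        by (simp_all add: h2_def h1_def)
      then show ?thesis using planar[OF x, of j] by (simp only: power2_eq_square mult.assoc)
    qed
    ultimately have "?F = 0"
      using r fps_expansion_zero by blast
    from arg_cong[OF this, of "\<lambda>F. fps_nth F i"]
    have "(if i = 0 then 0 else (of_nat i - 1) * c (i - 1) j) - 2 * (of_nat i * fps_nth H2 i)
      - of_nat i * fps_nth H1 i + (of_nat j - of_nat k) * (if i = 0 then 0 else c (i - 1) j)
      - (of_nat j - 2 - of_nat k) * fps_nth H2 i - (of_nat j - 1 - of_nat k) * fps_nth H1 i = 0"
      unfolding fps_sub_nth fps_add_nth fps_mult_left_const_nth fps_zero_nth euler
        nthX[of "fps_X * fps_deriv (fps_expansion (h j) 0)"] nthX[of "fps_expansion (h j) 0"]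
      by (cases i) (simp_all add: c_def)
    then show ?thesis
      by (cases "i = 0") (auto simp: H2_def H1_def c_def algebra_simps split: if_splits)
  qed
  \<comment> \<open>The homogeneous part of degree \<open>n\<close>, indexed by the exponent of
    \<open>x\<close>; the guard makes \<open>n - i\<close> a genuine difference and provides the
    finite support.\<close>
  define d where "d = (\<lambda>n i. if i \<le> n then c i (n - i) else 0)"
  have d0: "d n i = 0" if "\<not> (n = k \<and> i = 0)" for n i
    using that
  proof (rule no_resonant_solution[of d k n i, rotated 3])
    fix n
    show "(of_nat n - of_nat k) * d n 0 + (of_nat n - 1 - of_nat k) * (if n = 0 then 0 else d (n - 1) 0) = 0"
      using rec[of 0 "Suc n"] by (auto simp: d_def algebra_simps split: if_splits)
    fix i
    show "(of_nat n - of_nat k) * (d n i - d n (Suc i)) =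
        (of_nat i + of_nat n - of_nat k) * (if n = 0 then 0 else d (n - 1) (Suc i))"
    proof (cases "i \<le> n")
      case True
      then consider "n = i" | "n = Suc i" | m where "n = Suc (Suc (i + m))"
        by (metis add_Suc_right le_Suc_ex less_imp_Suc_add add.right_neutral nat.exhaust)
      then show ?thesis
        using rec[of "Suc i" "n - i"]
        by cases (auto simp: d_def algebra_simps)
    qed (auto simp: d_def)
  qed (simp add: d_def)
  have c0: "c i j = 0" if "\<not> (j = k \<and> i = 0)" for i j
    using d0[of "i + j" i] that by (auto simp: d_def)
  \<comment> \<open>Only the constant terms in \<open>x\<close> can survive, so every
    \<open>h j\<close> is constant and only \<open>h k\<close> can be nonzero.\<close>
  have h0: "h j x = (if j = k then h k 0 else 0)" if "x \<in> ball 0 r" for j x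
  proof -
    have "h j x = c 0 j * x ^ 0"
      unfolding c_def using c0 that by (intro taylor_monomial[OF holh that]) (auto simp: c_def)
    moreover have "h j 0 = c 0 j * 0 ^ 0"
      unfolding c_def using c0 r by (intro taylor_monomial[OF holh]) (auto simp: c_def)
    ultimately show ?thesis using c0[of j 0] by auto
  qed
  have "g x y = taylor_coeff (g x) k * y ^ k"
    using h0[OF xy(1)] by (intro taylor_monomial[OF hol2[OF xy(1)] xy(2)]) (simp add: h_def)
  also have "taylor_coeff (g x) k = taylor_coeff (g 0) k"
    using h0[OF xy(1), of k] by (simp add: h_def)
  finally show ?thesis .
qed

text \<open>The operator \<open>z * d/dz\<close> multiplies the coefficient of \<open>z^k\<close> by
  \<open>k\<close>. So each coefficient satisfies the planar equation, is a multiple of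
  \<open>y^k\<close>, and the expansion in \<open>z\<close> becomes a series in
  \<open>y * z\<close>.\<close>

lemma first_integral_form:
  fixes f :: "complex \<Rightarrow> complex \<Rightarrow> complex \<Rightarrow> complex"
  assumes r: "r > 0"
    and cont: "continuous_on ((ball 0 r \<times> ball 0 r) \<times> ball 0 r) (\<lambda>((x, y), z). f x y z)"
    and hol1: "\<And>y z. y \<in> ball 0 r \<Longrightarrow> z \<in> ball 0 r \<Longrightarrow> (\<lambda>x. f x y z) holomorphic_on ball 0 r"
    and hol2: "\<And>x z. x \<in> ball 0 r \<Longrightarrow> z \<in> ball 0 r \<Longrightarrow> (\<lambda>y. f x y z) holomorphic_on ball 0 r"
    and hol3: "\<And>x y. x \<in> ball 0 r \<Longrightarrow> y \<in> ball 0 r \<Longrightarrow> f x y holomorphic_on ball 0 r"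
    and pde: "\<And>x y z. x \<in> ball 0 r \<Longrightarrow> y \<in> ball 0 r \<Longrightarrow> z \<in> ball 0 r \<Longrightarrow>
      x * (x - 2 * y\<^sup>2 - y) * deriv (\<lambda>x. f x y z) x + y * (x - y\<^sup>2 - y) * deriv (\<lambda>y. f x y z) y
      - z * (x - y\<^sup>2 - y) * deriv (f x y) z = 0"
  obtains a where "\<And>x y z. x \<in> ball 0 r \<Longrightarrow> y \<in> ball 0 r \<Longrightarrow> z \<in> ball 0 r \<Longrightarrow>
      (\<lambda>k. a k * (y * z) ^ k) sums f x y z"
proof -
  define g where "g = (\<lambda>k x y. taylor_coeff (f x y) k)"
  have cont1: "continuous_on (ball 0 r \<times> ball 0 r) (\<lambda>(x, z). f x y z)" if "y \<in> ball 0 r" for y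
  proof -
    have "continuous_on (ball 0 r \<times> ball 0 r) (\<lambda>q. (\<lambda>((x, y), z). f x y z) ((fst q, y), snd q))"
      using that by (intro continuous_on_compose2[OF cont]) (auto intro!: continuous_intros)
    then show ?thesis by (simp add: case_prod_unfold)
  qed
  have cont2: "continuous_on (ball 0 r \<times> ball 0 r) (\<lambda>(y, z). f x y z)" if "x \<in> ball 0 r" for x
  proof -
    have "continuous_on (ball 0 r \<times> ball 0 r) (\<lambda>q. (\<lambda>((x, y), z). f x y z) ((x, fst q), snd q))"
      using that by (intro continuous_on_compose2[OF cont]) (auto intro!: continuous_intros)
    then show ?thesis by (simp add: case_prod_unfold)
  qed
  have dx: "((\<lambda>x. g k x y) has_field_derivative taylor_coeff (\<lambda>z. deriv (\<lambda>x. f x y z) x) k) (at x)"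
    if "x \<in> ball 0 r" "y \<in> ball 0 r" for k x y
    unfolding g_def
    by (rule has_field_derivative_taylor_coeff[OF cont1[OF that(2)] hol3[OF _ that(2)] hol1[OF that(2)] that(1) r])
  have dy: "(g k x has_field_derivative taylor_coeff (\<lambda>z. deriv (\<lambda>y. f x y z) y) k) (at y)"
    if "x \<in> ball 0 r" "y \<in> ball 0 r" for k x y
    unfolding g_def
    by (rule has_field_derivative_taylor_coeff[OF cont2[OF that(1)] hol3[OF that(1)] hol2[OF that(1)] that(2) r])
  have gform: "g k x y = taylor_coeff (g k 0) k * y ^ k" if xy: "x \<in> ball 0 r" "y \<in> ball 0 r" for k x y
  proof (rule planar_coefficient_form[OF r _ _ _ _ xy])
    have "continuous_on ((ball 0 r \<times> ball 0 r) \<times> ball 0 r) (\<lambda>(p, w). (deriv ^^ k) (f (fst p) (snd p)) w)"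
      using cont hol3 by (intro continuous_on_higher_deriv_param) (auto simp: case_prod_unfold)
    then have "continuous_on (ball 0 r \<times> ball 0 r)
        (\<lambda>p. (\<lambda>(p, w). (deriv ^^ k) (f (fst p) (snd p)) w) (p, 0))"
      by (rule continuous_on_compose2) (use r in \<open>auto intro!: continuous_intros\<close>)
    then show "continuous_on (ball 0 r \<times> ball 0 r) (\<lambda>(x, y). g k x y)"
      unfolding g_def taylor_coeff_eq case_prod_unfold by (auto intro!: continuous_intros)
    show "g k x holomorphic_on ball 0 r" if "x \<in> ball 0 r" for x
      using dy[OF that] by (meson holomorphic_on_open open_ball)
    show "(\<lambda>x. g k x y) holomorphic_on ball 0 r" if "y \<in> ball 0 r" for y
      using dx[OF _ that] by (meson holomorphic_on_open open_ball)
    fix x y :: complex assume x: "x \<in> ball 0 r" and y: "y \<in> ball 0 r"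
    define Fx where "Fx = fps_expansion (\<lambda>z. deriv (\<lambda>x. f x y z) x) 0"
    define Fy where "Fy = fps_expansion (\<lambda>z. deriv (\<lambda>y. f x y z) y) 0"
    define F where "F = fps_expansion (f x y) 0"
    have Fx: "(\<lambda>z. deriv (\<lambda>x. f x y z) x) has_fps_expansion Fx"
      unfolding Fx_def using holomorphic_on_deriv_param[OF cont1[OF y] hol3[OF _ y] hol1[OF y] x] r
      by (rule has_taylor_expansion)
    have Fy: "(\<lambda>z. deriv (\<lambda>y. f x y z) y) has_fps_expansion Fy"
      unfolding Fy_def using holomorphic_on_deriv_param[OF cont2[OF x] hol3[OF x] hol2[OF x] y] r
      by (rule has_taylor_expansion)
    have F: "f x y has_fps_expansion F"
      unfolding F_def using hol3[OF x y] r by (rule has_taylor_expansion)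
    have "(\<lambda>z. x * (x - 2 * y\<^sup>2 - y) * deriv (\<lambda>x. f x y z) x + y * (x - y\<^sup>2 - y) * deriv (\<lambda>y. f x y z) y
        - (x - y\<^sup>2 - y) * (z * deriv (f x y) z)) has_fps_expansion
      fps_const (x * (x - 2 * y\<^sup>2 - y)) * Fx + fps_const (y * (x - y\<^sup>2 - y)) * Fy
        - fps_const (x - y\<^sup>2 - y) * (fps_X * fps_deriv F)" (is "?f has_fps_expansion ?F")
      by (intro fps_expansion_intros F Fx Fy)
    moreover have "?f z = 0" if z: "z \<in> ball 0 r" for z
      using pde[OF x y z] by (simp add: mult_ac)
    ultimately have "?F = 0"
      using r fps_expansion_zero by blast
    from arg_cong[OF this, of "\<lambda>F. fps_nth F k"]
    have "x * (x - 2 * y\<^sup>2 - y) * fps_nth Fx k + y * (x - y\<^sup>2 - y) * fps_nth Fy k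
        - (x - y\<^sup>2 - y) * (of_nat k * fps_nth F k) = 0"
      by (simp add: fps_deriv_nth)
    moreover have "fps_nth Fx k = deriv (\<lambda>x. g k x y) x"
      unfolding Fx_def by (rule sym, rule DERIV_imp_deriv[OF dx[OF x y]])
    moreover have "fps_nth Fy k = deriv (g k x) y"
      unfolding Fy_def by (rule sym, rule DERIV_imp_deriv[OF dy[OF x y]])
    moreover have "fps_nth F k = g k x y" by (simp add: F_def g_def)
    ultimately show "x * (x - 2 * y\<^sup>2 - y) * deriv (\<lambda>x. g k x y) x
      + (x - y\<^sup>2 - y) * (y * deriv (g k x) y - of_nat k * g k x y) = 0"
      by (simp add: algebra_simps)
  qed
  show ?thesis
  proof (rule that)
    fix x y z :: complex assume xyz: "x \<in> ball 0 r" "y \<in> ball 0 r" "z \<in> ball 0 r"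
    have "(\<lambda>k. g k x y * z ^ k) sums f x y z"
      using taylor_sums[OF hol3[OF xyz(1,2)] xyz(3)] by (simp add: g_def)
    then show "(\<lambda>k. taylor_coeff (g k 0) k * (y * z) ^ k) sums f x y z"
      using gform[OF xyz(1,2)] by (simp add: power_mult_distrib mult.assoc)
  qed
qed

section \<open>Small plaques inside leaves, and derivatives along them\<close>

lemma tendsto_vec3:
  assumes "(f \<longlongrightarrow> a) F" "(g \<longlongrightarrow> b) F" "(h \<longlongrightarrow> c) F"
  shows "((\<lambda>q. vector [f q, g q, h q] :: complex^3) \<longlongrightarrow> vector [a, b, c]) F"
proof (rule vec_tendstoI)
  fix i :: 3
  show "((\<lambda>q. (vector [f q, g q, h q] :: complex^3) $ i) \<longlongrightarrow> vector [a, b, c] $ i) F"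
    using exhaust_3[of i] assms by auto
qed

lemma continuous_on_vec3:
  assumes "continuous_on S f" "continuous_on S g" "continuous_on S h"
  shows "continuous_on S (\<lambda>q. vector [f q, g q, h q] :: complex^3)"
  using assms unfolding continuous_on_def by (auto intro: tendsto_vec3)

lemma vec3_collapse: "vector [p $ 1, p $ 2, p $ 3] = (p :: 'a::zero^3)"
  by (simp add: vec_eq_iff forall_3)

lemma has_field_derivative_vec3_coords:
  fixes v :: "complex^3"
  assumes "(f has_field_derivative v $ 1) F" "(g has_field_derivative v $ 2) F"
    "(h has_field_derivative v $ 3) F"
  shows "((\<lambda>\<sigma>. (vector [f \<sigma>, g \<sigma>, h \<sigma>] :: complex^3) $ i) has_field_derivative v $ i) F"
  using exhaust_3[of i] assms by auto

lemma plaque_near: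
  fixes \<psi> :: "complex \<Rightarrow> complex^'n::finite"
  assumes "open U" "\<psi> c \<in> U" "open W" "c \<in> W"
    and der: "\<And>\<tau> i. \<tau> \<in> W \<Longrightarrow>
      ((\<lambda>\<sigma>. \<psi> \<sigma> $ i) has_field_derivative \<mu> \<tau> * Z (\<psi> \<tau>) $ i) (at \<tau>)"
    and hol: "\<mu> holomorphic_on W" and nz: "\<And>\<tau>. \<tau> \<in> W \<Longrightarrow> \<mu> \<tau> \<noteq> 0"
  shows "\<exists>e>0. \<forall>\<tau>\<in>ball c e. \<tau> \<in> W \<and> \<psi> \<tau> \<in> leaf Z U (\<psi> c)"
proof -
  have "continuous_on W \<psi>"
    unfolding continuous_on_def
  proof (intro ballI vec_tendstoI)
    fix \<tau> i assume "\<tau> \<in> W"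
    then have "isCont (\<lambda>\<sigma>. \<psi> \<sigma> $ i) \<tau>" using der DERIV_isCont by blast
    then show "((\<lambda>\<sigma>. \<psi> \<sigma> $ i) \<longlongrightarrow> \<psi> \<tau> $ i) (at \<tau> within W)"
      unfolding isCont_def by (rule tendsto_within_subset) simp
  qed
  then have 1: "open (W \<inter> \<psi> -` U)"
    using assms(1,3) continuous_open_preimage by blast
  have 2: "c \<in> W \<inter> \<psi> -` U" using assms(2,4) by simp
  have 3: "\<psi> \<tau> \<in> U" if "\<tau> \<in> W \<inter> \<psi> -` U" for \<tau> using that by simp
  have 4: "((\<lambda>\<sigma>. \<psi> \<sigma> $ i) has_field_derivative \<mu> \<tau> * Z (\<psi> \<tau>) $ i) (at \<tau>)"
    if "\<tau> \<in> W \<inter> \<psi> -` U" for \<tau> i using that der by simp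
  have 5: "\<mu> holomorphic_on W \<inter> \<psi> -` U"
    using hol by (rule holomorphic_on_subset) simp
  have 6: "\<mu> \<tau> \<noteq> 0" if "\<tau> \<in> W \<inter> \<psi> -` U" for \<tau> using that nz by simp
  obtain r where r: "r > 0" "ball c r \<subseteq> W \<inter> \<psi> -` U"
      "\<And>\<tau>. \<tau> \<in> ball c r \<Longrightarrow> same_curve Z U (\<psi> c) (\<psi> \<tau>)"
    using local_plaque_in_leaf[of "W \<inter> \<psi> -` U" c \<psi> U \<mu> Z, OF 1 2 3 4 5 6] by metis
  have "\<tau> \<in> W \<and> \<psi> \<tau> \<in> leaf Z U (\<psi> c)" if "\<tau> \<in> ball c r" for \<tau>
    using r(2) r(3)[OF that] that by (auto simp: leaf_def)
  then show ?thesis using r(1) by blast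
qed

lemma plaqueX_near:
  assumes "open U" "plaqueX C w c \<in> U" "c\<^sup>2 \<noteq> C"
  shows "\<exists>e>0. \<forall>\<tau>\<in>ball c e. \<tau>\<^sup>2 \<noteq> C \<and> plaqueX C w \<tau> \<in> leaf X_field U (plaqueX C w c)"
proof -
  have "open {\<tau>. \<tau>\<^sup>2 \<noteq> C}"
    by (intro open_Collect_neq continuous_intros)
  moreover have "(\<lambda>\<tau>. 1 / (\<tau>\<^sup>2 - C)\<^sup>2) holomorphic_on {\<tau>. \<tau>\<^sup>2 \<noteq> C}"
    by (intro holomorphic_intros) simp
  ultimately show ?thesis
    using plaque_near[where Z = X_field and U = U and \<psi> = "plaqueX C w" and c = c and W = "{\<tau>. \<tau>\<^sup>2 \<noteq> C}"
        and \<mu> = "\<lambda>\<tau>. 1 / (\<tau>\<^sup>2 - C)\<^sup>2", OF assms(1,2)] assms(3) deriv_plaqueX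
    by (simp del: mem_ball)
qed

lemma plaqueX0_near:
  assumes "open U" "plaqueX0 k c \<in> U" "c \<noteq> 0"
  shows "\<exists>e>0. \<forall>\<tau>\<in>ball c e. \<tau> \<noteq> 0 \<and> plaqueX0 k \<tau> \<in> leaf X_field U (plaqueX0 k c)"
proof -
  have "open {\<tau>::complex. \<tau> \<noteq> 0}"
    by (intro open_Collect_neq continuous_intros)
  moreover have "(\<lambda>\<tau>. 1 / (2 * \<tau>\<^sup>2)) holomorphic_on {\<tau>. \<tau> \<noteq> 0}"
    by (intro holomorphic_intros) simp
  ultimately show ?thesis
    using plaque_near[where Z = X_field and U = U and \<psi> = "plaqueX0 k" and c = c and W = "{\<tau>. \<tau> \<noteq> 0}"
        and \<mu> = "\<lambda>\<tau>. 1 / (2 * \<tau>\<^sup>2)", OF assms(1,2)] assms(3) deriv_plaqueX0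
    by (simp del: mem_ball)
qed

lemma plaqueY_near:
  assumes "open U" "plaqueY s0 u0 k c \<in> U" "coordY s0 u0 c \<noteq> 0"
  shows "\<exists>e>0. \<forall>\<tau>\<in>ball c e. coordY s0 u0 \<tau> \<noteq> 0 \<and> plaqueY s0 u0 k \<tau> \<in> leaf Y_field U (plaqueY s0 u0 k c)"
proof -
  have c: "coordY s0 u0 holomorphic_on W" for W
    unfolding coordY_def[abs_def] by (intro holomorphic_intros)
  have "open {\<tau>. coordY s0 u0 \<tau> \<noteq> 0}"
    using c by (intro open_Collect_neq continuous_intros holomorphic_on_imp_continuous_on)
  moreover have "(\<lambda>\<tau>. 1 / (coordY s0 u0 \<tau>)\<^sup>2) holomorphic_on {\<tau>. coordY s0 u0 \<tau> \<noteq> 0}"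
    by (intro holomorphic_intros c) simp
  ultimately show ?thesis
    using plaque_near[where Z = Y_field and U = U and \<psi> = "plaqueY s0 u0 k" and c = c and W = "{\<tau>. coordY s0 u0 \<tau> \<noteq> 0}"
        and \<mu> = "\<lambda>\<tau>. 1 / (coordY s0 u0 \<tau>)\<^sup>2", OF assms(1,2)] assms(3) deriv_plaqueY
    by (simp del: mem_ball)
qed

lemma plaqueY0_near:
  assumes "open U" "plaqueY0 k c \<in> U" "c \<noteq> 0"
  shows "\<exists>e>0. \<forall>\<tau>\<in>ball c e. \<tau> \<noteq> 0 \<and> plaqueY0 k \<tau> \<in> leaf Y_field U (plaqueY0 k c)"
proof -
  have "open {\<tau>::complex. \<tau> \<noteq> 0}"
    by (intro open_Collect_neq continuous_intros)
  moreover have "(\<lambda>\<tau>. 1 / \<tau>\<^sup>2) holomorphic_on {\<tau>. \<tau> \<noteq> 0}"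
    by (intro holomorphic_intros) simp
  ultimately show ?thesis
    using plaque_near[where Z = Y_field and U = U and \<psi> = "plaqueY0 k" and c = c and W = "{\<tau>. \<tau> \<noteq> 0}"
        and \<mu> = "\<lambda>\<tau>. 1 / \<tau>\<^sup>2", OF assms(1,2)] assms(3) deriv_plaqueY0
    by (simp del: mem_ball)
qed

lemma coordY_0 [simp]: "coordY s0 u0 0 = u0"
  by (simp add: coordY_def)

lemma slopeY_0 [simp]: "slopeY s0 0 = s0"
  by (simp add: slopeY_def)

lemma constant_along_curve:
  fixes F :: "complex^'n::finite \<Rightarrow> complex"
  assumes "(F has_derivative (\<lambda>v. \<Sum>i\<in>UNIV. a $ i * v $ i)) (at (\<psi> c))"
    and "\<And>i. ((\<lambda>\<sigma>. \<psi> \<sigma> $ i) has_field_derivative d $ i) (at c)"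
    and "e > 0" "\<And>\<tau>. \<tau> \<in> ball c e \<Longrightarrow> F (\<psi> \<tau>) = C"
  shows "(\<Sum>i\<in>UNIV. a $ i * d $ i) = 0"
proof -
  have "((\<lambda>\<tau>. C) has_field_derivative (\<Sum>i\<in>UNIV. a $ i * d $ i)) (at c)"
    by (rule has_field_derivative_transform_within_open[OF has_field_derivative_along_curve[OF assms(1,2)]
          open_ball[of c e]]) (use assms(3,4) in auto)
  then show ?thesis using DERIV_const DERIV_unique by blast
qed

text \<open>Constancy on leaves becomes a differential equation only once the leaf is known to
  contain a curve tangent to \<open>Y\<close> at \<open>p\<close>. The explicit plaques supply such
  a curve, with separate formulas for \<open>u \<noteq> 0\<close> and \<open>u = 0\<close>.\<close>

lemma Y_derivative_zero:
  assumes U: "open U" "p \<in> U"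
    and const: "\<And>L. L \<in> leaves Y_field U \<Longrightarrow> F constant_on L"
    and F: "(F has_derivative (\<lambda>v. \<Sum>i\<in>UNIV. a $ i * v $ i)) (at p)"
  shows "(\<Sum>i\<in>UNIV. a $ i * Y_field p $ i) = 0"
proof (cases "p \<in> sing Y_field")
  case True
  then show ?thesis by (simp add: sing_def)
next
  case False
  then have leafF: "F q = F p" if "q \<in> leaf Y_field U p" for q
    using const[of "leaf Y_field U p"] that U(2) leaf_refl[of p]
    unfolding leaves_def constant_on_def by (metis DiffI imageI)
  show ?thesis
  proof (cases "p $ 2 = 0")
    case False
    define s0 where "s0 = p $ 1 / p $ 2"
    define k where "k = p $ 2 * p $ 3"
    have p: "plaqueY s0 (p $ 2) k 0 = p"
      using False vec3_collapse[of p] by (simp add: plaqueY_def s0_def k_def)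
    obtain e where e: "e > 0" "\<And>\<tau>. \<tau> \<in> ball 0 e \<Longrightarrow> plaqueY s0 (p $ 2) k \<tau> \<in> leaf Y_field U p"
      using plaqueY_near[of U s0 "p $ 2" k 0] U False unfolding p by auto
    have "(\<Sum>i\<in>UNIV. a $ i * ((1 / (p $ 2)\<^sup>2) *s Y_field p) $ i) = 0"
    proof (rule constant_along_curve[where \<psi> = "plaqueY s0 (p $ 2) k" and c = 0 and F = F, OF _ _ e(1)])
      show "((\<lambda>\<sigma>. plaqueY s0 (p $ 2) k \<sigma> $ i) has_field_derivative ((1 / (p $ 2)\<^sup>2) *s Y_field p) $ i) (at 0)" for i
        using deriv_plaqueY[of s0 "p $ 2" 0 k i] False by (simp add: p)
    qed (use F p e(2) leafF in auto)
    moreover have "(\<Sum>i\<in>UNIV. a $ i * ((1 / (p $ 2)\<^sup>2) *s Y_field p) $ i) =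
        (1 / (p $ 2)\<^sup>2) * (\<Sum>i\<in>UNIV. a $ i * Y_field p $ i)"
      by (simp add: sum_divide_distrib)
    ultimately show ?thesis using False by simp
  next
    case True
    then have x: "p $ 1 \<noteq> 0" using False
      by (auto simp: sing_def Y_field_def Let_def vec_eq_iff forall_3)
    define k where "k = p $ 1 * p $ 3"
    have p: "plaqueY0 k (p $ 1) = p"
      using x True vec3_collapse[of p] by (simp add: plaqueY0_def k_def)
    obtain e where e: "e > 0" "\<And>\<tau>. \<tau> \<in> ball (p $ 1) e \<Longrightarrow> plaqueY0 k \<tau> \<in> leaf Y_field U p"
      using plaqueY0_near[of U k "p $ 1"] U x unfolding p by blast
    have "(\<Sum>i\<in>UNIV. a $ i * ((1 / (p $ 1)\<^sup>2) *s Y_field p) $ i) = 0"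
    proof (rule constant_along_curve[where \<psi> = "plaqueY0 k" and c = "p $ 1" and F = F, OF _ _ e(1)])
      show "((\<lambda>\<sigma>. plaqueY0 k \<sigma> $ i) has_field_derivative ((1 / (p $ 1)\<^sup>2) *s Y_field p) $ i) (at (p $ 1))" for i
        using deriv_plaqueY0[OF x, of k i] by (simp add: p)
    qed (use F p e(2) leafF in auto)
    moreover have "(\<Sum>i\<in>UNIV. a $ i * ((1 / (p $ 1)\<^sup>2) *s Y_field p) $ i) =
        (1 / (p $ 1)\<^sup>2) * (\<Sum>i\<in>UNIV. a $ i * Y_field p $ i)"
      by (simp add: sum_divide_distrib)
    ultimately show ?thesis using x by simp
  qed
qed

section \<open>The differential of a first integral of \<open>Y\<close>\<close>

definition polydisc :: "real \<Rightarrow> (complex^3) set"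
  where "polydisc r = {p. \<forall>i. p $ i \<in> ball 0 r}"

lemma open_polydisc: "open (polydisc r)"
proof -
  have "polydisc r = (\<Inter>i. (\<lambda>p. p $ i) -` ball 0 r)" by (auto simp: polydisc_def)
  then show ?thesis by (auto intro!: open_INT open_vimage continuous_intros)
qed

lemma polydisc_subset:
  assumes "open U" "0 \<in> U"
  obtains r where "r > 0" "polydisc r \<subseteq> U"
proof -
  obtain A where A: "\<And>i. open (A i)" "\<And>i. 0 \<in> A i" "\<And>y. (\<And>i. y $ i \<in> A i) \<Longrightarrow> y \<in> U"
    using assms unfolding open_vec_def by (metis zero_index)
  have "\<forall>i. \<exists>r>0. ball 0 r \<subseteq> A i" using A(1,2) openE by blast
  then obtain R where R: "\<And>i. R i > 0" "\<And>i. ball 0 (R i) \<subseteq> A i" by metis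
  define r where "r = Min (range R)"
  have r: "r > 0" "\<And>i. r \<le> R i" using R by (auto simp: r_def)
  have "p \<in> U" if "p \<in> polydisc r" for p
  proof (rule A(3))
    fix i
    have "norm (p $ i) < r" using that by (simp add: polydisc_def)
    then have "p $ i \<in> ball 0 (R i)" using r(2)[of i] by simp
    then show "p $ i \<in> A i" using R(2) by blast
  qed
  then show ?thesis using that r(1) by blast
qed

text \<open>The differential of \<open>F\<close> at \<open>p\<close> is that of a function of the product of the last two coordinates.\<close>

definition factors_at :: "(complex^3 \<Rightarrow> complex) \<Rightarrow> complex^3 \<Rightarrow> bool"
  where "factors_at F p \<longleftrightarrow> (\<exists>a. (F has_derivative (\<lambda>v. \<Sum>i\<in>UNIV. a $ i * v $ i)) (at p) \<and>
    a $ 1 = 0 \<and> p $ 2 * a $ 2 = p $ 3 * a $ 3 \<and> (p $ 2 = 0 \<longrightarrow> p $ 3 = 0 \<longrightarrow> a $ 2 = 0 \<and> a $ 3 = 0))"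

text \<open>The series is used only to see that the value depends on \<open>y * z\<close> alone.
  Hence \<open>F\<close> is constant along curves preserving this product: translations in
  \<open>x\<close>, the hyperbolic flow \<open>(y * exp \<tau>, z * exp (- \<tau>))\<close>, and
  both remaining axis directions where \<open>y = z = 0\<close>. Their tangent vectors give the
  equations in \<open>factors_at\<close>, so no series has to be differentiated.\<close>

lemma Y_first_integral_derivative:
  assumes "first_integral Y_field F"
  shows "\<forall>\<^sub>F p in nhds 0. factors_at F p"
proof -
  obtain U where U: "0 \<in> U" "open U" "\<And>p. p \<in> U \<Longrightarrow> \<exists>a. (F has_derivative (\<lambda>v. \<Sum>i\<in>UNIV. a $ i * v $ i)) (at p)"
      "\<And>L. L \<in> leaves Y_field U \<Longrightarrow> F constant_on L"
    using assms unfolding first_integral_def holomorphic_fun_def by blast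
  obtain A where A: "\<And>p. p \<in> U \<Longrightarrow> (F has_derivative (\<lambda>v. \<Sum>i\<in>UNIV. A p $ i * v $ i)) (at p)"
    using U(3) by metis
  obtain r where r: "r > 0" "polydisc r \<subseteq> U" using polydisc_subset U(1,2) by blast
  define f where "f = (\<lambda>x y z. F (vector [x, y, z]))"
  have inP: "vector [x, y, z] \<in> polydisc r \<longleftrightarrow> x \<in> ball 0 r \<and> y \<in> ball 0 r \<and> z \<in> ball 0 r" for x y z
    by (simp add: polydisc_def forall_3)
  have d: "((\<lambda>x. f x y z) has_field_derivative A (vector [x, y, z]) $ 1) (at x)"
      "((\<lambda>y. f x y z) has_field_derivative A (vector [x, y, z]) $ 2) (at y)"
      "(f x y has_field_derivative A (vector [x, y, z]) $ 3) (at z)"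
    if "x \<in> ball 0 r" "y \<in> ball 0 r" "z \<in> ball 0 r" for x y z
  proof -
    have p: "(F has_derivative (\<lambda>v. \<Sum>i\<in>UNIV. A (vector [x, y, z]) $ i * v $ i)) (at (vector [x, y, z]))"
      using A r(2) that inP by blast
    have along: "((\<lambda>\<tau>. F (vector [f1 \<tau>, f2 \<tau>, f3 \<tau>])) has_field_derivative
        (\<Sum>i\<in>UNIV. A (vector [x, y, z]) $ i * v $ i)) (at c)"
      if "vector [f1 c, f2 c, f3 c] = (vector [x, y, z] :: complex^3)"
        "(f1 has_field_derivative v $ 1) (at c)" "(f2 has_field_derivative v $ 2) (at c)"
        "(f3 has_field_derivative v $ 3) (at c)" for f1 f2 f3 c and v :: "complex^3"
      using p that(1) has_field_derivative_vec3_coords[OF that(2-4)]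
      by (intro has_field_derivative_along_curve) simp_all
    show "((\<lambda>x. f x y z) has_field_derivative A (vector [x, y, z]) $ 1) (at x)"
      using along[of "\<lambda>x. x" x "\<lambda>_. y" "\<lambda>_. z" "vector [1, 0, 0]"] by (simp add: f_def sum_3)
    show "((\<lambda>y. f x y z) has_field_derivative A (vector [x, y, z]) $ 2) (at y)"
      using along[of "\<lambda>_. x" y "\<lambda>y. y" "\<lambda>_. z" "vector [0, 1, 0]"] by (simp add: f_def sum_3)
    show "(f x y has_field_derivative A (vector [x, y, z]) $ 3) (at z)"
      using along[of "\<lambda>_. x" z "\<lambda>_. y" "\<lambda>z. z" "vector [0, 0, 1]"] by (simp add: f_def sum_3)
  qed
  obtain c where c: "\<And>x y z. x \<in> ball 0 r \<Longrightarrow> y \<in> ball 0 r \<Longrightarrow> z \<in> ball 0 r \<Longrightarrow>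
      (\<lambda>k. c k * (y * z) ^ k) sums f x y z"
  proof (rule first_integral_form[OF r(1), of f])
    have "continuous_on U F"
      using A by (meson has_derivative_continuous continuous_at_imp_continuous_on)
    then have "continuous_on ((ball 0 r \<times> ball 0 r) \<times> ball 0 r) (\<lambda>q. F (vector [fst (fst q), snd (fst q), snd q]))"
      by (rule continuous_on_compose2)
        (use r(2) inP in \<open>auto intro!: continuous_intros continuous_on_vec3\<close>)
    then show "continuous_on ((ball 0 r \<times> ball 0 r) \<times> ball 0 r) (\<lambda>((x, y), z). f x y z)"
      by (simp add: f_def case_prod_unfold)
    show "x * (x - 2 * y\<^sup>2 - y) * deriv (\<lambda>x. f x y z) x + y * (x - y\<^sup>2 - y) * deriv (\<lambda>y. f x y z) y
      - z * (x - y\<^sup>2 - y) * deriv (f x y) z = 0"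
      if xyz: "x \<in> ball 0 r" "y \<in> ball 0 r" "z \<in> ball 0 r" for x y z
    proof -
      have p: "vector [x, y, z] \<in> U" using xyz inP r(2) by blast
      show ?thesis
        using Y_derivative_zero[OF U(2) p U(4) A[OF p]] DERIV_imp_deriv[OF d(1)[OF xyz]]
          DERIV_imp_deriv[OF d(2)[OF xyz]] DERIV_imp_deriv[OF d(3)[OF xyz]]
        by (simp add: sum_3 Y_field_def Let_def algebra_simps)
    qed
  qed (use d in \<open>meson holomorphic_on_open open_ball\<close>)+
  have feq: "f x y z = f x' y' z'"
    if "vector [x, y, z] \<in> polydisc r" "vector [x', y', z'] \<in> polydisc r" "y * z = y' * z'" for x y z x' y' z'
    using c[of x y z] c[of x' y' z'] that inP by (metis sums_unique2)
  have key: "(\<Sum>i\<in>UNIV. A p $ i * v $ i) = 0"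
    if p: "p \<in> polydisc r" and \<psi>0: "vector [f1 0, f2 0, f3 0] = p"
      and der: "(f1 has_field_derivative v $ 1) (at 0)" "(f2 has_field_derivative v $ 2) (at 0)"
        "(f3 has_field_derivative v $ 3) (at 0)"
      and cont: "continuous_on UNIV f1" "continuous_on UNIV f2" "continuous_on UNIV f3"
      and prod: "\<And>\<tau>. f2 \<tau> * f3 \<tau> = p $ 2 * p $ 3" for p v f1 f2 f3
  proof -
    have "continuous_on UNIV (\<lambda>\<tau>. vector [f1 \<tau>, f2 \<tau>, f3 \<tau>] :: complex^3)"
      by (intro continuous_on_vec3 cont)
    then have "open ((\<lambda>\<tau>. vector [f1 \<tau>, f2 \<tau>, f3 \<tau>] :: complex^3) -` polydisc r)"
      using open_polydisc by (simp add: continuous_on_open_vimage)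
    moreover have "0 \<in> (\<lambda>\<tau>. vector [f1 \<tau>, f2 \<tau>, f3 \<tau>] :: complex^3) -` polydisc r"
      using p \<psi>0 by simp
    ultimately obtain e where e: "e > 0"
        "ball 0 e \<subseteq> (\<lambda>\<tau>. vector [f1 \<tau>, f2 \<tau>, f3 \<tau>] :: complex^3) -` polydisc r"
      by (rule openE)
    show ?thesis
    proof (rule constant_along_curve[where F = F and \<psi> = "\<lambda>\<tau>. vector [f1 \<tau>, f2 \<tau>, f3 \<tau>]" and c = 0, OF _ _ e(1)])
      show "((\<lambda>\<sigma>. vector [f1 \<sigma>, f2 \<sigma>, f3 \<sigma>] $ i) has_field_derivative v $ i) (at 0)" for i
        using der by (rule has_field_derivative_vec3_coords)
      show "F (vector [f1 \<tau>, f2 \<tau>, f3 \<tau>]) = F p" if "\<tau> \<in> ball 0 e" for \<tau>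
      proof -
        have "vector [f1 \<tau>, f2 \<tau>, f3 \<tau>] \<in> polydisc r" using e(2) that by blast
        moreover have "vector [p $ 1, p $ 2, p $ 3] \<in> polydisc r" using p by (simp add: vec3_collapse)
        ultimately have "f (f1 \<tau>) (f2 \<tau>) (f3 \<tau>) = f (p $ 1) (p $ 2) (p $ 3)"
          using prod by (rule feq)
        then show ?thesis by (simp add: f_def vec3_collapse)
      qed
      have "p \<in> U" using p r(2) by blast
      then show "(F has_derivative (\<lambda>v. \<Sum>i\<in>UNIV. A p $ i * v $ i)) (at (vector [f1 0, f2 0, f3 0]))"
        unfolding \<psi>0 by (rule A)
    qed
  qed
  have "\<forall>\<^sub>F p in nhds 0. p \<in> polydisc r"
    by (rule eventually_nhds_in_open[OF open_polydisc]) (simp add: polydisc_def r(1))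
  then show ?thesis
  proof (rule eventually_mono, unfold factors_at_def, intro exI conjI impI)
    fix p assume p: "p \<in> polydisc r"
    show "(F has_derivative (\<lambda>v. \<Sum>i\<in>UNIV. A p $ i * v $ i)) (at p)" using A p r(2) by blast
    have "(\<Sum>i\<in>UNIV. A p $ i * vector [1, 0, 0] $ i) = 0"
      by (rule key[OF p, of "\<lambda>\<tau>. p $ 1 + \<tau>" "\<lambda>\<tau>. p $ 2" "\<lambda>\<tau>. p $ 3"])
        (auto simp: vec3_collapse intro!: derivative_eq_intros continuous_intros)
    then show "A p $ 1 = 0" by (simp add: sum_3)
    have "(\<Sum>i\<in>UNIV. A p $ i * vector [0, p $ 2, - p $ 3] $ i) = 0"
      by (rule key[OF p, of "\<lambda>\<tau>. p $ 1" "\<lambda>\<tau>. p $ 2 * exp \<tau>" "\<lambda>\<tau>. p $ 3 * exp (- \<tau>)"])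
        (auto simp: vec3_collapse exp_minus intro!: derivative_eq_intros continuous_intros)
    then show "p $ 2 * A p $ 2 = p $ 3 * A p $ 3" by (simp add: sum_3 algebra_simps)
    assume 0: "p $ 2 = 0" "p $ 3 = 0"
    have "(\<Sum>i\<in>UNIV. A p $ i * vector [0, 1, 0] $ i) = 0"
      by (rule key[OF p, of "\<lambda>\<tau>. p $ 1" "\<lambda>\<tau>. \<tau>" "\<lambda>\<tau>. 0"])
        (use 0 in \<open>auto simp: vec_eq_iff forall_3 intro!: derivative_eq_intros continuous_intros\<close>)
    then show "A p $ 2 = 0" by (simp add: sum_3)
    have "(\<Sum>i\<in>UNIV. A p $ i * vector [0, 0, 1] $ i) = 0"
      by (rule key[OF p, of "\<lambda>\<tau>. p $ 1" "\<lambda>\<tau>. 0" "\<lambda>\<tau>. \<tau>"])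
        (use 0 in \<open>auto simp: vec_eq_iff forall_3 intro!: derivative_eq_intros continuous_intros\<close>)
    then show "A p $ 3 = 0" by (simp add: sum_3)
  qed
qed

text \<open>Both differentials lack the first component and satisfy the same linear relation, so
  their remaining minor is annihilated by \<open>y\<close> and by \<open>z\<close>. Where both
  vanish, the differential of \<open>F\<close> is zero itself.\<close>

lemma Y_dependent_integrals:
  assumes "first_integral Y_field F" "first_integral Y_field G"
  shows "\<not> independent_integrals F G"
proof -
  have "\<forall>\<^sub>F p in nhds 0. \<forall>u v. wedge_diff F G p u v = 0"
    using Y_first_integral_derivative[OF assms(1)] Y_first_integral_derivative[OF assms(2)]
  proof (rule eventually_elim2, intro allI)
    fix p u v :: "complex^3"
    assume F: "factors_at F p"
    assume G: "factors_at G p"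
    obtain a where a: "(F has_derivative (\<lambda>v. \<Sum>i\<in>UNIV. a $ i * v $ i)) (at p)" "a $ 1 = 0"
      "p $ 2 * a $ 2 = p $ 3 * a $ 3" "p $ 2 = 0 \<Longrightarrow> p $ 3 = 0 \<Longrightarrow> a $ 2 = 0 \<and> a $ 3 = 0"
      using F unfolding factors_at_def by blast
    obtain b where b: "(G has_derivative (\<lambda>v. \<Sum>i\<in>UNIV. b $ i * v $ i)) (at p)" "b $ 1 = 0"
      "p $ 2 * b $ 2 = p $ 3 * b $ 3"
      using G unfolding factors_at_def by blast
    have "a $ 2 * b $ 3 - a $ 3 * b $ 2 = 0"
    proof -
      have "p $ 2 * (a $ 2 * b $ 3 - a $ 3 * b $ 2) = (p $ 2 * a $ 2) * b $ 3 - a $ 3 * (p $ 2 * b $ 2)"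
        by (simp add: algebra_simps)
      then have 2: "p $ 2 * (a $ 2 * b $ 3 - a $ 3 * b $ 2) = 0"
        unfolding a(3) b(3) by (simp add: algebra_simps)
      have "p $ 3 * (a $ 2 * b $ 3 - a $ 3 * b $ 2) = a $ 2 * (p $ 3 * b $ 3) - (p $ 3 * a $ 3) * b $ 2"
        by (simp add: algebra_simps)
      then have 3: "p $ 3 * (a $ 2 * b $ 3 - a $ 3 * b $ 2) = 0"
        unfolding a(3)[symmetric] b(3)[symmetric] by (simp add: algebra_simps)
      show ?thesis
      proof (cases "p $ 2 = 0 \<and> p $ 3 = 0")
        case True
        then show ?thesis using a(4) by simp
      next
        case False
        then show ?thesis using 2 3 mult_eq_0_iff by blast
      qed
    qed
    then have "(a $ 2 * b $ 3 - a $ 3 * b $ 2) * (u $ 2 * v $ 3 - u $ 3 * v $ 2) = 0" by simp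
    then show "wedge_diff F G p u v = 0"
      unfolding wedge_diff_def frechet_derivative_at[OF a(1), symmetric] frechet_derivative_at[OF b(1), symmetric]
      by (simp add: sum_3 a(2) b(2) algebra_simps)
  qed
  then show ?thesis by (simp add: independent_integrals_def)
qed

subsection \<open>Transport along the leaves of \<open>Y\<close>\<close>

text \<open>The factor 2 reflects \<open>x = - 2 * a\<close>: on leaves of \<open>X\<close> the
  quantity \<open>t^2 + 2 * a\<close> is constant. The Lipschitz bound says that
  \<open>\<kappa>\<close> is close to a translation, which in particular fixes the sign of the
  square root. The bound \<open>\<rho> \<le> 1 / 2\<close> keeps the disc away from the cut of
  \<open>Ln\<close>.\<close>

locale tangency_chart =
  fixes \<kappa> :: "complex \<Rightarrow> complex" and \<rho> :: real
  assumes eps: "0 < \<rho>" "\<rho> \<le> 1 / 2"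
    and kappa_1: "\<kappa> 1 = 0"
    and kappa_sq: "\<And>m. m \<in> cball 1 \<rho> \<Longrightarrow> (\<kappa> m)\<^sup>2 = 2 * (1 / m + Ln m - 1)"
    and kappa_lipschitz: "\<And>m m'. m \<in> cball 1 \<rho> \<Longrightarrow> m' \<in> cball 1 \<rho> \<Longrightarrow>
      norm ((\<kappa> m - m) - (\<kappa> m' - m')) \<le> 1 / 2 * norm (m - m')"

lemma tangency_chart_exists: "\<exists>\<kappa> \<rho>. tangency_chart \<kappa> \<rho>"
proof -
  define \<Gamma> :: "complex \<Rightarrow> complex" where "\<Gamma> = (\<lambda>m. 2 * (1 / m + Ln m - 1))"
  have pos: "Re m > 0" if "m \<in> ball 1 1" for m :: complex
    using that abs_Re_le_cmod[of "1 - m"] by (auto simp: dist_norm)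
  have nn: "m \<notin> \<real>\<^sub>\<le>\<^sub>0" "m \<noteq> 0" if "m \<in> ball 1 1" for m :: complex
    using pos[OF that] by (auto simp: complex_nonpos_Reals_iff)
  have d\<Gamma>: "(\<Gamma> has_field_derivative 2 * (1 / m - 1 / m\<^sup>2)) (at m)" if "m \<in> ball 1 1" for m
    unfolding \<Gamma>_def using nn[OF that]
    by (auto intro!: derivative_eq_intros simp: field_simps power2_eq_square)
  have hol\<Gamma>: "\<Gamma> holomorphic_on ball 1 1"
    using d\<Gamma> by (meson holomorphic_on_open open_ball)
  have d1: "deriv \<Gamma> m = 2 * (1 / m - 1 / m\<^sup>2)" if "m \<in> ball 1 1" for m
    using d\<Gamma>[OF that] by (rule DERIV_imp_deriv)
  have "((\<lambda>m. 2 * (1 / m - 1 / m\<^sup>2)) has_field_derivative 2) (at (1::complex))"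
    by (auto intro!: derivative_eq_intros)
  then have "(deriv \<Gamma> has_field_derivative 2) (at 1)"
    by (rule has_field_derivative_transform_within_open[OF _ open_ball[of 1 1]]) (simp_all add: d1)
  then have d2: "(deriv ^^ 2) \<Gamma> 1 = 2"
    by (simp add: numeral_2_eq_2 DERIV_imp_deriv)
  \<comment> \<open>\<open>\<Gamma>\<close> has a zero of order exactly two at \<open>1\<close>, so
    it is the square of a function with a simple zero.\<close>
  obtain g r where r: "0 < r" and g: "g holomorphic_on ball 1 r"
      and fac: "\<And>w. w \<in> ball 1 r \<Longrightarrow> \<Gamma> w - \<Gamma> 1 = ((w - 1) * g w) ^ 2"
  proof (rule holomorphic_factor_order_of_zero_strong[OF hol\<Gamma> open_ball, of 1 2])
    show "(deriv ^^ i) \<Gamma> 1 = 0" if "0 < i" "i < 2" for i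
    proof -
      have "i = 1" using that by simp
      then show ?thesis by (simp add: d1)
    qed
  qed (use d2 in auto)
  define s where "s = min r 1"
  have s: "0 < s" "ball 1 s \<subseteq> ball (1::complex) r" "ball 1 s \<subseteq> ball (1::complex) 1"
    using r by (auto simp: s_def)
  have \<Gamma>1: "\<Gamma> 1 = 0" by (simp add: \<Gamma>_def)
  \<comment> \<open>The root \<open>(w - 1) * g w\<close> has derivative \<open>g 1\<close> at
    \<open>1\<close>, which will turn out to be a sign; the extra factor \<open>g 1\<close>
    normalises the derivative to \<open>1\<close>.\<close>
  define \<kappa> where "\<kappa> = (\<lambda>w. g 1 * ((w - 1) * g w))"
  have gs: "g holomorphic_on ball 1 s" using g s(2) holomorphic_on_subset by blast
  have dg: "(g has_field_derivative deriv g w) (at w)" if "w \<in> ball 1 s" for w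
    using holomorphic_derivI[OF gs open_ball that] .
  have dk0: "((\<lambda>w. (w - 1) * g w) has_field_derivative g w + (w - 1) * deriv g w) (at w)" if "w \<in> ball 1 s" for w
    using dg[OF that] by (auto intro!: derivative_eq_intros)
  \<comment> \<open>Differentiate the factorisation, cancel \<open>2 * (w - 1)\<close> away from
    \<open>1\<close>, and pass to the limit.\<close>
  have g1: "g 1 ^ 2 = 1"
  proof -
    have eq: "g w * (g w + (w - 1) * deriv g w) = 1 / w\<^sup>2" if w: "w \<in> ball 1 s" "w \<noteq> 1" for w
    proof -
      have "((\<lambda>w. ((w - 1) * g w) ^ 2) has_field_derivative
          2 * ((w - 1) * g w) * (g w + (w - 1) * deriv g w)) (at w)"
        by (rule DERIV_cong[OF DERIV_power[OF dk0[OF w(1)], of 2]]) (simp add: algebra_simps)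
      then have "(\<Gamma> has_field_derivative 2 * ((w - 1) * g w) * (g w + (w - 1) * deriv g w)) (at w)"
        by (rule has_field_derivative_transform_within_open[OF _ open_ball[of 1 s]])
          (use w fac \<Gamma>1 s in auto)
      then have "2 * ((w - 1) * g w) * (g w + (w - 1) * deriv g w) = 2 * (1 / w - 1 / w\<^sup>2)"
        using d\<Gamma>[of w] w(1) s(3) DERIV_unique by blast
      also have "\<dots> = 2 * (w - 1) * (1 / w\<^sup>2)"
        using nn[of w] w(1) s(3) by (auto simp: field_simps power2_eq_square)
      finally have "2 * (w - 1) * (g w * (g w + (w - 1) * deriv g w)) = 2 * (w - 1) * (1 / w\<^sup>2)"
        by (simp only: mult_ac)
      moreover have "2 * (w - 1) \<noteq> 0" using w(2) by simp
      ultimately show ?thesis using mult_left_cancel by blast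
    qed
    have "(\<lambda>w. g w * (g w + (w - 1) * deriv g w)) holomorphic_on ball 1 s"
      using gs by (intro holomorphic_intros) auto
    then have "isCont (\<lambda>w. g w * (g w + (w - 1) * deriv g w)) 1"
      using s(1) continuous_on_eq_continuous_at[OF open_ball] holomorphic_on_imp_continuous_on
        centre_in_ball by blast
    then have "(\<lambda>w. g w * (g w + (w - 1) * deriv g w)) \<midarrow>1\<rightarrow> g 1 * (g 1 + (1 - 1) * deriv g 1)"
      by (simp add: isCont_def)
    moreover have "\<forall>\<^sub>F w in at 1. g w * (g w + (w - 1) * deriv g w) = 1 / w\<^sup>2"
      using eventually_at_in_open[OF open_ball[of 1 s], of 1] s(1) eq by (auto elim: eventually_mono)
    ultimately have "(\<lambda>w. 1 / w\<^sup>2) \<midarrow>1\<rightarrow> g 1 * (g 1 + (1 - 1) * deriv g 1)"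
      using tendsto_cong by fastforce
    moreover have "(\<lambda>w. 1 / w\<^sup>2) \<midarrow>(1::complex)\<rightarrow> 1 / 1\<^sup>2"
      by (intro tendsto_intros) simp
    ultimately have "g 1 * (g 1 + (1 - 1) * deriv g 1) = 1 / 1\<^sup>2"
      by (rule LIM_unique)
    then show ?thesis by (simp add: power2_eq_square)
  qed
  \<comment> \<open>This is the derivative of \<open>\<kappa> w - w\<close>. It vanishes at
    \<open>1\<close>, so it is at most \<open>1/2\<close> on a small disc.\<close>
  define R' where "R' = (\<lambda>w. g 1 * (g w + (w - 1) * deriv g w) - 1)"
  have dR: "((\<lambda>w. \<kappa> w - w) has_field_derivative R' w) (at w)" if "w \<in> ball 1 s" for w
    unfolding \<kappa>_def R'_def using dk0[OF that]
    by (intro DERIV_diff DERIV_cmult DERIV_ident) simp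
  have "R' holomorphic_on ball 1 s"
    unfolding R'_def using gs by (intro holomorphic_intros) auto
  then have "isCont R' 1"
    using s(1) continuous_on_eq_continuous_at[OF open_ball] holomorphic_on_imp_continuous_on
      centre_in_ball by blast
  moreover have "R' 1 = 0" using g1 by (simp add: R'_def power2_eq_square)
  ultimately have "\<forall>\<^sub>F w in at 1. dist (R' w) 0 < 1 / 2"
    unfolding isCont_def by (intro tendstoD) auto
  then obtain e where e: "e > 0" "\<And>w. w \<noteq> 1 \<Longrightarrow> dist w 1 < e \<Longrightarrow> norm (R' w) < 1 / 2"
    unfolding eventually_at by auto
  define \<rho> where "\<rho> = min (min (e / 2) (s / 2)) (1 / 2)"
  have \<rho>: "0 < \<rho>" "\<rho> < e" "\<rho> < s" "\<rho> \<le> 1 / 2" using e(1) s(1) by (auto simp: \<rho>_def)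
  have sub: "cball 1 \<rho> \<subseteq> ball (1::complex) s" using \<rho> by auto
  have R'le: "norm (R' w) \<le> 1 / 2" if "w \<in> cball 1 \<rho>" for w
    using e(2)[of w] that \<rho>(2) \<open>R' 1 = 0\<close> by (cases "w = 1") (auto simp: dist_commute)
  show ?thesis
  proof (rule exI[of _ \<kappa>], rule exI[of _ \<rho>], rule tangency_chart.intro)
    show "0 < \<rho>" "\<rho> \<le> 1 / 2" using \<rho> by auto
    show "\<kappa> 1 = 0" by (simp add: \<kappa>_def)
    show "(\<kappa> m)\<^sup>2 = 2 * (1 / m + Ln m - 1)" if "m \<in> cball 1 \<rho>" for m
    proof -
      have m: "m \<in> ball 1 r" using that sub s(2) by blast
      have "(\<kappa> m)\<^sup>2 = g 1 ^ 2 * ((m - 1) * g m) ^ 2" by (simp add: \<kappa>_def power_mult_distrib)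
      also have "\<dots> = \<Gamma> m" using fac[OF m] g1 \<Gamma>1 by simp
      finally show ?thesis by (simp add: \<Gamma>_def)
    qed
    show "norm ((\<kappa> m - m) - (\<kappa> m' - m')) \<le> 1 / 2 * norm (m - m')"
      if "m \<in> cball 1 \<rho>" "m' \<in> cball 1 \<rho>" for m m'
    proof (rule field_differentiable_bound[of "cball 1 \<rho>" "\<lambda>w. \<kappa> w - w" R'])
      show "((\<lambda>w. \<kappa> w - w) has_field_derivative R' w) (at w within cball 1 \<rho>)" if "w \<in> cball 1 \<rho>" for w
        using dR[of w] that sub has_field_derivative_at_within by blast
    qed (use R'le that in auto)
  qed
qed

text \<open>Subtracting the linear part leaves a function whose derivative \<open>exp l - 1\<close>
  is small, so the rest can be treated as a perturbation.\<close>

lemma exp_lipschitz_near_0: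
  fixes l l' :: complex
  assumes "norm l \<le> \<rho>" "norm l' \<le> \<rho>" "\<rho> \<le> 1 / 2"
  shows "norm ((exp l - l) - (exp l' - l')) \<le> 2 * \<rho> * norm (l - l')"
proof (rule field_differentiable_bound[of "cball 0 \<rho>" "\<lambda>w. exp w - w" "\<lambda>w. exp w - 1"])
  have e1: "norm (exp z - 1) \<le> 2 * norm (z - 0)" if "z \<in> cball 0 (1/2)" for z :: complex
  proof -
    have "norm (exp z - exp 0) \<le> 2 * norm (z - 0)"
    proof (rule field_differentiable_bound[of "cball 0 (1/2)" exp exp])
      show "norm (exp w) \<le> 2" if "w \<in> cball 0 (1/2)" for w :: complex
        using that by (intro exp_bound_half) simp
    qed (use that in \<open>auto intro!: derivative_eq_intros\<close>)
    then show ?thesis by simp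
  qed
  show "norm (exp z - 1) \<le> 2 * \<rho>" if "z \<in> cball 0 \<rho>" for z :: complex
    using e1[of z] that assms(3) by simp
qed (use assms in \<open>auto intro!: derivative_eq_intros\<close>)

text \<open>Multiply by \<open>csqrt (1 + z) + 1\<close>, whose norm is at least 1 because the
  principal root has nonnegative real part.\<close>

lemma norm_csqrt_1_plus: "norm (csqrt (1 + z) - 1) \<le> norm z"
proof -
  have "(csqrt (1 + z) - 1) * (csqrt (1 + z) + 1) = z"
    by (simp add: algebra_simps flip: power2_eq_square)
  then have "norm (csqrt (1 + z) - 1) * norm (csqrt (1 + z) + 1) = norm z"
    by (metis norm_mult)
  moreover have "1 \<le> norm (csqrt (1 + z) + 1)"
    using Re_csqrt[of "1 + z"] complex_Re_le_cmod[of "csqrt (1 + z) + 1"] by (simp del: csqrt.sel)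
  ultimately show ?thesis
    by (metis mult_left_mono mult.right_neutral norm_ge_zero)
qed

context tangency_chart
begin

text \<open>The projection onto a convex set does not increase distances, so \<open>theta\<close> is the identity plus
  a map with Lipschitz constant \<open>1/2\<close>, hence injective.\<close>

definition theta :: "complex \<Rightarrow> complex"
  where "theta m = m + (\<kappa> (closest_point (cball 1 \<rho>) m) - closest_point (cball 1 \<rho>) m)"

lemma closest_in: "closest_point (cball 1 \<rho>) m \<in> cball (1::complex) \<rho>"
  using eps by (intro closest_point_in_set) auto

lemma theta_lipschitz: "norm ((theta m - m) - (theta m' - m')) \<le> 1 / 2 * norm (m - m')"
proof -
  have "norm ((theta m - m) - (theta m' - m')) \<le>
      1 / 2 * norm (closest_point (cball 1 \<rho>) m - closest_point (cball 1 \<rho>) m')"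
    unfolding theta_def using kappa_lipschitz[OF closest_in[of m] closest_in[of m']] by simp
  also have "\<dots> \<le> 1 / 2 * norm (m - m')"
    using closest_point_lipschitz[of "cball (1::complex) \<rho>" m m'] eps
    by (auto simp: dist_norm)
  finally show ?thesis .
qed

lemma theta_eq_kappa: "m \<in> cball 1 \<rho> \<Longrightarrow> theta m = \<kappa> m"
  by (simp add: theta_def closest_point_self del: mem_cball)

lemma theta_1 [simp]: "theta 1 = 0"
  using theta_eq_kappa[of 1] kappa_1 eps by simp

lemma theta_deviation: "norm (theta m - (m - 1)) \<le> 1 / 2 * norm (m - 1)"
  using theta_lipschitz[of m 1] by (simp add: algebra_simps)

text \<open>The correction depends only on the projected point, which is within
  \<open>\<rho>\<close> of \<open>1\<close>, so the bound is uniform on the unbounded fibre. Through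
  \<open>T_bound\<close> this uniformity gives continuity of \<open>hmap\<close> at
  \<open>u = 0\<close>.\<close>

lemma theta_deviation_eps: "norm (theta m - (m - 1)) \<le> \<rho> / 2"
proof -
  have "theta m - (m - 1) = (theta (closest_point (cball 1 \<rho>) m) - (closest_point (cball 1 \<rho>) m - 1))"
    using theta_eq_kappa[OF closest_in] by (simp add: theta_def)
  then have "norm (theta m - (m - 1)) \<le> 1 / 2 * norm (closest_point (cball 1 \<rho>) m - 1)"
    using theta_deviation[of "closest_point (cball 1 \<rho>) m"] by metis
  also have "\<dots> \<le> \<rho> / 2"
    using closest_in[of m] by (simp add: dist_norm norm_minus_commute)
  finally show ?thesis .
qed

lemma theta_lower: "1 / 2 * norm (m - 1) \<le> norm (theta m)"
  using theta_deviation[of m] norm_triangle_ineq2[of "m - 1" "m - 1 - theta m"]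
  by (simp add: norm_minus_commute)

lemma theta_upper: "norm (theta m - theta m') \<le> 3 / 2 * norm (m - m')"
proof -
  have "norm (theta m - theta m') = norm (((theta m - m) - (theta m' - m')) + (m - m'))"
    by (simp add: algebra_simps)
  also have "\<dots> \<le> norm ((theta m - m) - (theta m' - m')) + norm (m - m')"
    by (rule norm_triangle_ineq)
  finally show ?thesis using theta_lipschitz[of m m'] by simp
qed

lemma theta_inj: "theta m = theta m' \<Longrightarrow> m = m'"
  using theta_lipschitz[of m m'] by (simp add: norm_minus_commute)

lemma continuous_on_theta: "continuous_on S theta"
proof (rule continuous_on_subset[OF _ subset_UNIV])
  have "((\<lambda>x. theta x - theta m) \<longlongrightarrow> 0) (at m)" for m
  proof (rule Lim_null_comparison)
    show "\<forall>\<^sub>F x in at m. norm (theta x - theta m) \<le> 3 / 2 * norm (x - m)"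
      using theta_upper by simp
    have "((\<lambda>x. 3 / 2 * norm (x - m)) \<longlongrightarrow> 3 / 2 * norm (m - m)) (at m)"
      by (intro tendsto_intros)
    then show "((\<lambda>x. 3 / 2 * norm (x - m)) \<longlongrightarrow> 0) (at m)" by simp
  qed
  then show "continuous_on UNIV theta"
    by (simp add: continuous_on_def LIM_zero_iff)
qed

text \<open>A product \<open>m * exp l\<close> is reached from \<open>m\<close> along the leaf in time \<open>a\<close> iff
  \<open>1/m + Ln m + a\<close> is the value of \<open>1/m + Ln m\<close> at the end point; cleared of denominators
  this is \<open>transport_eq m a l\<close>, which also makes sense at \<open>m = 0\<close>.\<close>

definition transport_eq :: "complex \<Rightarrow> complex \<Rightarrow> complex \<Rightarrow> bool"
  where "transport_eq m a l \<longleftrightarrow> (m - 1) * l + (exp (- l) + l - 1) = m * a"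

text \<open>A small multiple of \<open>\<rho>^2\<close> is what the estimates call for:
  displacements of order \<open>d0 / \<rho>\<close> must be small against \<open>\<rho>\<close>. The
  numerical factor is chosen generously.\<close>

definition d0 :: real
  where "d0 = \<rho> ^ 3 / 2 ^ 20"

text \<open>The region away from the tangency \<open>m = 1\<close>, where fibres are transverse to
  leaves. Since \<open>m\<close> is unbounded, smallness of \<open>a\<close> alone would not control
  \<open>m * a\<close>.\<close>

definition outer :: "complex \<Rightarrow> complex \<Rightarrow> bool"
  where "outer m a \<longleftrightarrow> \<rho> / 8 \<le> norm (m - 1) \<and> norm a < d0 \<and> norm (m * a) < d0"

lemma d0_pos: "0 < d0"
  using eps by (simp add: d0_def)

lemma d0_le: "d0 \<le> \<rho>\<^sup>2 / 2 ^ 21" "d0 \<le> \<rho> / 2 ^ 22" "2097152 * d0 \<le> \<rho> * \<rho>"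
proof -
  have "\<rho> * \<rho>\<^sup>2 \<le> 1 / 2 * \<rho>\<^sup>2" using eps by (intro mult_right_mono) auto
  then show 1: "d0 \<le> \<rho>\<^sup>2 / 2 ^ 21" by (simp add: d0_def power3_eq_cube power2_eq_square)
  show "2097152 * d0 \<le> \<rho> * \<rho>" using 1 by (simp add: power2_eq_square)
  have "\<rho> * \<rho> \<le> 1 / 2 * \<rho>" using eps by (intro mult_right_mono) auto
  then show "d0 \<le> \<rho> / 2 ^ 22" using 1 by (simp add: power2_eq_square)
qed

lemma exp_rest_lipschitz:
  fixes l l' :: complex
  assumes "norm l \<le> \<rho> / 64" "norm l' \<le> \<rho> / 64"
  shows "norm ((exp (- l) + l - 1) - (exp (- l') + l' - 1)) \<le> \<rho> / 32 * norm (l - l')"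
proof -
  have "norm ((exp (- l) - - l) - (exp (- l') - - l')) \<le> 2 * (\<rho> / 64) * norm (- l - - l')"
    using assms eps by (intro exp_lipschitz_near_0) auto
  then show ?thesis by (simp add: norm_minus_commute algebra_simps)
qed

text \<open>The linear coefficient \<open>m - 1\<close> has norm at least \<open>\<rho> / 8\<close>
  and dominates the nonlinear rest, whose Lipschitz constant is \<open>\<rho> / 32\<close>.\<close>

lemma transport_unique:
  assumes "\<rho> / 8 \<le> norm (m - 1)" "transport_eq m a l" "transport_eq m a l'"
    and "norm l \<le> \<rho> / 64" "norm l' \<le> \<rho> / 64"
  shows "l = l'"
proof (rule ccontr)
  assume ne: "l \<noteq> l'"
  have "(m - 1) * (l - l') = - ((exp (- l) + l - 1) - (exp (- l') + l' - 1))"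
    using assms(2,3) unfolding transport_eq_def by (simp add: algebra_simps)
  then have "norm (m - 1) * norm (l - l') \<le> \<rho> / 32 * norm (l - l')"
    using exp_rest_lipschitz[OF assms(4,5)] by (metis norm_minus_cancel norm_mult)
  then have "norm (m - 1) \<le> \<rho> / 32" using ne by simp
  then show False using assms(1) eps by simp
qed

lemma transport_exists:
  assumes "outer m a"
  obtains l where "norm l \<le> \<rho> / 64" "transport_eq m a l"
proof -
  have m: "\<rho> / 8 \<le> norm (m - 1)" "norm (m * a) < d0" using assms by (auto simp: outer_def)
  have m0: "m \<noteq> 1" "norm (m - 1) > 0" using m eps by auto
  \<comment> \<open>Solve for the linear term and iterate: the contraction factor is
    \<open>(\<rho> / 32) / (\<rho> / 8) = 1 / 4\<close>, and the disc is preserved because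
    \<open>d0 + \<rho>^2 / 2048 \<le> \<rho>^2 / 512\<close>.\<close>
  define f where "f = (\<lambda>l. (m * a - (exp (- l) + l - 1)) / (m - 1))"
  have "\<exists>!l. l \<in> cball 0 (\<rho> / 64) \<and> f l = l"
  proof (rule Banach_fix[of "cball 0 (\<rho> / 64)" "1 / 4"])
    show "complete (cball (0::complex) (\<rho> / 64))" by (simp add: complete_eq_closed)
    show "cball (0::complex) (\<rho> / 64) \<noteq> {}" using eps by simp
    show "f ` cball 0 (\<rho> / 64) \<subseteq> cball 0 (\<rho> / 64)"
    proof
      fix q assume "q \<in> f ` cball 0 (\<rho> / 64)"
      then obtain l where l: "norm l \<le> \<rho> / 64" "q = f l" by auto
      have "norm (exp (- l) + l - 1) \<le> \<rho> / 32 * norm l"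
        using exp_rest_lipschitz[OF l(1), of 0] eps by simp
      also have "\<dots> \<le> \<rho> / 32 * (\<rho> / 64)" using l eps by (intro mult_left_mono) auto
      finally have "norm (m * a - (exp (- l) + l - 1)) \<le> d0 + \<rho> / 32 * (\<rho> / 64)"
        using m(2) norm_triangle_ineq4[of "m * a" "exp (- l) + l - 1"] by linarith
      also have "\<dots> \<le> \<rho> / 64 * (\<rho> / 8)"
      proof -
        have "\<rho> / 32 * (\<rho> / 64) = (\<rho> * \<rho>) / 2048" "\<rho> / 64 * (\<rho> / 8) = (\<rho> * \<rho>) / 512" by simp_all
        then show ?thesis using d0_le(3) zero_le_square[of \<rho>] by linarith
      qed
      also have "\<dots> \<le> \<rho> / 64 * norm (m - 1)" using m(1) eps by (intro mult_left_mono) auto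
      finally show "q \<in> cball 0 (\<rho> / 64)"
        using m0 by (simp add: l(2) f_def norm_divide pos_divide_le_eq)
    qed
    fix l l' :: complex assume l: "l \<in> cball 0 (\<rho> / 64)" "l' \<in> cball 0 (\<rho> / 64)"
    have "f l - f l' = - ((exp (- l) + l - 1) - (exp (- l') + l' - 1)) / (m - 1)"
      unfolding f_def by (simp add: diff_divide_distrib add_divide_distrib)
    then have "norm (f l - f l') = norm ((exp (- l) + l - 1) - (exp (- l') + l' - 1)) / norm (m - 1)"
      by (metis norm_divide norm_minus_cancel)
    also have "\<dots> \<le> (\<rho> / 32 * norm (l - l')) / norm (m - 1)"
      using exp_rest_lipschitz[of l l'] l by (intro divide_right_mono) auto
    also have "\<dots> \<le> (\<rho> / 32 * norm (l - l')) / (\<rho> / 8)"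
      using m(1) m0(2) eps by (intro divide_left_mono mult_pos_pos) auto
    finally show "dist (f l) (f l') \<le> 1 / 4 * dist l l'"
      using eps by (simp add: dist_norm)
  qed auto
  then obtain l where l: "norm l \<le> \<rho> / 64" "f l = l" by auto
  then have "m * a - (exp (- l) + l - 1) = l * (m - 1)"
    using m0(1) unfolding f_def by (simp add: divide_eq_eq)
  then have "transport_eq m a l"
    unfolding transport_eq_def by (simp add: algebra_simps)
  then show ?thesis using that l(1) by blast
qed

definition ell :: "complex \<Rightarrow> complex \<Rightarrow> complex"
  where "ell m a = (THE l. norm l \<le> \<rho> / 64 \<and> transport_eq m a l)"

lemma
  assumes "outer m a"
  shows ell_small: "norm (ell m a) \<le> \<rho> / 64" and ell_eq: "transport_eq m a (ell m a)"
proof -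
  have "\<exists>!l. norm l \<le> \<rho> / 64 \<and> transport_eq m a l"
    using transport_exists[OF assms] transport_unique assms unfolding outer_def by metis
  from theI'[OF this] show "norm (ell m a) \<le> \<rho> / 64" "transport_eq m a (ell m a)"
    by (simp_all add: ell_def)
qed

lemma ell_eqI:
  assumes "outer m a" "norm l \<le> \<rho> / 64" "transport_eq m a l"
  shows "ell m a = l"
  using transport_unique[of m a "ell m a" l] ell_small ell_eq assms unfolding outer_def by blast

lemma ell_bound:
  assumes "outer m a"
  shows "3 / 4 * (norm (m - 1) * norm (ell m a)) \<le> norm (m * a)"
proof -
  define l where "l = ell m a"
  have m: "\<rho> / 8 \<le> norm (m - 1)" using assms by (auto simp: outer_def)
  have l: "norm l \<le> \<rho> / 64" "transport_eq m a l"
    using ell_small ell_eq assms by (auto simp: l_def)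
  have "norm (exp (- l) + l - 1) \<le> \<rho> / 32 * norm l"
    using exp_rest_lipschitz[OF l(1), of 0] eps by simp
  also have "\<dots> \<le> 1 / 4 * norm (m - 1) * norm l"
    using m by (intro mult_right_mono) auto
  finally have "norm (exp (- l) + l - 1) \<le> 1 / 4 * (norm (m - 1) * norm l)" by simp
  moreover have "norm ((m - 1) * l) \<le> norm (m * a) + norm (exp (- l) + l - 1)"
    using l(2) norm_triangle_ineq4[of "m * a" "exp (- l) + l - 1"]
    unfolding transport_eq_def by (metis add_diff_cancel_right')
  ultimately show ?thesis by (simp add: norm_mult l_def)
qed

text \<open>The strict inequality leaves room to change \<open>l\<close> slightly along a leaf while
  \<open>ell_eqI\<close> still recognises it.\<close>

lemma ell_strict: "outer m a \<Longrightarrow> norm (ell m a) < \<rho> / 64"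
proof -
  assume o: "outer m a"
  have "3 / 4 * (\<rho> / 8 * norm (ell m a)) \<le> 3 / 4 * (norm (m - 1) * norm (ell m a))"
    using o unfolding outer_def by (intro mult_left_mono mult_right_mono) auto
  also have "\<dots> < d0" using ell_bound[OF o] o by (auto simp: outer_def)
  also have "d0 \<le> \<rho> * (\<rho> / 2 ^ 21)" using d0_le(1) by (simp add: power2_eq_square)
  finally have "\<rho> * (3 / 32 * norm (ell m a)) < \<rho> * (\<rho> / 2 ^ 21)" by (simp add: mult_ac)
  then have "3 / 32 * norm (ell m a) < \<rho> / 2 ^ 21" using eps by simp
  then show ?thesis using eps by simp
qed

text \<open>The point where the leaf through \<open>(m, a)\<close> meets the fibre
  \<open>a = 0\<close>.\<close>

definition mhat :: "complex \<Rightarrow> complex \<Rightarrow> complex"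
  where "mhat m a = m * exp (ell m a)"

text \<open>Although \<open>m\<close> is unbounded, \<open>l\<close> shrinks accordingly:
  \<open>norm m * \<rho>\<close> is at most \<open>9 * norm (m - 1)\<close>, so
  \<open>ell_bound\<close> controls the product \<open>m * l\<close>.\<close>

lemma mhat_near:
  assumes "outer m a"
  shows "norm (mhat m a - m) \<le> \<rho> / 64"
proof -
  define l where "l = ell m a"
  have m: "\<rho> / 8 \<le> norm (m - 1)" "norm (m * a) < d0" using assms by (auto simp: outer_def)
  have l: "norm l \<le> \<rho> / 64" using ell_small assms by (auto simp: l_def)
  have "norm ((exp l - l) - (exp 0 - 0)) \<le> 2 * (\<rho> / 64) * norm (l - 0)"
    using l eps by (intro exp_lipschitz_near_0) auto
  also have "\<dots> \<le> 1 * norm (l - 0)" using eps by (intro mult_right_mono) auto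
  finally have "norm (exp l - l - 1) \<le> norm l" by simp
  then have e: "norm (exp l - 1) \<le> 2 * norm l"
    using norm_triangle_ineq[of "exp l - l - 1" l] by simp
  have "norm m * \<rho> \<le> (norm (m - 1) + 1) * \<rho>"
    using norm_triangle_ineq[of "m - 1" 1] eps by (intro mult_right_mono) auto
  also have "\<dots> \<le> norm (m - 1) * 1 + 8 * norm (m - 1)"
    using m(1) eps mult_left_mono[of \<rho> 1 "norm (m - 1)"] by (simp add: algebra_simps)
  finally have "norm m * \<rho> \<le> 9 * norm (m - 1)" by simp
  then have "norm m * \<rho> * norm l \<le> 9 * norm (m - 1) * norm l"
    by (intro mult_right_mono) auto
  also have "\<dots> \<le> 12 * d0"
    using ell_bound[OF assms] m(2) by (simp add: l_def)
  also have "\<dots> \<le> \<rho> * (\<rho> / 2 ^ 17)"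
  proof -
    have "\<rho> * (\<rho> / 2 ^ 17) = (\<rho> * \<rho>) / 131072" by simp
    then show ?thesis using d0_le(3) zero_le_square[of \<rho>] by linarith
  qed
  finally have "\<rho> * (norm m * norm l) \<le> \<rho> * (\<rho> / 2 ^ 17)" by (simp add: mult_ac)
  then have b: "norm m * norm l \<le> \<rho> / 2 ^ 17" using eps by simp
  have "norm (mhat m a - m) = norm m * norm (exp l - 1)"
    by (simp add: mhat_def l_def algebra_simps flip: norm_mult)
  also have "\<dots> \<le> norm m * (2 * norm l)" using e by (intro mult_left_mono) auto
  also have "\<dots> \<le> \<rho> / 64" using b eps by simp
  finally show ?thesis .
qed

lemma mhat_far:
  assumes "outer m a"
  shows "7 / 64 * \<rho> \<le> norm (mhat m a - 1)" "7 / 128 * \<rho> \<le> norm (theta (mhat m a))"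
proof -
  have "norm (m - 1) \<le> norm (mhat m a - m) + norm (mhat m a - 1)"
    using norm_triangle_ineq4[of "mhat m a - 1" "mhat m a - m"] by simp
  then show 1: "7 / 64 * \<rho> \<le> norm (mhat m a - 1)"
    using mhat_near[OF assms] assms by (auto simp: outer_def)
  then show "7 / 128 * \<rho> \<le> norm (theta (mhat m a))"
    using theta_lower[of "mhat m a"] by simp
qed

text \<open>Transport is reversible. Multiplied by \<open>exp l\<close>, the equation expresses
  \<open>l\<close> through the end point \<open>n\<close>, with linear coefficient
  \<open>n - 1\<close>, which is again large compared with the Lipschitz constant of the
  rest.\<close>

lemma mhat_inj:
  assumes o: "outer m a" "outer m' a" and eq: "mhat m a = mhat m' a"
  shows "m = m'"
proof -
  define n where "n = mhat m a"
  define l where "l = ell m a"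
  define l' where "l' = ell m' a"
  have l: "norm l \<le> \<rho> / 64" "norm l' \<le> \<rho> / 64"
    using ell_small o by (auto simp: l_def l'_def)
  have n: "n = m * exp l" "n = m' * exp l'" using eq by (simp_all add: n_def mhat_def l_def l'_def)
  have reverse: "\<And>q k. transport_eq q a k \<Longrightarrow> 1 + (q * exp k) * k = exp k + (q * exp k) * a"
  proof -
    fix q k assume "transport_eq q a k"
    then have "exp k * (exp (- k) + q * k) = exp k * (1 + q * a)"
      by (simp add: transport_eq_def algebra_simps)
    then show "1 + (q * exp k) * k = exp k + (q * exp k) * a"
      by (simp add: exp_minus_inverse algebra_simps)
  qed
  have 1: "1 + n * l = exp l + n * a" unfolding n(1) l_def by (rule reverse[OF ell_eq[OF o(1)]])
  have 2: "1 + n * l' = exp l' + n * a" unfolding n(2) l'_def by (rule reverse[OF ell_eq[OF o(2)]])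
  have "(n - 1) * (l - l') = (1 + n * l) - (1 + n * l') - l + l'" by (simp add: algebra_simps)
  also have "\<dots> = (exp l - l) - (exp l' - l')" unfolding 1 2 by (simp add: algebra_simps)
  finally have "(n - 1) * (l - l') = (exp l - l) - (exp l' - l')" .
  then have "norm (n - 1) * norm (l - l') = norm ((exp l - l) - (exp l' - l'))"
    by (metis norm_mult)
  also have "\<dots> \<le> 2 * (\<rho> / 64) * norm (l - l')"
    using l eps by (intro exp_lipschitz_near_0) auto
  finally have *: "norm (n - 1) * norm (l - l') \<le> \<rho> / 32 * norm (l - l')" by simp
  have "l = l'"
  proof (rule ccontr)
    assume "l \<noteq> l'"
    then have "norm (n - 1) \<le> \<rho> / 32" using * by simp
    then show False using mhat_far(1)[OF o(1)] eps by (simp add: n_def)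
  qed
  then show ?thesis using n by simp
qed

end

section \<open>Slopes obtained by returning along the leaves of \<open>X\<close>\<close>

context tangency_chart
begin

text \<open>Three moves: along the leaf of \<open>Y\<close> to the fibre \<open>a = 0\<close>,
  across by \<open>theta\<close>, and back along the leaf of \<open>X\<close>, on which
  \<open>t^2 + 2 * a\<close> is constant. Factoring out \<open>theta\<close> before taking the root
  selects the branch close to \<open>theta (mhat m a)\<close>.\<close>

definition outer_slope :: "complex \<Rightarrow> complex \<Rightarrow> complex"
  where "outer_slope m a = theta (mhat m a) * csqrt (1 + (- 2 * a / (theta (mhat m a))\<^sup>2))"

lemma outer_small:
  assumes "outer m a"
  shows "2 * norm a \<le> \<rho> / 64 * norm (theta (mhat m a))"
    and "norm (- 2 * a / (theta (mhat m a))\<^sup>2) < 1"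
    and "theta (mhat m a) \<noteq> 0"
proof -
  define t where "t = norm (theta (mhat m a))"
  have t: "7 / 128 * \<rho> \<le> t" using mhat_far(2)[OF assms] by (simp add: t_def)
  have a: "norm a < d0" using assms by (simp add: outer_def)
  have "\<rho> / 64 * (7 / 128 * \<rho>) \<le> \<rho> / 64 * t" using t eps by (intro mult_left_mono) auto
  moreover have "\<rho> / 64 * (7 / 128 * \<rho>) = 7 * (\<rho> * \<rho>) / 8192" by simp
  ultimately have 1: "2 * norm a \<le> \<rho> / 64 * t"
    using a d0_le(3) zero_le_square[of \<rho>] by linarith
  then show "2 * norm a \<le> \<rho> / 64 * norm (theta (mhat m a))" by (simp add: t_def)
  have t0: "t > 0" using t eps by simp
  then show "theta (mhat m a) \<noteq> 0" by (auto simp: t_def)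
  have "\<rho> / 64 * t < t * t" using t t0 eps by (intro mult_strict_right_mono) auto
  then have "2 * norm a < t\<^sup>2" using 1 by (simp add: power2_eq_square)
  then show "norm (- 2 * a / (theta (mhat m a))\<^sup>2) < 1"
    using t0 by (simp add: norm_divide norm_mult norm_power t_def divide_less_eq)
qed

lemma outer_slope_sq:
  assumes "outer m a"
  shows "(outer_slope m a)\<^sup>2 = (theta (mhat m a))\<^sup>2 - 2 * a"
  using outer_small(3)[OF assms] by (simp add: outer_slope_def power_mult_distrib field_simps)

lemma outer_slope_near:
  assumes "outer m a"
  shows "norm (outer_slope m a - theta (mhat m a)) \<le> \<rho> / 64"
proof -
  define t where "t = theta (mhat m a)"
  have t: "t \<noteq> 0" using outer_small(3)[OF assms] by (simp add: t_def)
  have "norm (outer_slope m a - t) = norm t * norm (csqrt (1 + (- 2 * a / t\<^sup>2)) - 1)"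
    by (simp add: outer_slope_def t_def algebra_simps flip: norm_mult)
  also have "\<dots> \<le> norm t * norm (- 2 * a / t\<^sup>2)"
    by (intro mult_left_mono norm_csqrt_1_plus) simp
  also have "\<dots> = 2 * norm a / norm t"
    using t by (simp add: norm_divide norm_mult norm_power power2_eq_square)
  also have "\<dots> \<le> \<rho> / 64"
    using outer_small(1)[OF assms] t by (simp add: t_def divide_le_eq)
  finally show ?thesis by (simp add: t_def)
qed

lemma outer_slope_deviation:
  assumes "outer m a"
  shows "norm (outer_slope m a - theta m) \<le> \<rho> / 16"
proof -
  have "norm (outer_slope m a - theta m) \<le> norm (outer_slope m a - theta (mhat m a)) + norm (theta (mhat m a) - theta m)"
    using norm_triangle_ineq[of "outer_slope m a - theta (mhat m a)" "theta (mhat m a) - theta m"] by simp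
  also have "\<dots> \<le> \<rho> / 64 + 3 / 2 * (\<rho> / 64)"
    using outer_slope_near[OF assms] theta_upper[of "mhat m a" m] mhat_near[OF assms] by linarith
  finally show ?thesis using eps by simp
qed

text \<open>Equal slopes give equal squares in the fibre \<open>a = 0\<close>. Opposite signs are
  impossible: both values lie within \<open>\<rho> / 64\<close> of the common slope, but have norm
  at least \<open>7 * \<rho> / 128\<close>.\<close>

lemma outer_slope_inj:
  assumes o: "outer m a" "outer m' a" and eq: "outer_slope m a = outer_slope m' a"
  shows "m = m'"
proof -
  define t t' where "t = theta (mhat m a)" and "t' = theta (mhat m' a)"
  have "t\<^sup>2 = t'\<^sup>2"
    using outer_slope_sq[OF o(1)] outer_slope_sq[OF o(2)] eq by (simp add: t_def t'_def)
  then have "t = t' \<or> t = - t'" by (simp add: power2_eq_iff)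
  moreover have "t \<noteq> - t'"
  proof
    assume n: "t = - t'"
    have "norm (outer_slope m a - t) \<le> \<rho> / 64" "norm (outer_slope m a - t') \<le> \<rho> / 64"
      using outer_slope_near[OF o(1)] outer_slope_near[OF o(2)] eq by (simp_all add: t_def t'_def)
    then have "norm (t - t') \<le> \<rho> / 32"
      using norm_triangle_ineq4[of "outer_slope m a - t'" "outer_slope m a - t"] by simp
    moreover have "norm (t - t') = 2 * norm t"
      using n by (simp add: norm_minus_commute flip: norm_mult)
    ultimately show False using mhat_far(2)[OF o(1)] eps by (simp add: t_def)
  qed
  ultimately have "mhat m a = mhat m' a" using theta_inj by (auto simp: t_def t'_def)
  then show ?thesis using mhat_inj o by blast
qed

lemma continuous_on_ell: "continuous_on {q. outer (fst q) (snd q)} (\<lambda>q. ell (fst q) (snd q))"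
  unfolding continuous_on_def
proof
  fix q :: "complex \<times> complex" assume "q \<in> {q. outer (fst q) (snd q)}"
  then have o: "outer (fst q) (snd q)" by simp
  \<comment> \<open>The constant is the inverse of \<open>\<rho> / 8 - \<rho> / 32\<close>, the
    lower bound of the linear coefficient minus the Lipschitz constant of the rest.\<close>
  define C where "C = (\<lambda>p::complex \<times> complex. 32 / (3 * \<rho>) *
    (norm (fst p - fst q) * (\<rho> / 64) + norm (fst p * snd p - fst q * snd q)))"
  have est: "norm (ell (fst p) (snd p) - ell (fst q) (snd q)) \<le> C p" if p: "outer (fst p) (snd p)" for p
  proof -
    define l l' where "l = ell (fst p) (snd p)" and "l' = ell (fst q) (snd q)"
    have l: "norm l \<le> \<rho> / 64" "norm l' \<le> \<rho> / 64"
      using ell_small p o by (auto simp: l_def l'_def)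
    have e: "(fst p - 1) * l + (exp (- l) + l - 1) = fst p * snd p"
        "(fst q - 1) * l' + (exp (- l') + l' - 1) = fst q * snd q"
      using ell_eq[OF p] ell_eq[OF o] by (simp_all add: transport_eq_def l_def l'_def)
    have "(fst p - 1) * (l - l') = (fst p * snd p - fst q * snd q)
        - ((exp (- l) + l - 1) - (exp (- l') + l' - 1)) - (fst p - fst q) * l'"
      unfolding e[symmetric] by (simp add: algebra_simps)
    then have "norm (fst p - 1) * norm (l - l') = norm ((fst p * snd p - fst q * snd q)
        - ((exp (- l) + l - 1) - (exp (- l') + l' - 1)) - (fst p - fst q) * l')"
      by (simp only: flip: norm_mult)
    also have "\<dots> \<le> norm ((fst p * snd p - fst q * snd q)
        - ((exp (- l) + l - 1) - (exp (- l') + l' - 1))) + norm ((fst p - fst q) * l')"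
      by (rule norm_triangle_ineq4)
    also have "\<dots> \<le> norm (fst p * snd p - fst q * snd q)
        + norm ((exp (- l) + l - 1) - (exp (- l') + l' - 1)) + norm (fst p - fst q) * norm l'"
      unfolding norm_mult[of "fst p - fst q"] by (rule add_right_mono) (rule norm_triangle_ineq4)
    also have "\<dots> \<le> norm (fst p * snd p - fst q * snd q) + \<rho> / 32 * norm (l - l') + norm (fst p - fst q) * (\<rho> / 64)"
      using exp_rest_lipschitz[OF l] l(2) by (intro add_mono mult_left_mono) auto
    finally have "norm (fst p - 1) * norm (l - l') - \<rho> / 32 * norm (l - l') \<le>
        norm (fst p - fst q) * (\<rho> / 64) + norm (fst p * snd p - fst q * snd q)" by simp
    moreover have "\<rho> / 8 * norm (l - l') \<le> norm (fst p - 1) * norm (l - l')"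
      using p by (intro mult_right_mono) (auto simp: outer_def)
    ultimately have "3 * \<rho> / 32 * norm (l - l') \<le>
        norm (fst p - fst q) * (\<rho> / 64) + norm (fst p * snd p - fst q * snd q)" by (simp add: field_simps)
    then show ?thesis using eps by (simp add: C_def l_def l'_def field_simps)
  qed
  have "(C \<longlongrightarrow> 32 / (3 * \<rho>) * (norm (fst q - fst q) * (\<rho> / 64) + norm (fst q * snd q - fst q * snd q)))
      (at q within {q. outer (fst q) (snd q)})"
    unfolding C_def by (intro tendsto_intros)
  then have C: "(C \<longlongrightarrow> 0) (at q within {q. outer (fst q) (snd q)})" by simp
  have "((\<lambda>p. ell (fst p) (snd p) - ell (fst q) (snd q)) \<longlongrightarrow> 0) (at q within {q. outer (fst q) (snd q)})"
    by (rule Lim_null_comparison[OF _ C]) (use est in \<open>auto simp: eventually_at_filter\<close>)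
  then show "((\<lambda>q. ell (fst q) (snd q)) \<longlongrightarrow> ell (fst q) (snd q)) (at q within {q. outer (fst q) (snd q)})"
    by (simp add: LIM_zero_iff)
qed

lemma continuous_on_outer_slope: "continuous_on {q. outer (fst q) (snd q)} (\<lambda>q. outer_slope (fst q) (snd q))"
proof -
  have t: "continuous_on {q. outer (fst q) (snd q)} (\<lambda>q. theta (mhat (fst q) (snd q)))"
    unfolding mhat_def
    by (intro continuous_on_compose2[OF continuous_on_theta[of UNIV]] continuous_intros continuous_on_ell) auto
  have c: "continuous_on {q. outer (fst q) (snd q)} (\<lambda>q. 1 + (- 2 * snd q / (theta (mhat (fst q) (snd q)))\<^sup>2))"
    using outer_small(3) by (intro continuous_intros t) auto
  have slit: "1 + z \<in> - \<real>\<^sub>\<le>\<^sub>0" if "norm z < 1" for z :: complex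
    using that abs_Re_le_cmod[of z] by (auto simp: complex_nonpos_Reals_iff)
  have "continuous_on {q. outer (fst q) (snd q)}
      (\<lambda>q. csqrt (1 + (- 2 * snd q / (theta (mhat (fst q) (snd q)))\<^sup>2)))"
  proof (rule continuous_on_compose2[OF continuous_on_csqrt c], rule image_subsetI)
    fix q :: "complex \<times> complex" assume "q \<in> {q. outer (fst q) (snd q)}"
    then show "1 + (- 2 * snd q / (theta (mhat (fst q) (snd q)))\<^sup>2) \<in> - \<real>\<^sub>\<le>\<^sub>0"
      by (intro slit outer_small(2)) simp
  qed
  then show ?thesis
    unfolding outer_slope_def by (intro continuous_on_mult t)
qed

text \<open>In this annulus \<open>\<kappa>\<close> already carries the invariant of
  \<open>Y\<close> to that of \<open>X\<close>, so going to \<open>a = 0\<close> and back changes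
  nothing: the two sides have equal squares, and closeness to \<open>theta m\<close> decides the
  sign.\<close>

lemma outer_slope_eq_kappa:
  assumes o: "outer m a" and m: "norm (m - 1) \<le> \<rho> / 2"
  shows "outer_slope m a = \<kappa> m"
proof -
  define l n where "l = ell m a" and "n = mhat m a"
  have l: "norm l \<le> \<rho> / 64" "transport_eq m a l" "n = m * exp l"
    using ell_small ell_eq o by (auto simp: l_def n_def mhat_def)
  have mc: "m \<in> cball 1 \<rho>" using m eps by (simp add: dist_norm norm_minus_commute)
  have "norm (n - 1) \<le> norm (n - m) + norm (m - 1)"
    using norm_triangle_ineq[of "n - m" "m - 1"] by simp
  then have nc: "n \<in> cball 1 \<rho>"
    using mhat_near[OF o] m eps by (simp add: dist_norm norm_minus_commute n_def)
  have Re: "Re m > 0" using m eps abs_Re_le_cmod[of "m - 1"] by auto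
  then have m0: "m \<noteq> 0" by auto
  have "\<bar>Im (Ln m)\<bar> < pi / 2" using Re_Ln_pos_lt[OF m0] Re by simp
  \<comment> \<open>Both imaginary parts are below \<open>pi / 2\<close>, so the principal
    logarithms add without a jump.\<close>
  moreover have "\<bar>Im l\<bar> < pi / 2"
    using abs_Im_le_cmod[of l] l(1) eps pi_gt3 by linarith
  ultimately have "Ln n = Ln m + l"
    using m0 l(3) by (intro Ln_unique) (auto simp: exp_add)
  then have "(\<kappa> n)\<^sup>2 = 2 * ((exp (- l) / m + l) + Ln m - 1)"
    using kappa_sq[OF nc] l(3) by (simp add: exp_minus field_simps)
  also have "exp (- l) / m + l = 1 / m + a"
    using l(2) m0 unfolding transport_eq_def by (simp add: field_simps)
  finally have "(\<kappa> n)\<^sup>2 = 2 * (1 / m + Ln m - 1) + 2 * a"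
    by (simp add: algebra_simps)
  then have "(outer_slope m a)\<^sup>2 = (\<kappa> m)\<^sup>2"
    using outer_slope_sq[OF o] theta_eq_kappa[OF nc] kappa_sq[OF mc] by (simp add: n_def)
  then have "outer_slope m a = \<kappa> m \<or> outer_slope m a = - \<kappa> m" by (simp add: power2_eq_iff)
  moreover have "outer_slope m a \<noteq> - \<kappa> m"
  proof
    assume "outer_slope m a = - \<kappa> m"
    then have "outer_slope m a - theta m = - (2 * theta m)" using theta_eq_kappa[OF mc] by simp
    then have "norm (outer_slope m a - theta m) = 2 * norm (theta m)" by (simp only: norm_minus_cancel norm_mult) simp
    then have "2 * norm (theta m) \<le> \<rho> / 16" using outer_slope_deviation[OF o] by simp
    then show False using theta_lower[of m] o eps by (simp add: outer_def)
  qed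
  ultimately show ?thesis by blast
qed

section \<open>Gluing across the tangency\<close>

definition chart_dom :: "(complex \<times> complex) set"
  where "chart_dom = {q. norm (snd q) < d0 \<and> norm (fst q * snd q) < d0}"

text \<open>The two formulas agree for
  \<open>\<rho> / 8 \<le> norm (m - 1) \<le> \<rho> / 2\<close>, and the threshold
  \<open>\<rho> / 4\<close> lies inside this overlap, so either formula may be used there.\<close>

definition T :: "complex \<Rightarrow> complex \<Rightarrow> complex"
  where "T m a = (if norm (m - 1) < \<rho> / 4 then \<kappa> m else outer_slope m a)"

lemma outerI: "(m, a) \<in> chart_dom \<Longrightarrow> \<rho> / 8 \<le> norm (m - 1) \<Longrightarrow> outer m a"
  by (simp add: chart_dom_def outer_def)

lemma T_inner:
  assumes "(m, a) \<in> chart_dom" "norm (m - 1) \<le> \<rho> / 2"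
  shows "T m a = \<kappa> m"
  using outer_slope_eq_kappa[OF outerI] assms eps by (auto simp: T_def)

lemma T_outer:
  assumes "outer m a"
  shows "T m a = outer_slope m a"
  using outer_slope_eq_kappa[OF assms] eps by (auto simp: T_def)

lemma T_deviation:
  assumes "(m, a) \<in> chart_dom"
  shows "norm (T m a - theta m) \<le> \<rho> / 16"
proof (cases "norm (m - 1) \<le> \<rho> / 2")
  case True
  then have "m \<in> cball 1 \<rho>" using eps by (simp add: dist_norm norm_minus_commute)
  then show ?thesis using T_inner[OF assms True] theta_eq_kappa eps by simp
next
  case False
  then have o: "outer m a" using assms outerI eps by auto
  then show ?thesis using T_outer outer_slope_deviation by simp
qed

lemma T_bound:
  assumes "(m, a) \<in> chart_dom"
  shows "norm (T m a - m) \<le> 2"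
proof -
  have "norm (T m a - m) = norm (((T m a - theta m) + (theta m - (m - 1))) - 1)" by simp
  also have "\<dots> \<le> norm ((T m a - theta m) + (theta m - (m - 1))) + norm (1 :: complex)"
    by (rule norm_triangle_ineq4)
  also have "\<dots> \<le> norm (T m a - theta m) + norm (theta m - (m - 1)) + norm (1 :: complex)"
    by (rule add_right_mono) (rule norm_triangle_ineq)
  finally show ?thesis using T_deviation[OF assms] theta_deviation_eps[of m] eps by simp
qed

text \<open>At the inner point the value stays below \<open>3 * \<rho> / 16\<close> in norm. At the
  outer one \<open>theta\<close> exceeds \<open>\<rho> / 4\<close>, and \<open>T\<close> differs
  from it by at most \<open>\<rho> / 16\<close>.\<close>

lemma T_inj_aux:
  assumes "(m, a) \<in> chart_dom" "(m', a) \<in> chart_dom" "norm (m - 1) < \<rho> / 8" "\<rho> / 2 < norm (m' - 1)"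
  shows "T m a \<noteq> T m' a"
proof
  assume eq: "T m a = T m' a"
  have "T m a = theta m"
    using T_inner[OF assms(1)] theta_eq_kappa[of m] assms(3) eps by (simp add: dist_norm norm_minus_commute)
  then have "norm (T m a) < 3 / 2 * (\<rho> / 8)"
    using theta_upper[of m 1] assms(3) by simp
  moreover have "norm (theta m') \<le> norm (T m' a) + norm (T m' a - theta m')"
    using norm_triangle_ineq4[of "T m' a" "T m' a - theta m'"] by simp
  ultimately show False
    using T_deviation[OF assms(2)] theta_lower[of m'] assms(4) eq by simp
qed

lemma T_inj:
  assumes d: "(m, a) \<in> chart_dom" "(m', a) \<in> chart_dom" and eq: "T m a = T m' a"
  shows "m = m'"
proof -
  consider "norm (m - 1) \<le> \<rho> / 2" "norm (m' - 1) \<le> \<rho> / 2"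
    | "\<rho> / 8 \<le> norm (m - 1)" "\<rho> / 8 \<le> norm (m' - 1)"
    | "norm (m - 1) < \<rho> / 8" "\<rho> / 2 < norm (m' - 1)"
    | "norm (m' - 1) < \<rho> / 8" "\<rho> / 2 < norm (m - 1)"
    by linarith
  then show ?thesis
  proof cases
    case 1
    then have "theta m = theta m'"
      using T_inner[OF d(1)] T_inner[OF d(2)] eq eps theta_eq_kappa[of m] theta_eq_kappa[of m']
      by (simp add: dist_norm norm_minus_commute)
    then show ?thesis by (rule theta_inj)
  next
    case 2
    then show ?thesis using outerI d T_outer outer_slope_inj eq by metis
  next
    case 3
    then show ?thesis using T_inj_aux[OF d] eq by simp
  next
    case 4
    then show ?thesis using T_inj_aux[OF d(2,1)] eq by simp
  qed
qed

lemma open_chart_dom: "open chart_dom"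
  unfolding chart_dom_def by (intro open_Collect_conj open_Collect_less continuous_intros)

lemma continuous_on_T: "continuous_on chart_dom (\<lambda>q. T (fst q) (snd q))"
proof -
  define A where "A = chart_dom \<inter> {q. norm (fst q - 1) < \<rho> / 2}"
  define B where "B = chart_dom \<inter> {q. \<rho> / 8 < norm (fst q - 1)}"
  have "open A" "open B" unfolding A_def B_def
    by (intro open_Int open_chart_dom open_Collect_less continuous_intros)+
  have "continuous_on A (\<lambda>q. theta (fst q))"
    by (intro continuous_on_compose2[OF continuous_on_theta[of UNIV]] continuous_intros) auto
  then have A: "continuous_on A (\<lambda>q. T (fst q) (snd q))"
  proof (rule continuous_on_eq)
    fix q assume "q \<in> A"
    then have q: "(fst q, snd q) \<in> chart_dom" "norm (fst q - 1) < \<rho> / 2" by (auto simp: A_def)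
    then have "fst q \<in> cball 1 \<rho>" using eps by (simp add: dist_norm norm_minus_commute)
    then show "theta (fst q) = T (fst q) (snd q)"
      using T_inner[OF q(1)] q(2) theta_eq_kappa by simp
  qed
  have "continuous_on B (\<lambda>q. outer_slope (fst q) (snd q))"
    by (rule continuous_on_subset[OF continuous_on_outer_slope]) (auto simp: B_def chart_dom_def outer_def)
  then have B: "continuous_on B (\<lambda>q. T (fst q) (snd q))"
  proof (rule continuous_on_eq)
    fix q assume "q \<in> B"
    then have "outer (fst q) (snd q)" by (auto simp: B_def chart_dom_def outer_def)
    then show "outer_slope (fst q) (snd q) = T (fst q) (snd q)" using T_outer by simp
  qed
  have "continuous_on (A \<union> B) (\<lambda>q. T (fst q) (snd q))"
    using \<open>open A\<close> \<open>open B\<close> A B by (rule continuous_on_open_Un)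
  moreover have "chart_dom = A \<union> B" using eps by (auto simp: A_def B_def)
  ultimately show ?thesis by simp
qed

text \<open>\<open>m / (1 + m * \<tau>)\<close> and \<open>a - \<tau> + Ln (1 + m * \<tau>)\<close>
  are the values of \<open>m\<close> and \<open>a\<close> on \<open>plaqueY\<close> at parameter
  \<open>\<tau>\<close>. The shift of \<open>l\<close> cancels the denominator, so the end point
  \<open>m * exp l\<close> does not move.\<close>

lemma transport_eq_flow:
  assumes "transport_eq m a l" "1 + m * \<tau> \<noteq> 0"
  shows "transport_eq (m / (1 + m * \<tau>)) (a - \<tau> + Ln (1 + m * \<tau>)) (l + Ln (1 + m * \<tau>))"
proof -
  define w L where "w = 1 + m * \<tau>" and "L = Ln w"
  have w: "w \<noteq> 0" "exp L = w" using assms(2) by (auto simp: w_def L_def)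
  have "m * (l + L) + exp (- l) - w = m * (a - \<tau> + L)"
    using assms(1) by (simp add: transport_eq_def w_def algebra_simps)
  then have "(m * (l + L) + exp (- l) - w) / w = m * (a - \<tau> + L) / w" by simp
  moreover have "exp (- (l + L)) = exp (- l) / w"
    by (simp only: minus_add_distrib exp_add exp_minus w(2) divide_inverse)
  ultimately have "m / w * (l + L) + exp (- (l + L)) - 1 = m / w * (a - \<tau> + L)"
    using w(1) by (simp add: diff_divide_distrib add_divide_distrib)
  then show ?thesis
    unfolding transport_eq_def w_def[symmetric] L_def[symmetric] by (simp add: algebra_simps)
qed

text \<open>Near the tangency this is conservation of \<open>1/m + Ln m + a\<close> seen through
  \<open>\<kappa>\<close>. Elsewhere \<open>mhat\<close> is constant along the flow, and
  \<open>outer_slope_sq\<close> turns that into the invariant of \<open>X\<close>.\<close>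

lemma T_invariant:
  assumes d: "(m, a) \<in> chart_dom"
  shows "\<forall>\<^sub>F \<tau> in nhds 0. (m / (1 + m * \<tau>), a - \<tau> + Ln (1 + m * \<tau>)) \<in> chart_dom \<and>
    (T (m / (1 + m * \<tau>)) (a - \<tau> + Ln (1 + m * \<tau>)))\<^sup>2 + 2 * (a - \<tau> + Ln (1 + m * \<tau>)) = (T m a)\<^sup>2 + 2 * a"
proof -
  define L where "L = (\<lambda>\<tau>. Ln (1 + m * \<tau>))"
  define M where "M = (\<lambda>\<tau>. m / (1 + m * \<tau>))"
  define \<alpha> where "\<alpha> = (\<lambda>\<tau>. a - \<tau> + L \<tau>)"
  have "(L \<longlongrightarrow> Ln (1 + m * 0)) (nhds 0)" unfolding L_def by (intro tendsto_intros filterlim_ident) auto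
  then have L: "(L \<longlongrightarrow> 0) (nhds 0)" by simp
  have "(M \<longlongrightarrow> m / (1 + m * 0)) (nhds 0)" unfolding M_def by (intro tendsto_intros filterlim_ident) auto
  then have M: "(M \<longlongrightarrow> m) (nhds 0)" by simp
  have "(\<alpha> \<longlongrightarrow> a - 0 + 0) (nhds 0)" unfolding \<alpha>_def by (intro tendsto_intros filterlim_ident L)
  then have \<alpha>: "(\<alpha> \<longlongrightarrow> a) (nhds 0)" by simp
  have "((\<lambda>\<tau>. (M \<tau>, \<alpha> \<tau>)) \<longlongrightarrow> (m, a)) (nhds 0)" using M \<alpha> by (rule tendsto_Pair)
  then have dom: "\<forall>\<^sub>F \<tau> in nhds 0. (M \<tau>, \<alpha> \<tau>) \<in> chart_dom"
    using open_chart_dom d by (rule topological_tendstoD)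
  have "((\<lambda>\<tau>. 1 + m * \<tau>) \<longlongrightarrow> 1 + m * 0) (nhds 0)" by (intro tendsto_intros filterlim_ident)
  then have w: "\<forall>\<^sub>F \<tau> in nhds 0. 1 + m * \<tau> \<noteq> 0"
    by (rule tendsto_imp_eventually_ne) simp
  have dist: "((\<lambda>\<tau>. norm (M \<tau> - 1)) \<longlongrightarrow> norm (m - 1)) (nhds 0)" by (intro tendsto_intros M)
  have "\<forall>\<^sub>F \<tau> in nhds 0. (T (M \<tau>) (\<alpha> \<tau>))\<^sup>2 + 2 * \<alpha> \<tau> = (T m a)\<^sup>2 + 2 * a"
  proof (cases "norm (m - 1) < \<rho> / 2")
    case True
    then have mc: "m \<in> cball 1 \<rho>" using eps by (simp add: dist_norm norm_minus_commute)
    have Re: "Re m > 0" using True eps abs_Re_le_cmod[of "m - 1"] by auto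
    then have m0: "m \<noteq> 0" by auto
    have "((\<lambda>\<tau>. \<bar>Im (Ln m - L \<tau>)\<bar>) \<longlongrightarrow> \<bar>Im (Ln m - 0)\<bar>) (nhds 0)" by (intro tendsto_intros filterlim_ident L)
    moreover have "\<bar>Im (Ln m - 0)\<bar> < pi"
      using Re_Ln_pos_lt[OF m0] Re pi_gt_zero by (auto simp: abs_less_iff)
    ultimately have "\<forall>\<^sub>F \<tau> in nhds 0. \<bar>Im (Ln m - L \<tau>)\<bar> < pi" by (rule order_tendstoD)
    moreover have "\<forall>\<^sub>F \<tau> in nhds 0. norm (M \<tau> - 1) < \<rho> / 2"
      using dist True by (rule order_tendstoD)
    ultimately show ?thesis using w dom
    proof eventually_elim
      case (elim \<tau>)
      have c: "M \<tau> \<in> cball 1 \<rho>" using elim(2) eps by (simp add: dist_norm norm_minus_commute)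
      have "exp (Ln m - L \<tau>) = M \<tau>" using m0 elim(3) by (simp add: exp_diff L_def M_def)
      then have Ln: "Ln (M \<tau>) = Ln m - L \<tau>"
        using elim(1) by (intro Ln_unique) (auto simp: abs_less_iff)
      have inv: "1 / M \<tau> = 1 / m + \<tau>" using m0 elim(3) by (simp add: M_def field_simps)
      have "(T (M \<tau>) (\<alpha> \<tau>))\<^sup>2 = 2 * (1 / M \<tau> + Ln (M \<tau>) - 1)"
        using T_inner[OF elim(4)] elim(2) kappa_sq[OF c] by simp
      moreover have "(T m a)\<^sup>2 = 2 * (1 / m + Ln m - 1)"
        using T_inner[OF d] True kappa_sq[OF mc] by simp
      ultimately show ?case unfolding inv Ln by (simp add: \<alpha>_def)
    qed
  next
    case False
    then have far: "\<rho> / 8 < norm (m - 1)" using eps by auto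
    then have o: "outer m a" using outerI[OF d] by simp
    have "((\<lambda>\<tau>. norm (ell m a + L \<tau>)) \<longlongrightarrow> norm (ell m a + 0)) (nhds 0)" by (intro tendsto_intros filterlim_ident L)
    then have "\<forall>\<^sub>F \<tau> in nhds 0. norm (ell m a + L \<tau>) < \<rho> / 64"
      using ell_strict[OF o] by (intro order_tendstoD) auto
    moreover have "\<forall>\<^sub>F \<tau> in nhds 0. \<rho> / 8 < norm (M \<tau> - 1)"
      using dist far by (rule order_tendstoD)
    ultimately show ?thesis using w dom
    proof eventually_elim
      case (elim \<tau>)
      have o': "outer (M \<tau>) (\<alpha> \<tau>)" using outerI[OF elim(4)] elim(2) by simp
      have "transport_eq (M \<tau>) (\<alpha> \<tau>) (ell m a + L \<tau>)"
        using transport_eq_flow[OF ell_eq[OF o] elim(3)] by (simp add: M_def \<alpha>_def L_def)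
      then have "ell (M \<tau>) (\<alpha> \<tau>) = ell m a + L \<tau>"
        using ell_eqI[OF o'] elim(1) by simp
      then have "mhat (M \<tau>) (\<alpha> \<tau>) = mhat m a"
        using elim(3) by (simp add: mhat_def exp_add M_def L_def)
      then show ?case using T_outer[OF o] T_outer[OF o'] outer_slope_sq[OF o] outer_slope_sq[OF o'] by simp
    qed
  qed
  with dom show ?thesis unfolding M_def \<alpha>_def L_def by (rule eventually_conj)
qed

end

subsection \<open>Integral curves are contained in plaques\<close>

lemma constant_on_ballI:
  fixes f :: "complex \<Rightarrow> complex"
  assumes "\<And>t. t \<in> ball c r \<Longrightarrow> (f has_field_derivative 0) (at t)" "t \<in> ball c r"
  shows "f t = f c"
proof -
  have "f constant_on ball c r"
    by (rule has_field_derivative_0_imp_constant_on) (use assms(1) in auto)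
  moreover have "c \<in> ball c r"
    using assms(2) zero_le_dist[of c t] unfolding mem_ball dist_self by linarith
  ultimately show ?thesis using assms(2) by (auto simp: constant_on_def)
qed

lemma linear_ode_zero:
  fixes f g :: "complex \<Rightarrow> complex"
  assumes "\<And>t. t \<in> ball c r \<Longrightarrow> (f has_field_derivative f t * g t) (at t)"
    and "g holomorphic_on ball c r" "f c = 0" "t \<in> ball c r"
  shows "f t = 0"
proof -
  obtain P where P: "\<And>t. t \<in> ball c r \<Longrightarrow> (P has_field_derivative g t) (at t within ball c r)"
    using holomorphic_convex_primitive'[of "ball c r" g] assms(2) by (auto simp: convex_ball)
  have "f t * exp (- P t) = f c * exp (- P c)"
  proof (rule constant_on_ballI[OF _ assms(4)])
    fix t assume t: "t \<in> ball c r"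
    have "(P has_field_derivative g t) (at t)" using P[OF t] at_within_open[OF t open_ball] by simp
    then have "((\<lambda>t. exp (- P t)) has_field_derivative exp (- P t) * (- g t)) (at t)"
      by (auto intro!: derivative_eq_intros)
    from DERIV_mult[OF assms(1)[OF t] this]
    show "((\<lambda>t. f t * exp (- P t)) has_field_derivative 0) (at t)" by (simp add: algebra_simps)
  qed
  then show ?thesis using assms(3) by simp
qed

lemma integral_curve_near:
  assumes "integral_curve Z U D \<phi>" "c \<in> D"
  obtains r where "r > 0" "ball c r \<subseteq> D"
    "\<forall>t\<in>ball c r. \<forall>i. ((\<lambda>s. \<phi> s $ i) has_field_derivative Z (\<phi> t) $ i) (at t)"
    "\<forall>i. (\<lambda>s. \<phi> s $ i) holomorphic_on ball c r"
    "\<forall>t\<in>ball c r. \<forall>i. \<phi> c $ i \<noteq> 0 \<longrightarrow> \<phi> t $ i \<noteq> 0"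
proof -
  have D: "open D" and der: "\<And>t i. t \<in> D \<Longrightarrow> ((\<lambda>s. \<phi> s $ i) has_field_derivative Z (\<phi> t) $ i) (at t)"
    using assms(1) by (auto simp: integral_curve_def)
  have hol: "(\<lambda>s. \<phi> s $ i) holomorphic_on D" for i
    using der D by (meson holomorphic_on_open)
  have "\<forall>\<^sub>F t in nhds c. \<phi> c $ i \<noteq> 0 \<longrightarrow> \<phi> t $ i \<noteq> 0" for i
  proof (cases "\<phi> c $ i = 0")
    case False
    have "((\<lambda>s. \<phi> s $ i) \<longlongrightarrow> \<phi> c $ i) (nhds c)"
      using DERIV_isCont[OF der[OF assms(2), of i]] tendsto_at_iff_tendsto_nhds[of "\<lambda>s. \<phi> s $ i" c] by (simp add: isCont_def)
    then have "\<forall>\<^sub>F t in nhds c. \<phi> t $ i \<noteq> 0"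
      using False by (rule tendsto_imp_eventually_ne)
    then show ?thesis by (rule eventually_mono) simp
  qed simp
  then have "\<forall>\<^sub>F t in nhds c. \<forall>i. \<phi> c $ i \<noteq> 0 \<longrightarrow> \<phi> t $ i \<noteq> 0"
    by (intro eventually_all_finite) 
  moreover have "\<forall>\<^sub>F t in nhds c. t \<in> D" using D assms(2) by (rule eventually_nhds_in_open)
  ultimately have "\<forall>\<^sub>F t in nhds c. t \<in> D \<and> (\<forall>i. \<phi> c $ i \<noteq> 0 \<longrightarrow> \<phi> t $ i \<noteq> 0)"
    by eventually_elim simp
  then obtain r where r: "r > 0" "\<And>t. dist t c < r \<Longrightarrow> t \<in> D \<and> (\<forall>i. \<phi> c $ i \<noteq> 0 \<longrightarrow> \<phi> t $ i \<noteq> 0)"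
    unfolding eventually_nhds_metric by blast
  then have b: "\<And>t. t \<in> ball c r \<Longrightarrow> t \<in> D \<and> (\<forall>i. \<phi> c $ i \<noteq> 0 \<longrightarrow> \<phi> t $ i \<noteq> 0)"
    by (simp add: dist_commute)
  then have sub: "ball c r \<subseteq> D" by blast
  have "(\<lambda>s. \<phi> s $ i) holomorphic_on ball c r" for i
    using hol sub by (rule holomorphic_on_subset)
  then show ?thesis
    using that[OF r(1) sub] b der by blast
qed

text \<open>The constants of the plaque are conserved quantities: \<open>t^2 - x\<close> and
  \<open>x * z\<close> off the plane \<open>x = 0\<close>, and \<open>y * z\<close> on it.
  Invariance of that plane and of the axis makes the three cases persist for nearby times.\<close>

lemma integral_curve_X:
  assumes "integral_curve X_field U D \<phi>" "c \<in> D"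
  obtains r f C w where "r > 0" "ball c r \<subseteq> D" "continuous_on (ball c r) f"
      "\<phi> c $ 1 \<noteq> 0" "\<And>t. t \<in> ball c r \<Longrightarrow> (f t)\<^sup>2 \<noteq> C \<and> \<phi> t = plaqueX C w (f t)"
  | r f k where "r > 0" "ball c r \<subseteq> D" "continuous_on (ball c r) f"
      "\<phi> c $ 1 = 0" "\<And>t. t \<in> ball c r \<Longrightarrow> f t \<noteq> 0 \<and> \<phi> t = plaqueX0 k (f t)"
  | r where "r > 0" "ball c r \<subseteq> D" "\<And>t. t \<in> ball c r \<Longrightarrow> \<phi> t = \<phi> c"
proof -
  define x y z where "x = (\<lambda>t. \<phi> t $ 1)" and "y = (\<lambda>t. \<phi> t $ 2)" and "z = (\<lambda>t. \<phi> t $ 3)"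
  obtain r where r: "r > 0" "ball c r \<subseteq> D"
    and near: "\<forall>t\<in>ball c r. \<forall>i. ((\<lambda>s. \<phi> s $ i) has_field_derivative X_field (\<phi> t) $ i) (at t)"
      "\<forall>i. (\<lambda>s. \<phi> s $ i) holomorphic_on ball c r"
      "\<forall>t\<in>ball c r. \<forall>i. \<phi> c $ i \<noteq> 0 \<longrightarrow> \<phi> t $ i \<noteq> 0"
    by (rule integral_curve_near[OF assms])
  have der: "((\<lambda>s. \<phi> s $ i) has_field_derivative X_field (\<phi> t) $ i) (at t)" if "t \<in> ball c r" for t i
    using near(1) that by blast
  have hol: "(\<lambda>s. \<phi> s $ i) holomorphic_on ball c r" for i
    using near(2) by blast
  have nz: "\<phi> t $ i \<noteq> 0" if "t \<in> ball c r" "\<phi> c $ i \<noteq> 0" for t i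
    using near(3) that by blast
  have d: "(x has_field_derivative 2 * x t * y t) (at t)"
      "(y has_field_derivative x t ^ 3 + 2 * (y t)\<^sup>2) (at t)"
      "(z has_field_derivative - 2 * y t * z t) (at t)" if "t \<in> ball c r" for t
    using der[OF that, of 1] der[OF that, of 2] der[OF that, of 3]
    by (simp_all add: x_def y_def z_def X_field_def Let_def)
  have h: "x holomorphic_on ball c r" "y holomorphic_on ball c r"
    using hol[of 1] hol[of 2] by (simp_all add: x_def y_def)
  have \<phi>: "\<phi> t = vector [x t, y t, z t]" for t
    by (simp add: x_def y_def z_def vec3_collapse)
  consider "x c \<noteq> 0" | "x c = 0" "y c \<noteq> 0" | "x c = 0" "y c = 0" by blast
  then show ?thesis
  proof cases
    case 1
    have x: "x t \<noteq> 0" if "t \<in> ball c r" for t using nz[OF that, of 1] 1 by (simp add: x_def)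
    define f where "f = (\<lambda>t. y t / x t)"
    have df: "(f has_field_derivative (x t)\<^sup>2) (at t)" if t: "t \<in> ball c r" for t
    proof -
      have "(f has_field_derivative ((x t ^ 3 + 2 * (y t)\<^sup>2) * x t - y t * (2 * x t * y t)) / (x t * x t)) (at t)"
        unfolding f_def by (rule DERIV_divide[OF d(2)[OF t] d(1)[OF t] x[OF t]])
      moreover have "((x t ^ 3 + 2 * (y t)\<^sup>2) * x t - y t * (2 * x t * y t)) / (x t * x t) = (x t)\<^sup>2"
        using x[OF t] by (simp add: field_simps power2_eq_square power3_eq_cube)
      ultimately show ?thesis by simp
    qed
    have C: "(f t)\<^sup>2 - x t = (f c)\<^sup>2 - x c" if t: "t \<in> ball c r" for t
    proof (rule constant_on_ballI[OF _ t])
      fix t assume t: "t \<in> ball c r"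
      have "((\<lambda>t. (f t)\<^sup>2 - x t) has_field_derivative of_nat 2 * ((x t)\<^sup>2 * f t ^ (2 - Suc 0)) - 2 * x t * y t) (at t)"
        by (rule DERIV_diff[OF DERIV_power[OF df[OF t]] d(1)[OF t]])
      moreover have "of_nat 2 * ((x t)\<^sup>2 * f t ^ (2 - Suc 0)) - 2 * x t * y t = 0"
        using x[OF t] by (simp add: f_def field_simps power2_eq_square)
      ultimately show "((\<lambda>t. (f t)\<^sup>2 - x t) has_field_derivative 0) (at t)" by simp
    qed
    have w: "x t * z t = x c * z c" if t: "t \<in> ball c r" for t
    proof (rule constant_on_ballI[OF _ t])
      fix t assume t: "t \<in> ball c r"
      have "((\<lambda>t. x t * z t) has_field_derivative 2 * x t * y t * z t + - 2 * y t * z t * x t) (at t)"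
        by (rule DERIV_mult[OF d(1)[OF t] d(3)[OF t]])
      then show "((\<lambda>t. x t * z t) has_field_derivative 0) (at t)" by (simp add: algebra_simps)
    qed
    show ?thesis
    proof (rule that(1)[OF r, of f "(f c)\<^sup>2 - x c" "x c * z c"])
      show "continuous_on (ball c r) f"
        unfolding f_def using x by (intro continuous_on_divide holomorphic_on_imp_continuous_on h) auto
      show "\<phi> c $ 1 \<noteq> 0" using 1 by (simp add: x_def)
      fix t assume t: "t \<in> ball c r"
      have e: "(f t)\<^sup>2 - ((f c)\<^sup>2 - x c) = x t" using C[OF t] by (simp add: algebra_simps)
      have "(f t)\<^sup>2 \<noteq> (f c)\<^sup>2 - x c" using e x[OF t] by auto
      moreover have "\<phi> t = plaqueX ((f c)\<^sup>2 - x c) (x c * z c) (f t)"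
        unfolding plaqueX_def e w[OF t, symmetric] \<phi> using x[OF t] by (simp add: f_def)
      ultimately show "(f t)\<^sup>2 \<noteq> (f c)\<^sup>2 - x c \<and> \<phi> t = plaqueX ((f c)\<^sup>2 - x c) (x c * z c) (f t)" ..
    qed
  next
    case 2
    have y: "y t \<noteq> 0" if "t \<in> ball c r" for t using nz[OF that, of 2] 2 by (simp add: y_def)
    have x: "x t = 0" if t: "t \<in> ball c r" for t
      by (rule linear_ode_zero[of c r x "\<lambda>t. 2 * y t" t])
        (use 2(1) t d(1) h(2) in \<open>auto intro!: holomorphic_intros simp: mult_ac\<close>)
    have k: "y t * z t = y c * z c" if t: "t \<in> ball c r" for t
    proof (rule constant_on_ballI[OF _ t])
      fix t assume t: "t \<in> ball c r"
      have "((\<lambda>t. y t * z t) has_field_derivative (x t ^ 3 + 2 * (y t)\<^sup>2) * z t + - 2 * y t * z t * y t) (at t)"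
        by (rule DERIV_mult[OF d(2)[OF t] d(3)[OF t]])
      then show "((\<lambda>t. y t * z t) has_field_derivative 0) (at t)"
        using x[OF t] by (simp add: algebra_simps power2_eq_square)
    qed
    show ?thesis
    proof (rule that(2)[OF r, of y "y c * z c"])
      show "continuous_on (ball c r) y" using h by (intro holomorphic_on_imp_continuous_on)
      show "\<phi> c $ 1 = 0" using 2 by (simp add: x_def)
      fix t assume t: "t \<in> ball c r"
      show "y t \<noteq> 0 \<and> \<phi> t = plaqueX0 (y c * z c) (y t)"
        using y[OF t] x[OF t] unfolding plaqueX0_def k[OF t, symmetric] \<phi> by simp
    qed
  next
    case 3
    have x: "x t = 0" if t: "t \<in> ball c r" for t
      by (rule linear_ode_zero[of c r x "\<lambda>t. 2 * y t" t])
        (use 3(1) t d(1) h(2) in \<open>auto intro!: holomorphic_intros simp: mult_ac\<close>)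
    have y: "y t = 0" if t: "t \<in> ball c r" for t
      by (rule linear_ode_zero[of c r y "\<lambda>t. 2 * y t" t])
        (use 3(2) t d(2) x h(2) in \<open>auto intro!: holomorphic_intros simp: mult_ac power2_eq_square\<close>)
    have z: "z t = z c" if t: "t \<in> ball c r" for t
      by (rule constant_on_ballI[OF _ t]) (use d(3) y in auto)
    show ?thesis
      by (rule that(3)[OF r]) (use x y z 3 in \<open>simp add: \<phi>\<close>)
  qed
qed

lemma integral_curve_Y:
  assumes "integral_curve Y_field U D \<phi>" "c \<in> D"
  obtains r f where "r > 0" "ball c r \<subseteq> D" "continuous_on (ball c r) f" "f c = 0"
      "\<phi> c $ 2 \<noteq> 0"
      "\<And>t. t \<in> ball c r \<Longrightarrow> \<phi> t = plaqueY (\<phi> c $ 1 / \<phi> c $ 2) (\<phi> c $ 2) (\<phi> c $ 2 * \<phi> c $ 3) (f t)"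
  | r f k where "r > 0" "ball c r \<subseteq> D" "continuous_on (ball c r) f"
      "\<phi> c $ 2 = 0" "\<And>t. t \<in> ball c r \<Longrightarrow> f t \<noteq> 0 \<and> \<phi> t = plaqueY0 k (f t)"
  | r where "r > 0" "ball c r \<subseteq> D" "\<And>t. t \<in> ball c r \<Longrightarrow> \<phi> t = \<phi> c"
proof -
  define v u z where "v = (\<lambda>t. \<phi> t $ 1)" and "u = (\<lambda>t. \<phi> t $ 2)" and "z = (\<lambda>t. \<phi> t $ 3)"
  obtain r where r: "r > 0" "ball c r \<subseteq> D"
    and near: "\<forall>t\<in>ball c r. \<forall>i. ((\<lambda>s. \<phi> s $ i) has_field_derivative Y_field (\<phi> t) $ i) (at t)"
      "\<forall>i. (\<lambda>s. \<phi> s $ i) holomorphic_on ball c r"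
      "\<forall>t\<in>ball c r. \<forall>i. \<phi> c $ i \<noteq> 0 \<longrightarrow> \<phi> t $ i \<noteq> 0"
    by (rule integral_curve_near[OF assms])
  have der: "((\<lambda>s. \<phi> s $ i) has_field_derivative Y_field (\<phi> t) $ i) (at t)" if "t \<in> ball c r" for t i
    using near(1) that by blast
  have hol: "(\<lambda>s. \<phi> s $ i) holomorphic_on ball c r" for i
    using near(2) by blast
  have nz: "\<phi> t $ i \<noteq> 0" if "t \<in> ball c r" "\<phi> c $ i \<noteq> 0" for t i
    using near(3) that by blast
  have d: "(v has_field_derivative v t * (v t - 2 * (u t)\<^sup>2 - u t)) (at t)"
      "(u has_field_derivative u t * (v t - (u t)\<^sup>2 - u t)) (at t)"
      "(z has_field_derivative - z t * (v t - (u t)\<^sup>2 - u t)) (at t)" if "t \<in> ball c r" for t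
    using der[OF that, of 1] der[OF that, of 2] der[OF that, of 3]
    by (simp_all add: v_def u_def z_def Y_field_def Let_def)
  have h: "v holomorphic_on ball c r" "u holomorphic_on ball c r"
    using hol[of 1] hol[of 2] by (simp_all add: v_def u_def)
  have \<phi>: "\<phi> t = vector [v t, u t, z t]" for t
    by (simp add: v_def u_def z_def vec3_collapse)
  have uzero: "u t = 0" if "u c = 0" "t \<in> ball c r" for t
    by (rule linear_ode_zero[OF d(2) _ that]) (use h in \<open>auto intro!: holomorphic_intros\<close>)
  consider "u c \<noteq> 0" | "u c = 0" "v c \<noteq> 0" | "u c = 0" "v c = 0" by blast
  then show ?thesis
  proof cases
    case 1
    have u: "u t \<noteq> 0" if "t \<in> ball c r" for t using nz[OF that, of 2] 1 by (simp add: u_def)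
    define s where "s = (\<lambda>t. v t / u t)"
    have "(\<lambda>t. (u t)\<^sup>2) holomorphic_on ball c r" using h by (intro holomorphic_intros)
    then obtain P where P: "\<And>t. t \<in> ball c r \<Longrightarrow> (P has_field_derivative (u t)\<^sup>2) (at t within ball c r)"
      using holomorphic_convex_primitive'[of "ball c r"] by (auto simp: convex_ball)
    \<comment> \<open>A primitive of \<open>u^2\<close> is the time of the field
      \<open>Y/u^2\<close>; normalising it to vanish at \<open>c\<close> makes the initial data
      those of \<open>\<phi> c\<close>.\<close>
    define f where "f = (\<lambda>t. P t - P c)"
    have df: "(f has_field_derivative (u t)\<^sup>2) (at t)" if t: "t \<in> ball c r" for t
    proof -
      have "(P has_field_derivative (u t)\<^sup>2) (at t)"
        using P[OF t] at_within_open[OF t open_ball] by simp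
      then show ?thesis unfolding f_def by (auto intro!: derivative_eq_intros)
    qed
    have fc: "f c = 0" by (simp add: f_def)
    have dexp: "((\<lambda>t. exp (f t)) has_field_derivative exp (f t) * (u t)\<^sup>2) (at t)" if t: "t \<in> ball c r" for t
      using df[OF t] by (auto intro!: derivative_eq_intros)
    have ds: "(s has_field_derivative - (s t * (u t)\<^sup>2)) (at t)" if t: "t \<in> ball c r" for t
    proof -
      have "(s has_field_derivative (v t * (v t - 2 * (u t)\<^sup>2 - u t) * u t - v t * (u t * (v t - (u t)\<^sup>2 - u t)))
          / (u t * u t)) (at t)"
        unfolding s_def by (rule DERIV_divide[OF d(1)[OF t] d(2)[OF t] u[OF t]])
      moreover have "(v t * (v t - 2 * (u t)\<^sup>2 - u t) * u t - v t * (u t * (v t - (u t)\<^sup>2 - u t))) / (u t * u t) =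
          - (s t * (u t)\<^sup>2)"
        using u[OF t] by (simp add: s_def field_simps power2_eq_square)
      ultimately show ?thesis by simp
    qed
    have se: "s t * exp (f t) = s c" if t: "t \<in> ball c r" for t
    proof -
      have "s t * exp (f t) = s c * exp (f c)"
      proof (rule constant_on_ballI[OF _ t])
        fix t assume t: "t \<in> ball c r"
        have "((\<lambda>t. s t * exp (f t)) has_field_derivative
            - (s t * (u t)\<^sup>2) * exp (f t) + exp (f t) * (u t)\<^sup>2 * s t) (at t)"
          by (rule DERIV_mult[OF ds[OF t] dexp[OF t]])
        then show "((\<lambda>t. s t * exp (f t)) has_field_derivative 0) (at t)" by (simp add: algebra_simps)
      qed
      then show ?thesis by (simp add: fc)
    qed
    \<comment> \<open>In the time \<open>f\<close> the equation is \<open>u' = s - 1 - u\<close>, so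
      \<open>(u + 1) * exp f\<close> has derivative \<open>s * exp f\<close>, the constant
      \<open>s c\<close>.\<close>
    have ue: "(u t + 1) * exp (f t) - s c * f t = u c + 1" if t: "t \<in> ball c r" for t
    proof -
      have "(u t + 1) * exp (f t) - s c * f t = (u c + 1) * exp (f c) - s c * f c"
      proof (rule constant_on_ballI[OF _ t])
        fix t assume t: "t \<in> ball c r"
        have du: "((\<lambda>t. u t + 1) has_field_derivative u t * (v t - (u t)\<^sup>2 - u t)) (at t)"
          using d(2)[OF t] by (auto intro!: derivative_eq_intros)
        have "((\<lambda>t. (u t + 1) * exp (f t) - s c * f t) has_field_derivative
            (u t * (v t - (u t)\<^sup>2 - u t) * exp (f t) + exp (f t) * (u t)\<^sup>2 * (u t + 1)) - s c * (u t)\<^sup>2) (at t)"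
          by (rule DERIV_diff[OF DERIV_mult[OF du dexp[OF t]] DERIV_cmult[OF df[OF t]]])
        moreover have "(u t * (v t - (u t)\<^sup>2 - u t) * exp (f t) + exp (f t) * (u t)\<^sup>2 * (u t + 1)) - s c * (u t)\<^sup>2 = 0"
          unfolding se[OF t, symmetric] using u[OF t] by (simp add: s_def field_simps power2_eq_square)
        ultimately show "((\<lambda>t. (u t + 1) * exp (f t) - s c * f t) has_field_derivative 0) (at t)" by simp
      qed
      then show ?thesis by (simp add: fc)
    qed
    have ze: "u t * z t = u c * z c" if t: "t \<in> ball c r" for t
    proof (rule constant_on_ballI[OF _ t])
      fix t assume t: "t \<in> ball c r"
      have "((\<lambda>t. u t * z t) has_field_derivative
          u t * (v t - (u t)\<^sup>2 - u t) * z t + - z t * (v t - (u t)\<^sup>2 - u t) * u t) (at t)"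
        by (rule DERIV_mult[OF d(2)[OF t] d(3)[OF t]])
      then show "((\<lambda>t. u t * z t) has_field_derivative 0) (at t)" by (simp add: algebra_simps)
    qed
    show ?thesis
    proof (rule that(1)[OF r, of f])
      show "continuous_on (ball c r) f"
        using df by (meson DERIV_isCont continuous_at_imp_continuous_on)
      show "f c = 0" by (rule fc)
      show "\<phi> c $ 2 \<noteq> 0" using 1 by (simp add: u_def)
      fix t assume t: "t \<in> ball c r"
      have s: "slopeY (s c) (f t) = s t"
        unfolding slopeY_def se[OF t, symmetric] by (simp add: exp_minus)
      have "coordY (s c) (u c) (f t) = exp (- f t) * ((u t + 1) * exp (f t)) - 1"
        using ue[OF t] by (simp add: coordY_def algebra_simps)
      then have c: "coordY (s c) (u c) (f t) = u t" by (simp add: exp_minus field_simps)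
      have "\<phi> t = plaqueY (s c) (u c) (u c * z c) (f t)"
        unfolding plaqueY_def s c ze[OF t, symmetric] \<phi> using u[OF t] by (simp add: s_def)
      then show "\<phi> t = plaqueY (\<phi> c $ 1 / \<phi> c $ 2) (\<phi> c $ 2) (\<phi> c $ 2 * \<phi> c $ 3) (f t)"
        by (simp add: s_def u_def v_def z_def)
    qed
  next
    case 2
    have v: "v t \<noteq> 0" if "t \<in> ball c r" for t using nz[OF that, of 1] 2 by (simp add: v_def)
    have k: "v t * z t = v c * z c" if t: "t \<in> ball c r" for t
    proof (rule constant_on_ballI[OF _ t])
      fix t assume t: "t \<in> ball c r"
      have "((\<lambda>t. v t * z t) has_field_derivative
          v t * (v t - 2 * (u t)\<^sup>2 - u t) * z t + - z t * (v t - (u t)\<^sup>2 - u t) * v t) (at t)"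
        by (rule DERIV_mult[OF d(1)[OF t] d(3)[OF t]])
      then show "((\<lambda>t. v t * z t) has_field_derivative 0) (at t)"
        using uzero[OF 2(1) t] by (simp add: algebra_simps)
    qed
    show ?thesis
    proof (rule that(2)[OF r, of v "v c * z c"])
      show "continuous_on (ball c r) v" using h by (intro holomorphic_on_imp_continuous_on)
      show "\<phi> c $ 2 = 0" using 2 by (simp add: u_def)
      fix t assume t: "t \<in> ball c r"
      show "v t \<noteq> 0 \<and> \<phi> t = plaqueY0 (v c * z c) (v t)"
        using v[OF t] uzero[OF 2(1) t] unfolding plaqueY0_def k[OF t, symmetric] \<phi> by simp
    qed
  next
    case 3
    have v: "v t = 0" if t: "t \<in> ball c r" for t
      by (rule linear_ode_zero[OF d(1) _ 3(2) t]) (use h in \<open>auto intro!: holomorphic_intros\<close>)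
    have z: "z t = z c" if t: "t \<in> ball c r" for t
      by (rule constant_on_ballI[OF _ t]) (use d(3) v uzero[OF 3(1)] in force)
    show ?thesis
      by (rule that(3)[OF r]) (use v z uzero 3 in \<open>simp add: \<phi>\<close>)
  qed
qed

subsection \<open>The homeomorphism\<close>

lemma ball_preimage:
  fixes f :: "'a::metric_space \<Rightarrow> 'b::topological_space"
  assumes "continuous_on (ball c r) f" "r > 0" "open S" "f c \<in> S"
  shows "\<exists>r'>0. r' \<le> r \<and> (\<forall>t\<in>ball c r'. f t \<in> S)"
proof -
  have "open (ball c r \<inter> f -` S)"
    using assms(1,3) by (intro continuous_open_preimage) auto
  moreover have "c \<in> ball c r \<inter> f -` S" using assms(2,4) by simp
  ultimately obtain e where e: "e > 0" "ball c e \<subseteq> ball c r \<inter> f -` S" by (rule openE)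
  then show ?thesis using assms(2) by (intro exI[of _ "min e r"]) auto
qed

section \<open>Injectivity of the plaques\<close>

lemma plaqueX_eqD:
  assumes "plaqueX C w t = plaqueX C' w' t'" "t\<^sup>2 \<noteq> C" "t'\<^sup>2 \<noteq> C'"
  shows "t = t'" "C = C'" "w = w'"
proof -
  define x where "x = t\<^sup>2 - C"
  have c: "(plaqueX C w t) $ i = (plaqueX C' w' t') $ i" for i using assms(1) by simp
  have x: "x \<noteq> 0" using assms(2) by (simp add: x_def)
  have x': "x = t'\<^sup>2 - C'" using c[of 1] by (simp add: x_def plaqueX_def)
  have "t * x = t' * x" using c[of 2] by (simp add: plaqueX_def flip: x_def x')
  then show t: "t = t'" using x by simp
  then show "C = C'" using x' by (simp add: x_def)
  have "w / x = w' / x" using c[of 3] by (simp add: plaqueX_def flip: x_def x')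
  then show "w = w'" using x by simp
qed

text \<open>In the unit disc imaginary parts differ by less than \<open>2 * pi\<close>, so
  \<open>exp\<close> separates parameters. For \<open>s0 = 0\<close> the slope is identically zero
  and the second coordinate has to determine \<open>exp (- \<tau>)\<close>; this uses
  \<open>u0 \<noteq> - 1\<close>.\<close>

lemma inj_on_plaqueY:
  assumes "u0 \<noteq> - 1"
  shows "inj_on (plaqueY s0 u0 k) (ball 0 1 \<inter> {\<tau>. coordY s0 u0 \<tau> \<noteq> 0})"
proof (rule inj_onI)
  fix \<tau> \<tau>' assume b: "\<tau> \<in> ball 0 1 \<inter> {\<tau>. coordY s0 u0 \<tau> \<noteq> 0}" "\<tau>' \<in> ball 0 1 \<inter> {\<tau>. coordY s0 u0 \<tau> \<noteq> 0}"
    and eq: "plaqueY s0 u0 k \<tau> = plaqueY s0 u0 k \<tau>'"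
  have c: "(plaqueY s0 u0 k \<tau>) $ i = (plaqueY s0 u0 k \<tau>') $ i" for i using eq by simp
  have u: "coordY s0 u0 \<tau> = coordY s0 u0 \<tau>'" using c[of 2] by (simp add: plaqueY_def)
  then have s: "slopeY s0 \<tau> = slopeY s0 \<tau>'" using c[of 1] b by (simp add: plaqueY_def)
  have e: "exp (- \<tau>) = exp (- \<tau>')"
  proof (cases "s0 = 0")
    case True
    have "1 + u0 \<noteq> 0" using assms by (simp add: add_eq_0_iff)
    then show ?thesis using u True by (simp add: coordY_def)
  next
    case False
    then show ?thesis using s by (simp add: slopeY_def)
  qed
  have "\<bar>Im (- \<tau>) - Im (- \<tau>')\<bar> \<le> norm \<tau> + norm \<tau>'"
    using abs_Im_le_cmod[of \<tau>] abs_Im_le_cmod[of \<tau>'] by simp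
  also have "\<dots> < 2 * pi" using b pi_gt3 by simp
  finally have "- \<tau> = - \<tau>'" using e exp_complex_eqI by blast
  then show "\<tau> = \<tau>'" by simp
qed

context tangency_chart
begin

text \<open>The quarter compensates the bound of \<open>ratio v u * Ln (1 + u)\<close> by
  \<open>4 * norm v\<close>.\<close>

definition dl :: real
  where "dl = d0 / 4"

text \<open>A full cylinder in the third direction, since that coordinate enters the leaves only
  through conserved products.\<close>

definition V0 :: "(complex^3) set"
  where "V0 = {p. norm (p $ 1) < dl \<and> norm (p $ 2) < dl}"

definition logq :: "complex \<Rightarrow> complex"
  where "logq u = (if u = 0 then 1 else Ln (1 + u) / u)"

definition ratio :: "complex \<Rightarrow> complex \<Rightarrow> complex"
  where "ratio v u = v / (u * (1 + u))"

text \<open>For \<open>u \<noteq> 0\<close> the second coordinate is \<open>- 2 * Ln (1 + u) * T (ratio v u) (Ln (1 + u))\<close>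
  (see \<open>hmap_alt\<close>). In the form below it is visibly continuous at \<open>u = 0\<close>, since
  \<open>T m a - m\<close> is bounded.\<close>

definition hmap :: "complex^3 \<Rightarrow> complex^3"
  where "hmap p = vector [- 2 * Ln (1 + p $ 2),
    - 2 * logq (p $ 2) * p $ 1 / (1 + p $ 2)
      + (if p $ 2 = 0 then 0 else
         - 2 * Ln (1 + p $ 2) * (T (ratio (p $ 1) (p $ 2)) (Ln (1 + p $ 2)) - ratio (p $ 1) (p $ 2))),
    - p $ 3 / (2 * logq (p $ 2))]"

lemma dl: "0 < dl" "dl \<le> 1 / 4" "4 * dl = d0"
  using d0_pos d0_le(2) eps by (simp_all add: dl_def)

lemma small_u:
  assumes "norm u < dl"
  shows "1 + u \<noteq> 0" "norm (Ln (1 + u)) \<le> 2 * norm u" "exp (Ln (1 + u)) = 1 + u"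
    "Ln (1 + u) = 0 \<longleftrightarrow> u = 0" "1 / 2 \<le> norm (1 + u)" "logq u \<noteq> 0"
proof -
  have u: "norm u < 1 / 2" using assms dl by simp
  have "norm (1 :: complex) \<le> norm (1 + u) + norm u" using norm_triangle_ineq4[of "1 + u" u] by simp
  then show n: "1 / 2 \<le> norm (1 + u)" using u by simp
  then show ne: "1 + u \<noteq> 0" by auto
  show "norm (Ln (1 + u)) \<le> 2 * norm u" using norm_Ln_le[OF u] .
  show e: "exp (Ln (1 + u)) = 1 + u" using ne by simp
  show z: "Ln (1 + u) = 0 \<longleftrightarrow> u = 0"
  proof
    assume "Ln (1 + u) = 0"
    then show "u = 0" using e by simp
  qed simp
  show "logq u \<noteq> 0" using z by (auto simp: logq_def)
qed

lemma ratio_in_chart_dom: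
  assumes "norm v < dl" "norm u < dl" "u \<noteq> 0"
  shows "(ratio v u, Ln (1 + u)) \<in> chart_dom"
proof -
  have "norm (ratio v u * Ln (1 + u)) = norm v * norm (Ln (1 + u)) / (norm u * norm (1 + u))"
    by (simp add: ratio_def norm_mult norm_divide)
  also have "\<dots> \<le> norm v * (2 * norm u) / (norm u * (1 / 2))"
    using small_u[OF assms(2)] assms(3) by (intro frac_le mult_left_mono mult_nonneg_nonneg) auto
  also have "\<dots> = 4 * norm v" using assms(3) by simp
  finally have "norm (ratio v u * Ln (1 + u)) < d0" using assms(1) dl by simp
  moreover have "norm (Ln (1 + u)) < d0" using small_u(2)[OF assms(2)] assms(2) dl by simp
  ultimately show ?thesis by (simp add: chart_dom_def)
qed

lemma V0D:
  assumes "p \<in> V0"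
  shows "norm (p $ 1) < dl" "norm (p $ 2) < dl"
  using assms by (auto simp: V0_def)

lemma open_V0: "open V0"
  unfolding V0_def by (intro open_Collect_conj open_Collect_less continuous_intros)

lemma hmap_alt:
  assumes "p \<in> V0" "p $ 2 \<noteq> 0"
  shows "hmap p = vector [- 2 * Ln (1 + p $ 2),
    - 2 * Ln (1 + p $ 2) * T (ratio (p $ 1) (p $ 2)) (Ln (1 + p $ 2)),
    - (p $ 2 * p $ 3) / (2 * Ln (1 + p $ 2))]"
proof -
  have "- 2 * logq (p $ 2) * p $ 1 / (1 + p $ 2) = - 2 * Ln (1 + p $ 2) * ratio (p $ 1) (p $ 2)"
    using assms(2) by (simp add: logq_def ratio_def)
  moreover have "- p $ 3 / (2 * logq (p $ 2)) = - (p $ 2 * p $ 3) / (2 * Ln (1 + p $ 2))"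
    using assms(2) by (simp add: logq_def)
  ultimately show ?thesis using assms(2) by (simp add: hmap_def algebra_simps)
qed

lemma hmap_axis:
  assumes "p $ 2 = 0"
  shows "hmap p = vector [0, - 2 * p $ 1, - p $ 3 / 2]"
  using assms by (simp add: hmap_def logq_def)

lemma continuous_on_logq: "continuous_on {u. norm u < dl} logq"
proof -
  have o: "open {u :: complex. norm u < dl}" by (intro open_Collect_less continuous_intros)
  have slit: "1 + u \<notin> \<real>\<^sub>\<le>\<^sub>0" if "norm u < dl" for u :: complex
    using that abs_Re_le_cmod[of u] dl by (auto simp: complex_nonpos_Reals_iff)
  have "isCont logq u" if u: "norm u < dl" for u
  proof (cases "u = 0")
    case True
    have "((\<lambda>u. Ln (1 + u)) has_field_derivative 1) (at (0::complex))"
      by (auto intro!: derivative_eq_intros)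
    then have "((\<lambda>y. (Ln (1 + y) - Ln (1 + 0)) / (y - 0)) \<longlongrightarrow> 1) (at (0::complex))"
      by (simp add: has_field_derivative_iff)
    then have "(logq \<longlongrightarrow> 1) (at 0)"
      by (rule Lim_transform_eventually) (auto simp: logq_def eventually_at_filter)
    then show ?thesis using True by (simp add: isCont_def logq_def)
  next
    case False
    have "open ({u :: complex. norm u < dl} - {0})" using o by (intro open_Diff) auto
    moreover have "continuous_on ({u. norm u < dl} - {0}) logq"
    proof (rule continuous_on_eq)
      show "continuous_on ({u. norm u < dl} - {0}) (\<lambda>u. Ln (1 + u) / u)"
        using slit by (intro continuous_intros) auto
    qed (simp add: logq_def)
    ultimately show ?thesis using False u by (simp add: continuous_on_eq_continuous_at)
  qed
  then show ?thesis by (intro continuous_at_imp_continuous_on) auto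
qed

lemma continuous_on_hmap: "continuous_on V0 hmap"
proof -
  have slit: "1 + u \<notin> \<real>\<^sub>\<le>\<^sub>0" if "norm u < dl" for u :: complex
    using that abs_Re_le_cmod[of u] dl by (auto simp: complex_nonpos_Reals_iff)
  have q: "continuous_on V0 (\<lambda>p. logq (p $ 2))"
    by (intro continuous_on_compose2[OF continuous_on_logq] continuous_intros) (auto simp: V0_def)
  have L: "continuous_on V0 (\<lambda>p. Ln (1 + p $ 2))"
    using slit by (intro continuous_intros) (auto simp: V0_def)
  define E where "E = (\<lambda>p :: complex^3. if p $ 2 = 0 then 0 else
         - 2 * Ln (1 + p $ 2) * (T (ratio (p $ 1) (p $ 2)) (Ln (1 + p $ 2)) - ratio (p $ 1) (p $ 2)))"
  have "isCont E p" if p: "p \<in> V0" for p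
  proof (cases "p $ 2 = 0")
    case False
    define S where "S = V0 \<inter> {p. p $ 2 \<noteq> 0}"
    have "open S" unfolding S_def
      by (intro open_Int open_V0 open_Collect_neq continuous_intros)
    moreover have "continuous_on S E"
    proof (rule continuous_on_eq)
      have LS: "continuous_on S (\<lambda>p. Ln (1 + p $ 2))"
        using L by (rule continuous_on_subset) (simp add: S_def)
      have r: "continuous_on S (\<lambda>p. ratio (p $ 1) (p $ 2))"
        unfolding ratio_def using small_u(1) by (intro continuous_intros) (auto simp: S_def V0_def)
      have "continuous_on S (\<lambda>p. T (fst (ratio (p $ 1) (p $ 2), Ln (1 + p $ 2))) (snd (ratio (p $ 1) (p $ 2), Ln (1 + p $ 2))))"
        by (rule continuous_on_compose2[OF continuous_on_T continuous_on_Pair[OF r LS]])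
          (use ratio_in_chart_dom in \<open>auto simp: S_def V0_def\<close>)
      then show "continuous_on S (\<lambda>p. - 2 * Ln (1 + p $ 2) *
          (T (ratio (p $ 1) (p $ 2)) (Ln (1 + p $ 2)) - ratio (p $ 1) (p $ 2)))"
        by (intro continuous_on_mult continuous_on_diff continuous_on_const LS r) simp
    qed (simp add: E_def S_def)
    ultimately show ?thesis using p False by (simp add: continuous_on_eq_continuous_at S_def)
  next
    case True
    have bound: "norm (E q) \<le> 4 * norm (Ln (1 + q $ 2))" if "q \<in> V0" for q
    proof (cases "q $ 2 = 0")
      case False
      then have "norm (T (ratio (q $ 1) (q $ 2)) (Ln (1 + q $ 2)) - ratio (q $ 1) (q $ 2)) \<le> 2"
        using T_bound ratio_in_chart_dom V0D[OF that] by blast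
      then have "2 * norm (Ln (1 + q $ 2)) * norm (T (ratio (q $ 1) (q $ 2)) (Ln (1 + q $ 2)) - ratio (q $ 1) (q $ 2))
          \<le> 2 * norm (Ln (1 + q $ 2)) * 2" by (intro mult_left_mono) auto
      then show ?thesis using False by (simp add: E_def norm_mult)
    qed (simp add: E_def)
    have "isCont (\<lambda>p. Ln (1 + p $ 2)) p"
      using L open_V0 p by (simp add: continuous_on_eq_continuous_at)
    then have "((\<lambda>q. 4 * norm (Ln (1 + q $ 2))) \<longlongrightarrow> 4 * norm (Ln (1 + p $ 2))) (at p)"
      unfolding isCont_def by (intro tendsto_mult tendsto_norm tendsto_const)
    then have "((\<lambda>q. 4 * norm (Ln (1 + q $ 2))) \<longlongrightarrow> 0) (at p)" using True by simp
    moreover have "\<forall>\<^sub>F q in at p. norm (E q) \<le> 4 * norm (Ln (1 + q $ 2))"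
      using eventually_at_in_open'[OF open_V0 p] by (rule eventually_mono) (rule bound)
    ultimately have "(E \<longlongrightarrow> 0) (at p)" by (rule Lim_null_comparison[rotated])
    then show ?thesis using True by (simp add: isCont_def E_def)
  qed
  then have E: "continuous_on V0 E" by (intro continuous_at_imp_continuous_on) auto
  have ne: "1 + p $ 2 \<noteq> 0" "logq (p $ 2) \<noteq> 0" if "p \<in> V0" for p
    using small_u V0D[OF that] by blast+
  have "continuous_on V0 (\<lambda>p. vector [- 2 * Ln (1 + p $ 2),
      - 2 * logq (p $ 2) * p $ 1 / (1 + p $ 2) + E p, - p $ 3 / (2 * logq (p $ 2))] :: complex^3)"
    by (intro continuous_on_vec3 continuous_on_mult continuous_on_add continuous_on_divide
        continuous_on_const L q E continuous_on_minus continuous_intros) (use ne in auto)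
  then show ?thesis by (simp add: hmap_def[abs_def] E_def)
qed

lemma inj_on_hmap: "inj_on hmap V0"
proof (rule inj_onI)
  fix p q assume p: "p \<in> V0" and q: "q \<in> V0" and eq: "hmap p = hmap q"
  have c: "hmap p $ i = hmap q $ i" for i using eq by simp
  have "- 2 * Ln (1 + p $ 2) = - 2 * Ln (1 + q $ 2)"
    using c[of 1] unfolding hmap_def vector_3 .
  then have "exp (Ln (1 + p $ 2)) = exp (Ln (1 + q $ 2))" by simp
  then have u: "p $ 2 = q $ 2"
    unfolding small_u(3)[OF V0D(2)[OF p]] small_u(3)[OF V0D(2)[OF q]] by simp
  have "- p $ 3 / (2 * logq (q $ 2)) = - q $ 3 / (2 * logq (q $ 2))"
    using c[of 3] unfolding hmap_def vector_3 u .
  then have z: "p $ 3 = q $ 3" using small_u(6)[OF V0D(2)[OF q]] by simp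
  have "p $ 1 = q $ 1"
  proof (cases "p $ 2 = 0")
    case True
    then have "q $ 2 = 0" using u by simp
    then show ?thesis using c[of 2] unfolding hmap_axis[OF True] hmap_axis[OF \<open>q $ 2 = 0\<close>] by simp
  next
    case False
    have L: "Ln (1 + q $ 2) \<noteq> 0" using small_u(4)[OF V0D(2)[OF q]] False u by simp
    have nz: "q $ 2 \<noteq> 0" using False u by simp
    have "- 2 * Ln (1 + q $ 2) * T (ratio (p $ 1) (q $ 2)) (Ln (1 + q $ 2)) =
        - 2 * Ln (1 + q $ 2) * T (ratio (q $ 1) (q $ 2)) (Ln (1 + q $ 2))"
      using c[of 2] unfolding hmap_alt[OF p False] hmap_alt[OF q nz] u vector_3 .
    then have "T (ratio (p $ 1) (q $ 2)) (Ln (1 + q $ 2)) = T (ratio (q $ 1) (q $ 2)) (Ln (1 + q $ 2))"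
      using L by simp
    moreover have "(ratio (p $ 1) (q $ 2), Ln (1 + q $ 2)) \<in> chart_dom" "(ratio (q $ 1) (q $ 2), Ln (1 + q $ 2)) \<in> chart_dom"
      by (rule ratio_in_chart_dom[OF V0D(1)[OF p] V0D(2)[OF q] nz], rule ratio_in_chart_dom[OF V0D[OF q] nz])
    ultimately have "ratio (p $ 1) (q $ 2) = ratio (q $ 1) (q $ 2)"
      using T_inj by blast
    then show ?thesis
      using False u small_u(1)[OF V0D(2)[OF q]] by (simp add: ratio_def)
  qed
  then show "p = q" using u z by (simp add: vec_eq_iff forall_3)
qed

text \<open>On a plaque of \<open>Y\<close> the value \<open>T\<close> serves as the slope parameter
  of \<open>X\<close>: its square plus \<open>2 * a\<close> is a constant \<open>C\<close>, and
  \<open>x = - 2 * a\<close> then equals \<open>(f \<tau>)^2 - C\<close>. The bound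
  \<open>e \<le> 1\<close> is recorded for \<open>inj_on_plaqueY\<close>.\<close>

lemma hmap_plaque:
  assumes p: "p \<in> V0" and u0: "p $ 2 \<noteq> 0"
  obtains e C f where "e > 0" "e \<le> 1" "continuous_on (ball 0 e) f"
    "\<forall>\<tau>\<in>ball 0 e. plaqueY (p $ 1 / p $ 2) (p $ 2) (p $ 2 * p $ 3) \<tau> \<in> leaf Y_field V0 p \<and>
      coordY (p $ 1 / p $ 2) (p $ 2) \<tau> \<noteq> 0 \<and> (f \<tau>)\<^sup>2 \<noteq> C \<and>
      hmap (plaqueY (p $ 1 / p $ 2) (p $ 2) (p $ 2 * p $ 3) \<tau>) = plaqueX C (p $ 2 * p $ 3) (f \<tau>)"
proof -
  define s0 where "s0 = p $ 1 / p $ 2"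
  define u0 where "u0 = p $ 2"
  define k where "k = p $ 2 * p $ 3"
  define m0 where "m0 = ratio (p $ 1) (p $ 2)"
  define a0 where "a0 = Ln (1 + u0)"
  define M where "M = (\<lambda>\<tau>. m0 / (1 + m0 * \<tau>))"
  define \<alpha> where "\<alpha> = (\<lambda>\<tau>. a0 - \<tau> + Ln (1 + m0 * \<tau>))"
  define f where "f = (\<lambda>\<tau>. T (M \<tau>) (\<alpha> \<tau>))"
  define C where "C = (T m0 a0)\<^sup>2 + 2 * a0"
  have u: "u0 \<noteq> 0" "norm u0 < dl" using u0 V0D[OF p] by (auto simp: u0_def)
  note su = small_u[OF u(2)]
  have m0: "m0 = s0 / (1 + u0)" by (simp add: m0_def ratio_def s0_def u0_def)
  have s0: "s0 = m0 * (1 + u0)" using su(1) by (simp add: m0)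
  have d: "(m0, a0) \<in> chart_dom" using ratio_in_chart_dom V0D[OF p] u0 by (simp add: m0_def a0_def u0_def)
  have p0: "plaqueY s0 u0 k 0 = p"
    using u vec3_collapse[of p] by (simp add: plaqueY_def s0_def k_def u0_def)
  obtain e1 where e1: "e1 > 0" "\<forall>\<tau>\<in>ball 0 e1.
      coordY s0 u0 \<tau> \<noteq> 0 \<and> plaqueY s0 u0 k \<tau> \<in> leaf Y_field V0 (plaqueY s0 u0 k 0)"
    using plaqueY_near[OF open_V0, of s0 u0 k 0] p0 p u(1) by auto
  have "((\<lambda>\<tau>. norm (m0 * \<tau>)) \<longlongrightarrow> norm (m0 * 0)) (nhds 0)"
    by (intro tendsto_intros filterlim_ident)
  then have ev1: "\<forall>\<^sub>F \<tau> in nhds 0. norm (m0 * \<tau>) < 1" by (rule order_tendstoD) simp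
  have "((\<lambda>\<tau>. \<bar>Im (\<alpha> \<tau>)\<bar>) \<longlongrightarrow> \<bar>Im (a0 - 0 + Ln (1 + m0 * 0))\<bar>) (nhds 0)"
    unfolding \<alpha>_def by (intro tendsto_intros filterlim_ident) auto
  moreover have "\<bar>Im (a0 - 0 + Ln (1 + m0 * 0))\<bar> < pi"
    using abs_Im_le_cmod[of a0] su(2) u(2) dl pi_gt3 by (simp add: a0_def)
  ultimately have ev2: "\<forall>\<^sub>F \<tau> in nhds 0. \<bar>Im (\<alpha> \<tau>)\<bar> < pi" by (rule order_tendstoD)
  have ev3: "\<forall>\<^sub>F \<tau> in nhds 0. (M \<tau>, \<alpha> \<tau>) \<in> chart_dom \<and> (f \<tau>)\<^sup>2 + 2 * \<alpha> \<tau> = C"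
    using T_invariant[OF d] by (simp add: M_def \<alpha>_def f_def C_def)
  have "\<forall>\<^sub>F \<tau> in nhds 0. \<tau> \<in> ball 0 (min e1 1)"
    by (rule eventually_nhds_in_open) (use e1 in auto)
  with ev1 ev2 ev3 have "\<forall>\<^sub>F \<tau> in nhds 0. norm (m0 * \<tau>) < 1 \<and> \<bar>Im (\<alpha> \<tau>)\<bar> < pi \<and>
      ((M \<tau>, \<alpha> \<tau>) \<in> chart_dom \<and> (f \<tau>)\<^sup>2 + 2 * \<alpha> \<tau> = C) \<and> \<tau> \<in> ball 0 (min e1 1)"
    (is "eventually ?P _")
    by eventually_elim simp
  then obtain e0 where e0: "e0 > 0" "\<forall>\<tau>. dist \<tau> 0 < e0 \<longrightarrow> ?P \<tau>"
    unfolding eventually_nhds_metric by blast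
  define e where "e = min e0 1"
  have all: "norm (m0 * \<tau>) < 1" "\<bar>Im (\<alpha> \<tau>)\<bar> < pi" "(M \<tau>, \<alpha> \<tau>) \<in> chart_dom" "(f \<tau>)\<^sup>2 + 2 * \<alpha> \<tau> = C" "\<tau> \<in> ball 0 e1"
    if "\<tau> \<in> ball 0 e" for \<tau>
    using e0(2)[rule_format, of \<tau>] that by (auto simp: e_def)
  have slit: "1 + z \<notin> \<real>\<^sub>\<le>\<^sub>0" if "norm z < 1" for z :: complex
    using that abs_Re_le_cmod[of z] by (auto simp: complex_nonpos_Reals_iff)
  have slit': "1 + m0 * \<tau> \<notin> \<real>\<^sub>\<le>\<^sub>0" if "\<tau> \<in> ball 0 e" for \<tau>
    using slit[OF all(1)[OF that]] .
  have w: "1 + m0 * \<tau> \<noteq> 0" if "\<tau> \<in> ball 0 e" for \<tau>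
    using slit'[OF that] by auto
  show ?thesis
  proof (rule that[of e f C, folded s0_def u0_def k_def])
    show "e > 0" "e \<le> 1" using e0(1) by (simp_all add: e_def)
    have "continuous_on (ball 0 e) M" unfolding M_def using w by (intro continuous_intros) auto
    moreover have "continuous_on (ball 0 e) \<alpha>" unfolding \<alpha>_def using slit' by (intro continuous_intros) auto
    ultimately have "continuous_on (ball 0 e) (\<lambda>\<tau>. (M \<tau>, \<alpha> \<tau>))" by (rule continuous_on_Pair)
    then have "continuous_on (ball 0 e) (\<lambda>\<tau>. T (fst (M \<tau>, \<alpha> \<tau>)) (snd (M \<tau>, \<alpha> \<tau>)))"
      by (rule continuous_on_compose2[OF continuous_on_T]) (use all(3) in blast)
    then show "continuous_on (ball 0 e) f" by (simp add: f_def)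
    show "\<forall>\<tau>\<in>ball 0 e. plaqueY s0 u0 k \<tau> \<in> leaf Y_field V0 p \<and> coordY s0 u0 \<tau> \<noteq> 0 \<and>
      (f \<tau>)\<^sup>2 \<noteq> C \<and> hmap (plaqueY s0 u0 k \<tau>) = plaqueX C k (f \<tau>)"
    proof
      fix \<tau> :: complex assume \<tau>: "\<tau> \<in> ball 0 e"
      have leaf: "plaqueY s0 u0 k \<tau> \<in> leaf Y_field V0 p" and c: "coordY s0 u0 \<tau> \<noteq> 0"
        using e1(2) all(5)[OF \<tau>] p0 by auto
      have V: "plaqueY s0 u0 k \<tau> \<in> V0" using leaf leaf_subset[OF p] by blast
      define cu where "cu = coordY s0 u0 \<tau>"
      have comp: "plaqueY s0 u0 k \<tau> $ 1 = slopeY s0 \<tau> * cu" "plaqueY s0 u0 k \<tau> $ 2 = cu"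
          "plaqueY s0 u0 k \<tau> $ 3 = k / cu"
        by (simp_all add: plaqueY_def cu_def)
      have cu: "cu \<noteq> 0" "norm cu < dl" using c V0D(2)[OF V] comp by (simp_all add: cu_def)
      have cu1: "1 + cu = exp (- \<tau>) * ((1 + u0) * (1 + m0 * \<tau>))"
        by (simp add: cu_def coordY_def s0 algebra_simps)
      have "exp (\<alpha> \<tau>) = 1 + cu"
        using su(3) w[OF \<tau>] by (simp add: \<alpha>_def exp_add exp_diff cu1 a0_def exp_minus field_simps)
      \<comment> \<open>The exponential identity determines \<open>\<alpha> \<tau>\<close> only up
        to multiples of \<open>2 * pi * \<i>\<close>; the bound on its imaginary part selects the
        principal value.\<close>
      then have Ln: "Ln (1 + cu) = \<alpha> \<tau>"
        using all(2)[OF \<tau>] by (intro Ln_unique) (auto simp: abs_less_iff)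
      have \<alpha>0: "\<alpha> \<tau> \<noteq> 0" using small_u(4)[OF cu(2)] cu(1) Ln by simp
      have "ratio (slopeY s0 \<tau> * cu) cu = slopeY s0 \<tau> / (1 + cu)" using cu(1) by (simp add: ratio_def)
      also have "\<dots> = M \<tau>" using su(1) w[OF \<tau>] unfolding cu1 slopeY_def M_def by (simp add: s0)
      finally have ratio: "ratio (slopeY s0 \<tau> * cu) cu = M \<tau>" .
      have sq: "(f \<tau>)\<^sup>2 - C = - 2 * \<alpha> \<tau>" using all(4)[OF \<tau>] by (simp add: algebra_simps)
      have "(f \<tau>)\<^sup>2 \<noteq> C" using sq \<alpha>0 by auto
      moreover have "hmap (plaqueY s0 u0 k \<tau>) = plaqueX C k (f \<tau>)"
        using hmap_alt[OF V] cu(1) unfolding comp Ln ratio plaqueX_def sq by (simp add: f_def mult_ac)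
      ultimately show "plaqueY s0 u0 k \<tau> \<in> leaf Y_field V0 p \<and> coordY s0 u0 \<tau> \<noteq> 0 \<and>
        (f \<tau>)\<^sup>2 \<noteq> C \<and> hmap (plaqueY s0 u0 k \<tau>) = plaqueX C k (f \<tau>)"
      using leaf c by blast
    qed
  qed
qed

lemma open_hmap: "open (hmap ` V0)"
  using continuous_on_hmap open_V0 inj_on_hmap by (rule invariance_of_domain)

lemma hmap_plaqueY0: "hmap (plaqueY0 k v) = plaqueX0 k (- 2 * v)"
  using hmap_axis[of "plaqueY0 k v"] by (simp add: plaqueY0_def plaqueX0_def mult.commute)

lemma hmap_follows_leaves: "follows_leaves Y_field V0 X_field (hmap ` V0) hmap"
  unfolding follows_leaves_def
proof (intro allI impI)
  fix D \<phi> c assume \<phi>: "integral_curve Y_field V0 D \<phi>" and c: "c \<in> D"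
  have p: "\<phi> c \<in> V0" using \<phi> c by (simp add: integral_curve_def)
  from \<phi> c show "\<exists>r>0. ball c r \<subseteq> D \<and> (\<forall>t\<in>ball c r. hmap (\<phi> t) \<in> leaf X_field (hmap ` V0) (hmap (\<phi> c)))"
  proof (cases rule: integral_curve_Y)
    case (1 r \<tau>)
    define k where "k = \<phi> c $ 2 * \<phi> c $ 3"
    obtain e C f where e: "e > 0" "continuous_on (ball 0 e) f"
      "\<forall>\<tau>\<in>ball 0 e. plaqueY (\<phi> c $ 1 / \<phi> c $ 2) (\<phi> c $ 2) k \<tau> \<in> leaf Y_field V0 (\<phi> c) \<and>
        coordY (\<phi> c $ 1 / \<phi> c $ 2) (\<phi> c $ 2) \<tau> \<noteq> 0 \<and> (f \<tau>)\<^sup>2 \<noteq> C \<and>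
        hmap (plaqueY (\<phi> c $ 1 / \<phi> c $ 2) (\<phi> c $ 2) k \<tau>) = plaqueX C k (f \<tau>)"
      unfolding k_def by (rule hmap_plaque[OF p 1(5)])
    obtain r1 where r1: "0 < r1" "r1 \<le> r" "\<forall>t\<in>ball c r1. \<tau> t \<in> ball 0 e"
      using ball_preimage[OF 1(3,1) open_ball[of 0 e]] 1(4) e(1) by auto
    have sub: "ball c r1 \<subseteq> ball c r" using r1(2) by auto
    have h: "hmap (\<phi> t) = plaqueX C k (f (\<tau> t)) \<and> (f (\<tau> t))\<^sup>2 \<noteq> C" if "t \<in> ball c r1" for t
    proof -
      have "\<tau> t \<in> ball 0 e" "t \<in> ball c r" using r1(3) that sub by blast+
      then show ?thesis using 1(6)[of t] e(3) by (auto simp: k_def simp del: mem_ball)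
    qed
    have cb: "c \<in> ball c r1" using r1(1) by simp
    have "plaqueX C k (f (\<tau> c)) \<in> hmap ` V0" using h[OF cb] imageI[OF p, of hmap] by simp
    then obtain e2 where e2: "e2 > 0"
      "\<forall>s\<in>ball (f (\<tau> c)) e2. s\<^sup>2 \<noteq> C \<and> plaqueX C k s \<in> leaf X_field (hmap ` V0) (plaqueX C k (f (\<tau> c)))"
      using plaqueX_near[OF open_hmap, of C k "f (\<tau> c)"] h[OF cb] by blast
    have cf: "continuous_on (ball c r1) (\<lambda>t. f (\<tau> t))"
      by (rule continuous_on_compose2[OF e(2) continuous_on_subset[OF 1(3) sub]]) (use r1(3) in blast)
    obtain r2 where r2: "0 < r2" "r2 \<le> r1" "\<forall>t\<in>ball c r2. f (\<tau> t) \<in> ball (f (\<tau> c)) e2"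
      using ball_preimage[OF cf r1(1) open_ball[of "f (\<tau> c)" e2]] e2(1) by (auto simp del: mem_ball)
    show ?thesis
    proof (intro exI[of _ r2] conjI ballI)
      show "ball c r2 \<subseteq> D" using r2(2) r1(2) 1(2) by auto
      fix t assume t: "t \<in> ball c r2"
      then have "t \<in> ball c r1" using r2(2) by auto
      then show "hmap (\<phi> t) \<in> leaf X_field (hmap ` V0) (hmap (\<phi> c))"
        using h h[OF cb] e2(2) r2(3) t by simp
    qed (rule r2(1))
  next
    case (2 r f k)
    have cb: "c \<in> ball c r" using 2(1) by simp
    have h: "hmap (\<phi> t) = plaqueX0 k (- 2 * f t)" if "t \<in> ball c r" for t
      using 2(5)[OF that] hmap_plaqueY0 by simp
    have "plaqueX0 k (- 2 * f c) \<in> hmap ` V0" using h[OF cb] imageI[OF p, of hmap] by simp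
    then obtain e2 where e2: "e2 > 0"
      "\<forall>s\<in>ball (- 2 * f c) e2. s \<noteq> 0 \<and> plaqueX0 k s \<in> leaf X_field (hmap ` V0) (plaqueX0 k (- 2 * f c))"
      using plaqueX0_near[OF open_hmap, of k "- 2 * f c"] 2(5)[OF cb] by auto
    have cf: "continuous_on (ball c r) (\<lambda>t. - 2 * f t)" using 2(3) by (intro continuous_intros)
    obtain r2 where r2: "0 < r2" "r2 \<le> r" "\<forall>t\<in>ball c r2. - 2 * f t \<in> ball (- 2 * f c) e2"
      using ball_preimage[OF cf 2(1) open_ball[of "- 2 * f c" e2]] e2(1) by (auto simp del: mem_ball)
    show ?thesis
    proof (intro exI[of _ r2] conjI ballI)
      show "ball c r2 \<subseteq> D" using r2(2) 2(2) by auto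
      fix t assume t: "t \<in> ball c r2"
      then have "t \<in> ball c r" using r2(2) by auto
      then show "hmap (\<phi> t) \<in> leaf X_field (hmap ` V0) (hmap (\<phi> c))"
        using h h[OF cb] e2(2) r2(3) t by simp
    qed (rule r2(1))
  next
    case (3 r)
    show ?thesis
    proof (intro exI[of _ r] conjI ballI 3(1,2))
      fix t assume "t \<in> ball c r"
      then have "\<phi> t = \<phi> c" by (rule 3(3))
      then show "hmap (\<phi> t) \<in> leaf X_field (hmap ` V0) (hmap (\<phi> c))" by (simp only: leaf_refl)
    qed
  qed
qed

text \<open>Nearby slopes on the leaf of \<open>X\<close> must be lifted to the plaque of
  \<open>Y\<close> through \<open>p\<close>. The parameter map \<open>F\<close> is injective because
  \<open>hmap\<close> and the plaque are, so by invariance of domain its image contains all slopes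
  close to \<open>f c\<close>.\<close>

lemma hmap_inverse_follows_leaves:
  assumes g: "\<And>p. p \<in> V0 \<Longrightarrow> g (hmap p) = p"
  shows "follows_leaves X_field (hmap ` V0) Y_field V0 g"
  unfolding follows_leaves_def
proof (intro allI impI)
  fix D \<phi> c assume \<phi>: "integral_curve X_field (hmap ` V0) D \<phi>" and c: "c \<in> D"
  have "\<phi> c \<in> hmap ` V0" using \<phi> c by (simp add: integral_curve_def)
  then obtain p where p: "p \<in> V0" "hmap p = \<phi> c" by auto
  have gp: "g (\<phi> c) = p" using g p by metis
  have u: "norm (p $ 2) < dl" using V0D[OF p(1)] by blast
  have x: "\<phi> c $ 1 = 0 \<longleftrightarrow> p $ 2 = 0"
    using small_u(4)[OF u] unfolding p(2)[symmetric] by (simp add: hmap_def)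
  from \<phi> c show "\<exists>r>0. ball c r \<subseteq> D \<and> (\<forall>t\<in>ball c r. g (\<phi> t) \<in> leaf Y_field V0 (g (\<phi> c)))"
  proof (cases rule: integral_curve_X)
    case (1 r f C w)
    have cb: "c \<in> ball c r" using 1(1) by simp
    have u0: "p $ 2 \<noteq> 0" using 1(4) x by simp
    define s0 where "s0 = p $ 1 / p $ 2"
    define k where "k = p $ 2 * p $ 3"
    obtain e C' F where e: "e > 0" "e \<le> 1" "continuous_on (ball 0 e) F"
      "\<forall>\<tau>\<in>ball 0 e. plaqueY s0 (p $ 2) k \<tau> \<in> leaf Y_field V0 p \<and> coordY s0 (p $ 2) \<tau> \<noteq> 0 \<and>
        (F \<tau>)\<^sup>2 \<noteq> C' \<and> hmap (plaqueY s0 (p $ 2) k \<tau>) = plaqueX C' k (F \<tau>)"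
      unfolding k_def s0_def by (rule hmap_plaque[OF p(1) u0])
    have pl: "plaqueY s0 (p $ 2) k \<tau> \<in> leaf Y_field V0 p" "coordY s0 (p $ 2) \<tau> \<noteq> 0" "(F \<tau>)\<^sup>2 \<noteq> C'"
        "hmap (plaqueY s0 (p $ 2) k \<tau>) = plaqueX C' k (F \<tau>)" "plaqueY s0 (p $ 2) k \<tau> \<in> V0"
      if "\<tau> \<in> ball 0 e" for \<tau>
      using e(4) that leaf_subset[OF p(1)] by blast+
    have e0: "0 \<in> ball (0::complex) e" using e(1) by simp
    have p0: "plaqueY s0 (p $ 2) k 0 = p"
      using u0 vec3_collapse[of p] by (simp add: plaqueY_def s0_def k_def)
    have eq: "plaqueX C w (f c) = plaqueX C' k (F 0)" using 1(5)[OF cb] pl(4)[OF e0] p0 p(2) by simp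
    have fc: "(f c)\<^sup>2 \<noteq> C" using 1(5)[OF cb] by blast
    \<comment> \<open>Both plaques of \<open>X\<close> pass through \<open>\<phi> c\<close>, so
      their constants agree and equal slopes mean equal points.\<close>
    note same = plaqueX_eqD[OF eq fc pl(3)[OF e0]]
    have "inj_on F (ball 0 e)"
    proof (rule inj_onI)
      fix \<tau> \<tau>' assume t: "\<tau> \<in> ball 0 e" "\<tau>' \<in> ball 0 e" and eq: "F \<tau> = F \<tau>'"
      have "hmap (plaqueY s0 (p $ 2) k \<tau>) = hmap (plaqueY s0 (p $ 2) k \<tau>')"
        using pl(4)[OF t(1)] pl(4)[OF t(2)] eq by simp
      then have same: "plaqueY s0 (p $ 2) k \<tau> = plaqueY s0 (p $ 2) k \<tau>'"
        by (rule inj_onD[OF inj_on_hmap _ pl(5)[OF t(1)] pl(5)[OF t(2)]])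
      have "p $ 2 \<noteq> - 1" using u dl by auto
      from inj_onD[OF inj_on_plaqueY[OF this] same] show "\<tau> = \<tau>'"
        using t e(2) pl(2)[OF t(1)] pl(2)[OF t(2)] by simp
    qed
    then have "open (F ` ball 0 e)"
      using e(3) by (intro invariance_of_domain) auto
    moreover have "f c \<in> F ` ball 0 e" using same(1) e0 by blast
    ultimately obtain r2 where r2: "0 < r2" "r2 \<le> r" "\<forall>t\<in>ball c r2. f t \<in> F ` ball 0 e"
      using ball_preimage[OF 1(3,1)] by blast
    show ?thesis
    proof (intro exI[of _ r2] conjI ballI)
      show "ball c r2 \<subseteq> D" using r2(2) 1(2) by auto
      fix t assume t: "t \<in> ball c r2"
      then have tr: "t \<in> ball c r" using r2(2) by auto
      obtain \<tau> where \<tau>: "\<tau> \<in> ball 0 e" "f t = F \<tau>" using r2(3) t by blast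
      have "\<phi> t = hmap (plaqueY s0 (p $ 2) k \<tau>)"
        using 1(5)[OF tr] pl(4)[OF \<tau>(1)] \<tau>(2) same by simp
      then show "g (\<phi> t) \<in> leaf Y_field V0 (g (\<phi> c))"
        using g pl(1,5)[OF \<tau>(1)] gp by simp
    qed (rule r2(1))
  next
    case (2 r f k)
    have cb: "c \<in> ball c r" using 2(1) by simp
    have u0: "p $ 2 = 0" using 2(4) x by simp
    have f: "f c \<noteq> 0" "\<phi> c = plaqueX0 k (f c)" using 2(5)[OF cb] by auto
    have comp: "hmap p $ i = plaqueX0 k (f c) $ i" for i using p(2) f(2) by simp
    have p13: "f c = - 2 * p $ 1" "- p $ 3 / 2 = k / f c"
      using comp[of 2] comp[of 3] hmap_axis[OF u0] by (simp_all add: plaqueX0_def)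
    have "p $ 3 = - 2 * (- p $ 3 / 2)" by simp
    also have "\<dots> = k / (- f c / 2)" unfolding p13(2) by simp
    finally have "p $ 3 = k / (- f c / 2)" .
    moreover have "p $ 1 = - f c / 2" unfolding p13(1) by simp
    ultimately have pk: "plaqueY0 k (- f c / 2) = p"
      using u0 vec3_collapse[of p] by (simp add: plaqueY0_def)
    obtain e2 where e2: "e2 > 0"
      "\<forall>s\<in>ball (- f c / 2) e2. s \<noteq> 0 \<and> plaqueY0 k s \<in> leaf Y_field V0 p"
      using plaqueY0_near[OF open_V0, of k "- f c / 2"] f(1) p(1) unfolding pk by (auto simp del: mem_ball)
    have cf: "continuous_on (ball c r) (\<lambda>t. - f t / 2)" using 2(3) by (intro continuous_intros) auto
    obtain r2 where r2: "0 < r2" "r2 \<le> r" "\<forall>t\<in>ball c r2. - f t / 2 \<in> ball (- f c / 2) e2"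
      using ball_preimage[OF cf 2(1) open_ball[of "- f c / 2" e2]] e2(1) by (auto simp del: mem_ball)
    show ?thesis
    proof (intro exI[of _ r2] conjI ballI)
      show "ball c r2 \<subseteq> D" using r2(2) 2(2) by auto
      fix t assume t: "t \<in> ball c r2"
      then have "t \<in> ball c r" using r2(2) by auto
      then have "\<phi> t = hmap (plaqueY0 k (- f t / 2))" using 2(5)[of t] by (simp add: hmap_plaqueY0)
      moreover have l: "plaqueY0 k (- f t / 2) \<in> leaf Y_field V0 p" using e2(2) r2(3) t by blast
      moreover have "plaqueY0 k (- f t / 2) \<in> V0" using l leaf_subset[OF p(1)] by blast
      ultimately show "g (\<phi> t) \<in> leaf Y_field V0 (g (\<phi> c))"
        using g gp by simp
    qed (rule r2(1))
  next
    case (3 r)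
    show ?thesis
    proof (intro exI[of _ r] conjI ballI 3(1,2))
      fix t assume "t \<in> ball c r"
      then have "\<phi> t = \<phi> c" by (rule 3(3))
      then show "g (\<phi> t) \<in> leaf Y_field V0 (g (\<phi> c))" by (simp only: leaf_refl)
    qed
  qed
qed

lemma hmap_sing:
  assumes p: "p \<in> V0"
  shows "hmap p \<in> sing X_field \<longleftrightarrow> p \<in> sing Y_field"
proof -
  have u: "norm (p $ 2) < dl" using V0D[OF p] by blast
  have "hmap p \<in> sing X_field \<longleftrightarrow> p $ 1 = 0 \<and> p $ 2 = 0"
  proof (cases "p $ 2 = 0")
    case True
    then show ?thesis using hmap_axis[OF True] by (simp add: sing_X_field)
  next
    case False
    then show ?thesis using small_u(4)[OF u] by (simp add: sing_X_field hmap_def)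
  qed
  also have "\<dots> \<longleftrightarrow> p \<in> sing Y_field"
  proof
    assume "p \<in> sing Y_field"
    then have e: "p $ 1 = 0 \<or> p $ 1 - 2 * (p $ 2)\<^sup>2 - p $ 2 = 0" "p $ 2 = 0 \<or> p $ 1 - (p $ 2)\<^sup>2 - p $ 2 = 0"
      by (auto simp: sing_def Y_field_def Let_def vec_eq_iff forall_3)
    show "p $ 1 = 0 \<and> p $ 2 = 0"
    proof (cases "p $ 2 = 0")
      case False
      then have v: "p $ 1 = p $ 2 * (1 + p $ 2)"
        using e(2) by (simp add: algebra_simps power2_eq_square)
      then have "p $ 1 \<noteq> 0" using False small_u(1)[OF u] by simp
      then have "p $ 2 * p $ 2 = 0" using e(1) v by (simp add: algebra_simps power2_eq_square)
      then show ?thesis using False by simp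
    qed (use e in auto)
  qed (auto simp: sing_def Y_field_def Let_def vec_eq_iff forall_3)
  finally show ?thesis .
qed

text \<open>\<open>hmap\<close> runs from \<open>Y\<close> to \<open>X\<close>, so the required
  homeomorphism is its inverse \<open>g\<close>, defined on the open image.\<close>

lemma X_Y_equivalent: "topologically_equivalent X_field Y_field"
proof -
  obtain g where hg: "homeomorphism V0 (hmap ` V0) hmap g"
    by (rule invariance_of_domain_homeomorphism[OF open_V0 continuous_on_hmap order.refl inj_on_hmap])
  have g: "g (hmap p) = p" if "p \<in> V0" for p
    using hg that by (simp add: homeomorphism_def)
  have 0: "0 \<in> V0" using dl by (simp add: V0_def)
  have h0: "hmap 0 = 0" using hmap_axis[of 0] by (simp add: vec_eq_iff forall_3)
  show ?thesis
  proof (rule topologically_equivalentI[OF open_hmap _ open_V0 0 homeomorphism_symD[OF hg]])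
    show "0 \<in> hmap ` V0" using 0 h0 by (metis imageI)
    show "g 0 = 0" using g[OF 0] h0 by simp
    show "g p \<in> sing Y_field \<longleftrightarrow> p \<in> sing X_field" if "p \<in> hmap ` V0" for p
      using that g hmap_sing by auto
  qed (rule hmap_inverse_follows_leaves[OF g] hmap_follows_leaves; assumption?)+
qed

end

theorem theorem1p1:
  "topologically_equivalent X_field Y_field \<and>
   (\<exists>F G. first_integral X_field F \<and> first_integral X_field G \<and> independent_integrals F G) \<and>
   \<not> (\<exists>F G. first_integral Y_field F \<and> first_integral Y_field G \<and> independent_integrals F G)"
proof (intro conjI notI)
  obtain \<kappa> \<rho> where "tangency_chart \<kappa> \<rho>" using tangency_chart_exists by blast
  then show "topologically_equivalent X_field Y_field" by (rule tangency_chart.X_Y_equivalent)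
  show "\<exists>F G. first_integral X_field F \<and> first_integral X_field G \<and> independent_integrals F G"
    by (rule X_first_integrals)
  assume "\<exists>F G. first_integral Y_field F \<and> first_integral Y_field G \<and> independent_integrals F G"
  then show False using Y_dependent_integrals by blast
qed

end
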